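(* Let $X$ be a path connected, locally path connected, paracompact Hausdorff space with basepoint $x_0$, give $\pi_1(X,x_0)$ the shape topology, and let $H$ be a subgroup of $\pi_1(X,x_0)$. The following are equivalent: (1) $H$ is open in $\pi_1(X,x_0)$. (2) There is an open cover $\mathscr{U}$ of $X$ such that $\pi^{Sp}(\mathscr{U},x_0)\subseteq H$. (3) There is a covering map $r:Y\to X$ (in the classical sense) with $r(y_0)=x_0$ such that $r_\ast(\pi_1(Y,y_0))=H$.
   Context: Paths are continuous maps from $[0,1]$, $\overline{\alpha}$ is the reverse path, and $[\alpha][\beta]=[\alpha\ast\beta]$ denotes concatenation of homotopy classes rel. endpoints. For an open cover $\mathscr{U}$ of $X$, the Spanier group $\pi^{Sp}(\mathscr{U},x_0)$ is the subgroup of $\pi_1(X,x_0)$ generated by all elements $[\alpha][\gamma][\overline{\alpha}]$ where $\alpha$ is a path with $\alpha(0)=x_0$ and $\gamma$ is a loop based at $\alpha(1)$ with image in some $U\in\mathscr{U}$. First shape group. Consider pairs $(\mathscr{U},U_0)$ with $\mathscr{U}$ an open cover of $X$ and $x_0\in U_0\in\mathscr{U}$. $(\mathscr{V},V_0)$ refines $(\mathscr{U},U_0)$ if $\mathscr{V}$ refines $\mathscr{U}$ and $V_0\subseteq U_0$. The nerve $N(\mathscr{U})$ is the abstract simplicial complex with vertex set $\mathscr{U}$, in which $A_0,\dots,A_n$ span a simplex iff $\bigcap_i A_i\neq\emptyset$; $|N(\mathscr{U})|$ is its geometric realization, based at the vertex $U_0$. Let $\Lambda$ be the set of pairs $(\mathscr{U},U_0)$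 admitting a partition of unity $\{\phi_U\}_{U\in\mathscr{U}}$ subordinated to $\mathscr{U}$ with $\phi_{U_0}(x_0)=1$, directed by refinement. If $(\mathscr{V},V_0)$ refines $(\mathscr{U},U_0)$, any vertex assignment $V\mapsto U$ with $V\subseteq U$ and $V_0\mapsto U_0$ defines a simplicial map $N(\mathscr{V})\to N(\mathscr{U})$ whose realization is unique up to based homotopy; the induced homomorphism is $p_{\mathscr{U}\mathscr{V}\ast}:\pi_1(|N(\mathscr{V})|,V_0)\to\pi_1(|N(\mathscr{U})|,U_0)$. Set $\check{\pi}_1(X,x_0)=\varprojlim(\pi_1(|N(\mathscr{U})|,U_0),p_{\mathscr{U}\mathscr{V}\ast},\Lambda)$. A canonical map for $(\mathscr{U},U_0)$ is a continuous map $p_{\mathscr{U}}:X\to|N(\mathscr{U})|$ with $p_{\mathscr{U}}(x_0)=U_0$ and $p_{\mathscr{U}}^{-1}(St(U,N(\mathscr{U})))\subseteq U$ for all $U\in\mathscr{U}$, where $St(U,N(\mathscr{U}))$ is the open star of the vertex $U$. For $(\mathscr{U},U_0)\in\Lambda$ canonical maps exist and are unique up to based homotopy, and they are compatible with the maps $p_{\mathscr{U}\mathscr{V}\ast}$ on $\pi_1$. Define $\Psi_X:\pi_1(X,x_0)\to\check{\pi}_1(X,x_0)$ by $\Psi_X([\alpha])=([p_{\mathscr{U}}\circ\alpha])_{(\mathscr{U},U_0)\in\Lambda}$. Shape topology. Topologize $\check{\pi}_1(X,x_0)$ as a subspace of the product $\prod_{\Lambda}\pi_1(|N(\mathscr{U})|,U_0)$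 of discrete groups. The shape topology on $\pi_1(X,x_0)$ has as open sets exactly the sets $\Psi_X^{-1}(W)$ with $W$ open in $\check{\pi}_1(X,x_0)$; it is a group topology. *)

theory Defs
  imports "HOL-Analysis.Analysis" "HOL-Algebra.Generated_Groups"
begin

section \<open>The fundamental group of an abstract topological space\<close>

text \<open>A path is a function on the reals of which only the restriction to \<open>{0..1}\<close> matters.
  The library's \<open>joinpaths\<close>, \<open>reversepath\<close> and \<open>homotopic_paths\<close> require the ambient type to be
  in class \<open>topological_space\<close>; the following are their counterparts for an explicit topology.\<close>

definition path_concat :: "(real \<Rightarrow> 'a) \<Rightarrow> (real \<Rightarrow> 'a) \<Rightarrow> real \<Rightarrow> 'a" (infixr \<open>\<star>\<close> 75)
  where "p \<star> q = (\<lambda>s. if s \<le> 1/2 then p (2 * s) else q (2 * s - 1))"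

definition path_rev :: "(real \<Rightarrow> 'a) \<Rightarrow> real \<Rightarrow> 'a"
  where "path_rev p = (\<lambda>s. p (1 - s))"

definition path_homotopic :: "'a topology \<Rightarrow> (real \<Rightarrow> 'a) \<Rightarrow> (real \<Rightarrow> 'a) \<Rightarrow> bool"
  where "path_homotopic X p q \<longleftrightarrow>
    homotopic_with (\<lambda>r. r 0 = p 0 \<and> r 1 = p 1) (top_of_set {0..1}) X p q"

definition path_class :: "'a topology \<Rightarrow> (real \<Rightarrow> 'a) \<Rightarrow> (real \<Rightarrow> 'a) set"
  where "path_class X p = {q. path_homotopic X p q}"

definition loops_at :: "'a topology \<Rightarrow> 'a \<Rightarrow> (real \<Rightarrow> 'a) set"
  where "loops_at X x0 = {p. pathin X p \<and> p 0 = x0 \<and> p 1 = x0}"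

text \<open>The product of two classes is the union of the classes of all products of representatives;
  by \<open>fundamental_group_mult\<close> below this is the class of any one of them.\<close>

definition fundamental_group :: "'a topology \<Rightarrow> 'a \<Rightarrow> (real \<Rightarrow> 'a) set monoid"
  where "fundamental_group X x0 =
    \<lparr>carrier = path_class X ` loops_at X x0,
     mult = (\<lambda>A B. \<Union>p\<in>A. \<Union>q\<in>B. path_class X (p \<star> q)),
     one = path_class X (\<lambda>_. x0)\<rparr>"

text \<open>The homomorphism induced by \<open>f\<close>; \<open>Y\<close> is the target space.\<close>

definition induced_hom :: "'b topology \<Rightarrow> ('a \<Rightarrow> 'b) \<Rightarrow> (real \<Rightarrow> 'a) set \<Rightarrow> (real \<Rightarrow> 'b) set"
  where "induced_hom Y f A = (\<Union>p\<in>A. path_class Y (f \<circ> p))"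


section \<open>Well-definedness of the fundamental group\<close>

lemma path_homotopic_iff:
  "path_homotopic X p q \<longleftrightarrow>
    (\<exists>h. continuous_map (prod_topology (top_of_set {0..1::real}) (top_of_set {0..1})) X h \<and>
      (\<forall>s. h (0, s) = p s) \<and> (\<forall>s. h (1, s) = q s) \<and>
      (\<forall>t\<in>{0..1}. h (t, 0) = p 0 \<and> h (t, 1) = p 1))"
  unfolding path_homotopic_def homotopic_with_def by simp

lemma path_homotopic_ends: "path_homotopic X p q \<Longrightarrow> q 0 = p 0 \<and> q 1 = p 1"
  unfolding path_homotopic_iff by (metis atLeastAtMost_iff order_refl zero_le_one)

lemma path_homotopic_pathin:
  assumes "path_homotopic X p q" shows "pathin X p" "pathin X q"
  using homotopic_with_imp_continuous_maps[OF assms[unfolded path_homotopic_def]]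
  unfolding pathin_def by auto

lemma path_homotopic_refl: "path_homotopic X p p \<longleftrightarrow> pathin X p"
  unfolding path_homotopic_def pathin_def by (simp add: homotopic_with_refl)

lemma path_homotopic_sym: "path_homotopic X p q \<Longrightarrow> path_homotopic X q p"
  using path_homotopic_ends[of X p q] unfolding path_homotopic_def
  by (simp add: homotopic_with_sym)

lemma path_homotopic_trans:
  "path_homotopic X p q \<Longrightarrow> path_homotopic X q r \<Longrightarrow> path_homotopic X p r"
  using path_homotopic_ends[of X p q] unfolding path_homotopic_def
  by (auto intro: homotopic_with_trans)

lemma path_class_eq: "path_homotopic X p q \<Longrightarrow> path_class X p = path_class X q"
  unfolding path_class_def by (blast intro: path_homotopic_trans path_homotopic_sym)

lemma path_class_self: "pathin X p \<Longrightarrow> p \<in> path_class X p"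
  by (simp add: path_class_def path_homotopic_refl)

lemma path_homotopic_reparam:
  assumes p: "pathin X p" and f: "continuous_on {0..1} f" "f \<in> {0..1} \<rightarrow> {0..1}"
    and g: "continuous_on {0..1} g" "g \<in> {0..1} \<rightarrow> {0..1}"
    and e: "f 0 = g 0" "f 1 = g 1"
  shows "path_homotopic X (p \<circ> f) (p \<circ> g)"
  unfolding path_homotopic_iff
proof (intro exI conjI)
  let ?k = "\<lambda>z::real \<times> real. (1 - fst z) * f (snd z) + fst z * g (snd z)"
  have "continuous_on ({0..1} \<times> {0..1}) ?k"
    by (intro continuous_intros continuous_on_compose2[OF f(1)] continuous_on_compose2[OF g(1)]) auto
  moreover have "?k z \<in> {0..1}" if "z \<in> {0..1} \<times> {0..1}" for z
  proof -
    have "0 \<le> f (snd z)" "f (snd z) \<le> 1" "0 \<le> g (snd z)" "g (snd z) \<le> 1"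
      using that f(2) g(2) by (auto simp: Pi_iff mem_Times_iff)
    then show ?thesis using that
      by (auto simp: mem_Times_iff intro!: convex_bound_le)
  qed
  ultimately have "continuous_map (top_of_set ({0..1} \<times> {0..1})) (top_of_set {0..1}) ?k"
    by (auto simp: Pi_iff)
  then show "continuous_map (prod_topology (top_of_set {0..1}) (top_of_set {0..1})) X (p \<circ> ?k)"
    using p unfolding pathin_def
    by (simp add: continuous_map_compose del: continuous_map_subtopology_eu)
qed (use e in \<open>auto simp: algebra_simps\<close>)

lemma path_homotopic_concat:
  assumes "path_homotopic X p p'" "path_homotopic X q q'" "p 1 = q 0"
  shows "path_homotopic X (p \<star> q) (p' \<star> q')"
proof -
  let ?I = "top_of_set {0..1::real}"
  obtain h where h: "continuous_map (prod_topology ?I ?I) X h"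
      "\<And>s. h (0, s) = p s" "\<And>s. h (1, s) = p' s"
      "\<And>t. t \<in> {0..1} \<Longrightarrow> h (t, 0) = p 0" "\<And>t. t \<in> {0..1} \<Longrightarrow> h (t, 1) = p 1"
    using assms(1) unfolding path_homotopic_iff by metis
  obtain k where k: "continuous_map (prod_topology ?I ?I) X k"
      "\<And>s. k (0, s) = q s" "\<And>s. k (1, s) = q' s"
      "\<And>t. t \<in> {0..1} \<Longrightarrow> k (t, 0) = q 0" "\<And>t. t \<in> {0..1} \<Longrightarrow> k (t, 1) = q 1"
    using assms(2) unfolding path_homotopic_iff by metis
  have eq: "prod_topology ?I ?I = top_of_set ({0..1} \<times> {0..1})"
    by (auto simp: prod_topology_subtopology subtopology_subtopology Times_Int_Times)
  let ?m = "\<lambda>z. if snd z \<le> 1/2 then (h \<circ> (\<lambda>z. (fst z, 2 * snd z))) z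
                 else (k \<circ> (\<lambda>z. (fst z, 2 * snd z - 1))) z"
  have "continuous_map (prod_topology ?I ?I) X ?m"
  proof (rule continuous_map_cases_le)
    show "continuous_map (prod_topology ?I ?I) euclideanreal snd"
      unfolding eq by (simp add: continuous_on_snd)
    show "continuous_map (prod_topology ?I ?I) euclideanreal (\<lambda>x. 1/2)"
      by simp
    show "continuous_map (subtopology (prod_topology ?I ?I)
        {x \<in> topspace (prod_topology ?I ?I). snd x \<le> 1/2}) X (h \<circ> (\<lambda>z. (fst z, 2 * snd z)))"
      by (rule continuous_map_compose[OF _ h(1)])
        (auto simp: eq subtopology_subtopology intro!: continuous_intros)
    show "continuous_map (subtopology (prod_topology ?I ?I)
        {x \<in> topspace (prod_topology ?I ?I). 1/2 \<le> snd x}) X (k \<circ> (\<lambda>z. (fst z, 2 * snd z - 1)))"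
      by (rule continuous_map_compose[OF _ k(1)])
        (auto simp: eq subtopology_subtopology intro!: continuous_intros)
    fix x assume x: "x \<in> topspace (prod_topology ?I ?I)" "snd x = 1/2"
    then have "2 * snd x = 1" "2 * snd x - 1 = 0" by auto
    with x show "(h \<circ> (\<lambda>z. (fst z, 2 * snd z))) x = (k \<circ> (\<lambda>z. (fst z, 2 * snd z - 1))) x"
      using h(5)[of "fst x"] k(4)[of "fst x"] assms(3)
      by (auto simp: eq)
  qed
  then show ?thesis
    unfolding path_homotopic_iff
    by (intro exI[of _ ?m]) (use h k in \<open>auto simp: path_concat_def\<close>)
qed

lemma pathin_concat:
  assumes "pathin X p" "pathin X q" "p 1 = q 0" shows "pathin X (p \<star> q)"
  using path_homotopic_concat[of X p p q q] assms by (simp add: path_homotopic_refl)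

lemma path_concat_ends [simp]: "(p \<star> q) 0 = p 0" "(p \<star> q) 1 = q 1"
  by (auto simp: path_concat_def)

lemma pathin_rev: "pathin X p \<Longrightarrow> pathin X (path_rev p)"
proof -
  assume "pathin X p"
  then have "pathin X (p \<circ> (\<lambda>s. 1 - s))"
    using path_homotopic_reparam[of X p "\<lambda>s. 1 - s" "\<lambda>s. 1 - s"]
    by (simp add: path_homotopic_refl continuous_on_diff)
  then show ?thesis by (simp add: path_rev_def o_def)
qed

lemma path_homotopic_const_concat:
  assumes "pathin X p" "p 0 = x" shows "path_homotopic X ((\<lambda>_. x) \<star> p) p"
proof -
  have "path_homotopic X (p \<circ> (\<lambda>s. max 0 (2 * s - 1))) (p \<circ> (\<lambda>s. s))"
    by (rule path_homotopic_reparam) (use assms in \<open>auto intro!: continuous_intros\<close>)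
  moreover have "(p \<circ> (\<lambda>s. max 0 (2 * s - 1))) s = ((\<lambda>_. x) \<star> p) s" for s
    using assms by (cases "s \<le> 1/2") (simp_all add: path_concat_def)
  then have "p \<circ> (\<lambda>s. max 0 (2 * s - 1)) = (\<lambda>_. x) \<star> p" ..
  ultimately show ?thesis by (simp add: o_def)
qed

lemma path_homotopic_rev_concat:
  assumes "pathin X p" shows "path_homotopic X (path_rev p \<star> p) (\<lambda>_. p 1)"
proof -
  have "path_homotopic X (p \<circ> (\<lambda>s. \<bar>2 * s - 1\<bar>)) (p \<circ> (\<lambda>s. 1))"
    by (rule path_homotopic_reparam) (use assms in \<open>auto intro!: continuous_intros\<close>)
  moreover have "(p \<circ> (\<lambda>s. \<bar>2 * s - 1\<bar>)) s = (path_rev p \<star> p) s" for s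
    by (cases "s \<le> 1/2") (simp_all add: path_concat_def path_rev_def)
  then have "p \<circ> (\<lambda>s. \<bar>2 * s - 1\<bar>) = path_rev p \<star> p" ..
  ultimately show ?thesis by (simp add: o_def)
qed

lemma path_homotopic_assoc:
  assumes "pathin X p" "pathin X q" "pathin X r" "p 1 = q 0" "q 1 = r 0"
  shows "path_homotopic X ((p \<star> q) \<star> r) (p \<star> (q \<star> r))"
proof -
  let ?f = "\<lambda>s::real. min (min (2 * s) (s + 1/4)) ((s + 1) / 2)"
  have "pathin X (p \<star> (q \<star> r))"
    using assms by (intro pathin_concat) auto
  then have "path_homotopic X ((p \<star> (q \<star> r)) \<circ> ?f) ((p \<star> (q \<star> r)) \<circ> (\<lambda>s. s))"
    by (rule path_homotopic_reparam) (auto intro!: continuous_intros simp: min_le_iff_disj)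
  moreover have "((p \<star> (q \<star> r)) \<circ> ?f) s = ((p \<star> q) \<star> r) s" for s
  proof -
    consider "s \<le> 1/4" | "1/4 < s" "s \<le> 1/2" | "s > 1/2" by linarith
    then show ?thesis
    proof cases
      case 1
      then have "?f s = 2 * s" by (simp add: min_def)
      then show ?thesis using 1 by (simp add: path_concat_def)
    next
      case 2
      then have "?f s = s + 1/4" by (simp add: min_def)
      then show ?thesis using 2 by (auto simp: path_concat_def algebra_simps)
    next
      case 3
      then have "?f s = (s + 1) / 2" by (simp add: min_def)
      then have "((p \<star> (q \<star> r)) \<circ> ?f) s = r (2 * (2 * ((s + 1) / 2) - 1) - 1)"
        using 3 by (simp only: o_apply path_concat_def) simp
      also have "2 * (2 * ((s + 1) / 2) - 1) - 1 = 2 * s - 1" by argo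
      finally show ?thesis using 3 by (simp add: path_concat_def)
    qed
  qed
  then have "(p \<star> (q \<star> r)) \<circ> ?f = (p \<star> q) \<star> r" ..
  ultimately show ?thesis by (simp add: o_def)
qed

lemma fundamental_group_mult:
  assumes "p \<in> loops_at X x0" "q \<in> loops_at X x0"
  shows "path_class X p \<otimes>\<^bsub>fundamental_group X x0\<^esub> path_class X q = path_class X (p \<star> q)"
proof -
  have "path_class X (p' \<star> q') = path_class X (p \<star> q)"
    if "p' \<in> path_class X p" "q' \<in> path_class X q" for p' q'
    by (metis (mono_tags, lifting) that assms loops_at_def mem_Collect_eq path_class_def
        path_class_eq path_homotopic_concat)
  moreover have "p \<in> path_class X p" "q \<in> path_class X q"
    using assms by (auto simp: loops_at_def intro: path_class_self)
  ultimately have "(\<Union>p'\<in>path_class X p. \<Union>q'\<in>path_class X q. path_class X (p' \<star> q')) =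
      path_class X (p \<star> q)"
    by blast
  then show ?thesis
    by (simp add: fundamental_group_def)
qed

lemma group_fundamental_group:
  assumes "x0 \<in> topspace X" shows "group (fundamental_group X x0)"
proof (rule groupI)
  have carr: "carrier (fundamental_group X x0) = path_class X ` loops_at X x0"
    and one: "\<one>\<^bsub>fundamental_group X x0\<^esub> = path_class X (\<lambda>_. x0)"
    by (simp_all add: fundamental_group_def)
  have const: "(\<lambda>_. x0) \<in> loops_at X x0"
    using assms by (simp add: loops_at_def)
  have conc: "p \<star> q \<in> loops_at X x0" if "p \<in> loops_at X x0" "q \<in> loops_at X x0" for p q
    using that by (auto simp: loops_at_def pathin_concat)
  show "\<one>\<^bsub>fundamental_group X x0\<^esub> \<in> carrier (fundamental_group X x0)"
    using const by (simp add: one carr)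
  fix A assume A: "A \<in> carrier (fundamental_group X x0)"
  then obtain p where p: "p \<in> loops_at X x0" "A = path_class X p" by (auto simp: carr)
  show "\<one>\<^bsub>fundamental_group X x0\<^esub> \<otimes>\<^bsub>fundamental_group X x0\<^esub> A = A"
    using p const path_homotopic_const_concat[of X p x0]
    by (simp add: one fundamental_group_mult) (auto simp: loops_at_def path_class_eq)
  have rev: "path_rev p \<in> loops_at X x0"
    using p by (auto simp: loops_at_def pathin_rev) (auto simp: path_rev_def)
  show "\<exists>B\<in>carrier (fundamental_group X x0).
      B \<otimes>\<^bsub>fundamental_group X x0\<^esub> A = \<one>\<^bsub>fundamental_group X x0\<^esub>"
    using p rev path_homotopic_rev_concat[of X p]
    by (intro bexI[of _ "path_class X (path_rev p)"])
      (auto simp: one carr fundamental_group_mult loops_at_def path_class_eq)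
  fix B assume "B \<in> carrier (fundamental_group X x0)"
  then obtain q where q: "q \<in> loops_at X x0" "B = path_class X q" by (auto simp: carr)
  show "A \<otimes>\<^bsub>fundamental_group X x0\<^esub> B \<in> carrier (fundamental_group X x0)"
    using p q conc by (simp add: fundamental_group_mult carr)
  fix C assume "C \<in> carrier (fundamental_group X x0)"
  then obtain r where r: "r \<in> loops_at X x0" "C = path_class X r" by (auto simp: carr)
  show "A \<otimes>\<^bsub>fundamental_group X x0\<^esub> B \<otimes>\<^bsub>fundamental_group X x0\<^esub> C =
      A \<otimes>\<^bsub>fundamental_group X x0\<^esub> (B \<otimes>\<^bsub>fundamental_group X x0\<^esub> C)"
    using p q r conc path_homotopic_assoc[of X p q r]
    by (simp add: fundamental_group_mult) (auto simp: loops_at_def path_class_eq)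
qed

lemma induced_hom_path_class:
  assumes "continuous_map X Y f" "pathin X p"
  shows "induced_hom Y f (path_class X p) = path_class Y (f \<circ> p)"
proof -
  have "path_class Y (f \<circ> q) = path_class Y (f \<circ> p)" if "q \<in> path_class X p" for q
  proof -
    have pq: "path_homotopic X p q"
      using that by (simp add: path_class_def)
    have "path_homotopic Y (f \<circ> p) (f \<circ> q)"
      unfolding path_homotopic_def
      by (rule homotopic_with_compose_continuous_map_left[OF pq[unfolded path_homotopic_def] assms(1)])
        auto
    then show ?thesis by (simp add: path_class_eq)
  qed
  then show ?thesis
    unfolding induced_hom_def using path_class_self[OF assms(2)] by blast
qed


section \<open>Open covers and Spanier groups\<close>

definition open_cover :: "'a topology \<Rightarrow> 'a set set \<Rightarrow> bool"
  where "open_cover X \<U> \<longleftrightarrow> (\<forall>U\<in>\<U>. openin X U) \<and> \<Union>\<U> = topspace X"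

definition refines :: "'a set set \<Rightarrow> 'a set set \<Rightarrow> bool"
  where "refines \<V> \<U> \<longleftrightarrow> (\<forall>V\<in>\<V>. \<exists>U\<in>\<U>. V \<subseteq> U)"

definition paracompact_space :: "'a topology \<Rightarrow> bool"
  where "paracompact_space X \<longleftrightarrow>
    (\<forall>\<U>. open_cover X \<U> \<longrightarrow> (\<exists>\<V>. open_cover X \<V> \<and> refines \<V> \<U> \<and> locally_finite_in X \<V>))"

definition spanier_group :: "'a topology \<Rightarrow> 'a set set \<Rightarrow> 'a \<Rightarrow> (real \<Rightarrow> 'a) set set"
  where "spanier_group X \<U> x0 = generate (fundamental_group X x0)
    {path_class X ((\<alpha> \<star> \<gamma>) \<star> path_rev \<alpha>) |\<alpha> \<gamma>.
       pathin X \<alpha> \<and> \<alpha> 0 = x0 \<and> \<gamma> \<in> loops_at X (\<alpha> 1) \<and> (\<exists>U\<in>\<U>. \<gamma> ` {0..1} \<subseteq> U)}"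


section \<open>Nerves and their geometric realizations\<close>

definition nerve :: "'a set set \<Rightarrow> 'a set set set"
  where "nerve \<U> = {\<sigma>. \<sigma> \<subseteq> \<U> \<and> finite \<sigma> \<and> \<sigma> \<noteq> {} \<and> \<Inter>\<sigma> \<noteq> {}}"

text \<open>A point of the realization of a complex \<open>K\<close> is its function of barycentric coordinates.\<close>

definition bary_support :: "('v \<Rightarrow> real) \<Rightarrow> 'v set"
  where "bary_support b = {v. b v \<noteq> 0}"

definition realization_points :: "'v set set \<Rightarrow> ('v \<Rightarrow> real) set"
  where "realization_points K =
    {b. (\<forall>v. 0 \<le> b v) \<and> bary_support b \<in> K \<and> (\<Sum>v\<in>bary_support b. b v) = 1}"

definition closed_simplex :: "'v set set \<Rightarrow> 'v set \<Rightarrow> ('v \<Rightarrow> real) set"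
  where "closed_simplex K \<sigma> = {b \<in> realization_points K. bary_support b \<subseteq> \<sigma>}"

text \<open>The weak topology: a set is open iff it is open in every closed simplex. The product
  topology on \<open>'v \<Rightarrow> real\<close> restricts to the Euclidean topology on each (finite) closed simplex.\<close>

definition realization :: "'v set set \<Rightarrow> ('v \<Rightarrow> real) topology"
  where "realization K = topology (\<lambda>W. W \<subseteq> realization_points K \<and>
    (\<forall>\<sigma>\<in>K. openin (top_of_set (closed_simplex K \<sigma>)) (W \<inter> closed_simplex K \<sigma>)))"

lemma openin_realization:
  "openin (realization K) W \<longleftrightarrow> W \<subseteq> realization_points K \<and>
    (\<forall>\<sigma>\<in>K. openin (top_of_set (closed_simplex K \<sigma>)) (W \<inter> closed_simplex K \<sigma>))"
proof -
  have "istopology (\<lambda>W. W \<subseteq> realization_points K \<and>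
    (\<forall>\<sigma>\<in>K. openin (top_of_set (closed_simplex K \<sigma>)) (W \<inter> closed_simplex K \<sigma>)))"
    unfolding istopology_def
  proof (intro conjI allI impI)
    fix S T assume "S \<subseteq> realization_points K \<and>
        (\<forall>\<sigma>\<in>K. openin (top_of_set (closed_simplex K \<sigma>)) (S \<inter> closed_simplex K \<sigma>))"
      and "T \<subseteq> realization_points K \<and>
        (\<forall>\<sigma>\<in>K. openin (top_of_set (closed_simplex K \<sigma>)) (T \<inter> closed_simplex K \<sigma>))"
    moreover have "S \<inter> T \<inter> closed_simplex K \<sigma> =
        (S \<inter> closed_simplex K \<sigma>) \<inter> (T \<inter> closed_simplex K \<sigma>)" for \<sigma>
      by auto
    ultimately show "S \<inter> T \<subseteq> realization_points K"
      "\<forall>\<sigma>\<in>K. openin (top_of_set (closed_simplex K \<sigma>)) (S \<inter> T \<inter> closed_simplex K \<sigma>)"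
      by (auto simp del: Int_iff simp: openin_Int)
  next
    fix \<K> assume K: "\<forall>W\<in>\<K>. W \<subseteq> realization_points K \<and>
        (\<forall>\<sigma>\<in>K. openin (top_of_set (closed_simplex K \<sigma>)) (W \<inter> closed_simplex K \<sigma>))"
    then show "\<Union>\<K> \<subseteq> realization_points K" by auto
    have "openin (top_of_set (closed_simplex K \<sigma>)) (\<Union>((\<lambda>W. W \<inter> closed_simplex K \<sigma>) ` \<K>))"
      if "\<sigma> \<in> K" for \<sigma>
      using K that by (intro openin_Union) auto
    then show "\<forall>\<sigma>\<in>K. openin (top_of_set (closed_simplex K \<sigma>)) (\<Union>\<K> \<inter> closed_simplex K \<sigma>)"
      by (simp only: Int_Union2) blast
  qed
  then show ?thesis
    unfolding realization_def by simp
qed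

lemma topspace_realization [simp]: "topspace (realization K) = realization_points K"
proof -
  have "realization_points K \<inter> closed_simplex K \<sigma> = closed_simplex K \<sigma>" for \<sigma>
    by (auto simp: closed_simplex_def)
  then have "openin (realization K) (realization_points K)"
    by (simp add: openin_realization)
  then show ?thesis
    by (meson openin_realization openin_subset openin_topspace subset_antisym)
qed

definition vertex_point :: "'v \<Rightarrow> 'v \<Rightarrow> real"
  where "vertex_point u = (\<lambda>v. if v = u then 1 else 0)"

definition open_star :: "'v set set \<Rightarrow> 'v \<Rightarrow> ('v \<Rightarrow> real) set"
  where "open_star K u = {b \<in> realization_points K. b u \<noteq> 0}"

text \<open>The affine extension to the realizations of the vertex map \<open>f\<close>.\<close>

definition realization_map :: "('v \<Rightarrow> 'w) \<Rightarrow> ('v \<Rightarrow> real) \<Rightarrow> 'w \<Rightarrow> real"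
  where "realization_map f b = (\<lambda>w. \<Sum>v | v \<in> bary_support b \<and> f v = w. b v)"


section \<open>The first shape group and the shape topology\<close>

text \<open>Partitions of unity are locally finite with closed supports. Dropping local finiteness, or
  only asking \<open>\<phi> U\<close> to vanish outside \<open>U\<close>, does not change \<open>shape_index\<close> below: with
  \<open>m x = (SUP U. \<phi> U x)\<close>, normalise \<open>max 0 (\<phi> U x - m x / 2)\<close>.\<close>

definition subordinated_partition ::
    "'a topology \<Rightarrow> 'a set set \<Rightarrow> ('a set \<Rightarrow> 'a \<Rightarrow> real) \<Rightarrow> bool"
  where "subordinated_partition X \<U> \<phi> \<longleftrightarrow>
    (\<forall>U\<in>\<U>. continuous_map X euclideanreal (\<phi> U)) \<and>
    (\<forall>U\<in>\<U>. \<forall>x\<in>topspace X. 0 \<le> \<phi> U x) \<and>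
    (\<forall>U\<in>\<U>. X closure_of {x \<in> topspace X. \<phi> U x \<noteq> 0} \<subseteq> U) \<and>
    (\<forall>x\<in>topspace X. \<exists>N. openin X N \<and> x \<in> N \<and> finite {U \<in> \<U>. \<exists>y\<in>N. \<phi> U y \<noteq> 0}) \<and>
    (\<forall>x\<in>topspace X. (\<Sum>U | U \<in> \<U> \<and> \<phi> U x \<noteq> 0. \<phi> U x) = 1)"

definition shape_index :: "'a topology \<Rightarrow> 'a \<Rightarrow> ('a set set \<times> 'a set) set"
  where "shape_index X x0 = {(\<U>, U0). open_cover X \<U> \<and> U0 \<in> \<U> \<and> x0 \<in> U0 \<and>
    (\<exists>\<phi>. subordinated_partition X \<U> \<phi> \<and> \<phi> U0 x0 = 1)}"

definition refines_pointed :: "'a set set \<times> 'a set \<Rightarrow> 'a set set \<times> 'a set \<Rightarrow> bool"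
  where "refines_pointed j i \<longleftrightarrow> refines (fst j) (fst i) \<and> snd j \<subseteq> snd i"

definition nerve_group :: "'a set set \<times> 'a set \<Rightarrow> (real \<Rightarrow> 'a set \<Rightarrow> real) set monoid"
  where "nerve_group i = fundamental_group (realization (nerve (fst i))) (vertex_point (snd i))"

definition vertex_assignment ::
    "'a set set \<times> 'a set \<Rightarrow> 'a set set \<times> 'a set \<Rightarrow> ('a set \<Rightarrow> 'a set) \<Rightarrow> bool"
  where "vertex_assignment i j f \<longleftrightarrow>
    (\<forall>V\<in>fst j. f V \<in> fst i \<and> V \<subseteq> f V) \<and> f (snd j) = snd i"

text \<open>The bonding homomorphism from \<open>nerve_group j\<close> to \<open>nerve_group i\<close>, for \<open>j\<close> refining \<open>i\<close>.
  It does not depend on the choice of the vertex assignment.\<close>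

definition bonding_hom :: "'a set set \<times> 'a set \<Rightarrow> 'a set set \<times> 'a set \<Rightarrow>
    (real \<Rightarrow> 'a set \<Rightarrow> real) set \<Rightarrow> (real \<Rightarrow> 'a set \<Rightarrow> real) set"
  where "bonding_hom i j = induced_hom (realization (nerve (fst i)))
    (realization_map (SOME f. vertex_assignment i j f))"

definition shape_group ::
    "'a topology \<Rightarrow> 'a \<Rightarrow> ('a set set \<times> 'a set \<Rightarrow> (real \<Rightarrow> 'a set \<Rightarrow> real) set) set"
  where "shape_group X x0 = {g \<in> (\<Pi>\<^sub>E i\<in>shape_index X x0. carrier (nerve_group i)).
    \<forall>i\<in>shape_index X x0. \<forall>j\<in>shape_index X x0.
      refines_pointed j i \<longrightarrow> bonding_hom i j (g j) = g i}"

definition shape_group_topology ::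
    "'a topology \<Rightarrow> 'a \<Rightarrow> ('a set set \<times> 'a set \<Rightarrow> (real \<Rightarrow> 'a set \<Rightarrow> real) set) topology"
  where "shape_group_topology X x0 = subtopology
    (product_topology (\<lambda>i. discrete_topology (carrier (nerve_group i))) (shape_index X x0))
    (shape_group X x0)"

definition canonical_map ::
    "'a topology \<Rightarrow> 'a \<Rightarrow> 'a set set \<times> 'a set \<Rightarrow> ('a \<Rightarrow> 'a set \<Rightarrow> real) \<Rightarrow> bool"
  where "canonical_map X x0 i p \<longleftrightarrow>
    continuous_map X (realization (nerve (fst i))) p \<and> p x0 = vertex_point (snd i) \<and>
    (\<forall>U\<in>fst i. {x \<in> topspace X. p x \<in> open_star (nerve (fst i)) U} \<subseteq> U)"

text \<open>The canonical homomorphism; it does not depend on the choice of the canonical maps.\<close>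

definition shape_hom :: "'a topology \<Rightarrow> 'a \<Rightarrow>
    (real \<Rightarrow> 'a) set \<Rightarrow> 'a set set \<times> 'a set \<Rightarrow> (real \<Rightarrow> 'a set \<Rightarrow> real) set"
  where "shape_hom X x0 A = (\<lambda>i\<in>shape_index X x0.
    induced_hom (realization (nerve (fst i))) (SOME p. canonical_map X x0 i p) A)"

definition shape_topology :: "'a topology \<Rightarrow> 'a \<Rightarrow> (real \<Rightarrow> 'a) set topology"
  where "shape_topology X x0 = pullback_topology
    (carrier (fundamental_group X x0)) (shape_hom X x0) (shape_group_topology X x0)"


section \<open>Covering maps\<close>

text \<open>The counterpart of the library's \<open>covering_space\<close> for explicit topologies.\<close>

definition covering_map :: "'b topology \<Rightarrow> 'a topology \<Rightarrow> ('b \<Rightarrow> 'a) \<Rightarrow> bool"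
  where "covering_map Y X r \<longleftrightarrow>
    continuous_map Y X r \<and> r ` topspace Y = topspace X \<and>
    (\<forall>x\<in>topspace X. \<exists>T. openin X T \<and> x \<in> T \<and>
      (\<exists>\<V>. \<Union>\<V> = {y \<in> topspace Y. r y \<in> T} \<and> (\<forall>V\<in>\<V>. openin Y V) \<and> pairwise disjnt \<V> \<and>
        (\<forall>V\<in>\<V>. homeomorphic_map (subtopology Y V) (subtopology X T) r)))"

text \<open>\<open>H\<close> is the image of the fundamental group of a pointed covering space whose points
  have type \<open>'b\<close>. HOL cannot quantify over \<open>'b\<close> inside a formula. The type \<open>(real \<Rightarrow> 'a) set\<close> is large
  enough for the standard construction (points are sets of paths in \<open>X\<close>); universality over
  all \<open>'b\<close> has to be asserted by a free type variable.\<close>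

definition covering_image :: "'b itself \<Rightarrow> 'a topology \<Rightarrow> 'a \<Rightarrow> (real \<Rightarrow> 'a) set set \<Rightarrow> bool"
  where "covering_image _ X x0 H \<longleftrightarrow>
    (\<exists>(Y :: 'b topology) y0 r. covering_map Y X r \<and> y0 \<in> topspace Y \<and> r y0 = x0 \<and>
      induced_hom X r ` carrier (fundamental_group Y y0) = H)"

end

theory Submission
  imports Defs
begin

text \<open>An open subgroup contains the kernel of \<open>\<pi>\<^sub>1\<close> of finitely many canonical maps, and a loop
  whose image under a canonical map stays in an open star is null there; so the cover by sets
  that each of these maps sends into some open star has its Spanier group in \<open>H\<close>.

  Conversely let the Spanier group of \<open>\<U>\<close> lie in \<open>H\<close>. A barycentric refinement yields a cover
  \<open>\<W>\<close> by path connected open sets such that any two that meet lie in one member of \<open>\<U>\<close>. The cosets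
  of paths from \<open>x0\<close> modulo \<open>H\<close> then split into sheets over the members of \<open>\<W>\<close>, which gives the
  covering. Lifting to sheets does not need continuity, only that a map is locally contained in members
  of \<open>\<W>\<close>. This replaces simplicial approximation: a nullhomotopy in the nerve of a refinement of
  \<open>\<W>\<close>, composed with a choice of a point in the intersection of each simplex, is such a map
  on the square, so its lift shows that a loop that is null in the nerve lies in \<open>H\<close>.

  Given a covering, conjugates of loops in evenly covered sets lift to loops.\<close>

section \<open>Paracompact Hausdorff spaces\<close>

text \<open>The sheet relation must forget which member of \<W> a short path ran through, since
  lifts pass from one member to the next. Two short paths with common ends may therefore use
  different members \<open>W\<close> and \<open>W'\<close>, and the loop that they bound lies only
  in \<open>W \<union> W'\<close>; this is why the refinement has to control unions of two meeting
  members. The price is that the relation is transitive only among points over one member, so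
  lifting works over small pieces of the domain and spreads by bisection. On the nerve side the
  obstacle is that covers may be infinite and not locally finite, so homotopies live in the weak
  topology. A choice of a point for each simplex jumps, but if \<open>h z\<close> has a nonzero
  coordinate at \<open>V\<close>, so has \<open>h z'\<close> for all nearby \<open>z'\<close>; all
  points chosen there lie in \<open>V\<close>. Openness of stars is thus the only property of the
  nullhomotopy that is used, and the subdivision takes place in the square instead of the
  nerve.\<close>

lemma closure_of_locally_finite_UN:
  assumes "locally_finite_in X \<O>" "\<B> \<subseteq> \<O>"
  shows "X closure_of \<Union>\<B> = (\<Union>B\<in>\<B>. X closure_of B)"
  by (rule closure_of_locally_finite_Union[OF locally_finite_in_subset[OF assms]])

lemma paracompact_spaceE:
  assumes "paracompact_space X" "open_cover X \<U>"
  obtains \<V> where "open_cover X \<V>" "refines \<V> \<U>" "locally_finite_in X \<V>"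
  using assms unfolding paracompact_space_def by blast

text \<open>Refine the given neighbourhoods, together with the complement of \<open>C\<close>, to a
  locally finite cover. The closure of the union of the members that meet \<open>C\<close> is then
  the union of their closures, each of which misses \<open>D\<close>. A point \<open>D\<close> gives
  regularity, and a closed \<open>D\<close> then gives normality.\<close>

lemma paracompact_separation:
  assumes "paracompact_space X" and C: "closedin X C" and D: "D \<subseteq> topspace X"
    and sep: "\<And>c. c \<in> C \<Longrightarrow> \<exists>U. openin X U \<and> c \<in> U \<and> disjnt D (X closure_of U)"
  shows "\<exists>U. openin X U \<and> C \<subseteq> U \<and> disjnt D (X closure_of U)"
proof -
  define \<U> where "\<U> = insert (topspace X - C) {U. openin X U \<and> disjnt D (X closure_of U)}"
  have "open_cover X \<U>"
    unfolding open_cover_def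
  proof
    show "\<forall>U\<in>\<U>. openin X U"
      using C by (auto simp: \<U>_def)
    then have "U \<subseteq> topspace X" if "U \<in> \<U>" for U
      using that openin_subset by metis
    moreover have "x \<in> \<Union>\<U>" if "x \<in> topspace X" for x
      using that sep[of x] by (cases "x \<in> C") (auto simp: \<U>_def)
    ultimately show "\<Union>\<U> = topspace X"
      by (metis (no_types, lifting) Union_least subsetI subset_antisym)
  qed
  then obtain \<V> where \<V>: "open_cover X \<V>" "refines \<V> \<U>" "locally_finite_in X \<V>"
    by (rule paracompact_spaceE[OF assms(1)])
  let ?\<B> = "{V \<in> \<V>. V \<inter> C \<noteq> {}}"
  have "disjnt D (X closure_of V)" if V: "V \<in> ?\<B>" for V
  proof -
    obtain U where "U \<in> \<U>" "V \<subseteq> U"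
      using V \<V>(2) unfolding refines_def by blast
    moreover from this have "U \<noteq> topspace X - C"
      using V by blast
    ultimately have "disjnt D (X closure_of U)" "V \<subseteq> U"
      by (auto simp: \<U>_def)
    then show ?thesis
      by (meson closure_of_mono disjnt_subset2)
  qed
  then have "disjnt D (X closure_of \<Union>?\<B>)"
    by (subst closure_of_locally_finite_UN[OF \<V>(3)]) (auto simp: disjnt_def)
  moreover have "openin X (\<Union>?\<B>)"
    using \<V>(1) by (auto simp: open_cover_def)
  moreover have "C \<subseteq> \<Union>?\<B>"
    using \<V>(1) closedin_subset[OF C] by (fastforce simp: open_cover_def)
  ultimately show ?thesis
    by blast
qed

lemma paracompact_Hausdorff_imp_regular_space:
  assumes "paracompact_space X" "Hausdorff_space X"
  shows "regular_space X"
  unfolding regular_space_def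
proof (intro allI impI)
  fix C a assume *: "closedin X C \<and> a \<in> topspace X - C"
  have "\<exists>U. openin X U \<and> c \<in> U \<and> disjnt {a} (X closure_of U)" if "c \<in> C" for c
  proof -
    have "c \<in> topspace X" "c \<noteq> a"
      using * that closedin_subset by blast+
    then obtain U V where "openin X U" "openin X V" "c \<in> U" "a \<in> V" "disjnt U V"
      using assms(2) * unfolding Hausdorff_space_def by blast
    then show ?thesis
      using openin_Int_closure_of_eq_empty[of X V U] by (fastforce simp: disjnt_def)
  qed
  then obtain U where U: "openin X U" "C \<subseteq> U" "disjnt {a} (X closure_of U)"
    using paracompact_separation[OF assms(1), of C "{a}"] * by blast
  then have "a \<in> topspace X - X closure_of U" "disjnt (topspace X - X closure_of U) U"
    using * closure_of_subset[OF openin_subset[OF U(1)]] by (auto simp: disjnt_def)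
  then show "\<exists>U V. openin X U \<and> openin X V \<and> a \<in> U \<and> C \<subseteq> V \<and> disjnt U V"
    using U by (meson closedin_closure_of openin_diff openin_topspace)
qed

lemma paracompact_Hausdorff_imp_normal_space:
  assumes "paracompact_space X" "Hausdorff_space X"
  shows "normal_space X"
  unfolding normal_space
proof (intro allI impI)
  fix S T assume *: "closedin X S \<and> closedin X T \<and> disjnt S T"
  show "\<exists>U. openin X U \<and> S \<subseteq> U \<and> disjnt T (X closure_of U)"
  proof (rule paracompact_separation[OF assms(1)])
    fix c assume "c \<in> S"
    then have "c \<in> topspace X - T"
      using * closedin_subset by (fastforce simp: disjnt_iff)
    then show "\<exists>U. openin X U \<and> c \<in> U \<and> disjnt T (X closure_of U)"
      using * paracompact_Hausdorff_imp_regular_space[OF assms] unfolding regular_space by blast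
  qed (use * closedin_subset in auto)
qed

text \<open>By regularity the open sets whose closure lies in some \<open>U i\<close> cover
  \<open>X\<close>. A locally finite refinement is regrouped along a choice \<open>f\<close> of such
  an index, and local finiteness lets closures commute with the regrouped unions. Keeping the index
  set \<open>I\<close> allows the lemma to be applied again to its own result.\<close>

lemma paracompact_shrinking:
  assumes "paracompact_space X" "Hausdorff_space X"
    and op: "\<And>i. i \<in> I \<Longrightarrow> openin X (U i)" and cov: "(\<Union>i\<in>I. U i) = topspace X"
  obtains S where "\<And>i. i \<in> I \<Longrightarrow> openin X (S i)" "\<And>i. i \<in> I \<Longrightarrow> X closure_of (S i) \<subseteq> U i"
    "(\<Union>i\<in>I. S i) = topspace X"
    "\<And>x. x \<in> topspace X \<Longrightarrow> \<exists>N. openin X N \<and> x \<in> N \<and> finite {i \<in> I. S i \<inter> N \<noteq> {}}"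
proof -
  let ?\<O> = "{G. openin X G \<and> (\<exists>i\<in>I. X closure_of G \<subseteq> U i)}"
  have "x \<in> \<Union>?\<O>" if x: "x \<in> topspace X" for x
  proof -
    obtain i where i: "i \<in> I" "x \<in> U i"
      using cov x by blast
    then have "closedin X (topspace X - U i)" "x \<in> topspace X - (topspace X - U i)"
      using op x by auto
    then obtain G where "openin X G" "x \<in> G" "disjnt (topspace X - U i) (X closure_of G)"
      using paracompact_Hausdorff_imp_regular_space[OF assms(1,2)] unfolding regular_space by meson
    moreover from this have "X closure_of G \<subseteq> U i"
      using closure_of_subset_topspace by (fastforce simp: disjnt_iff)
    ultimately show ?thesis
      using i by blast
  qed
  then have "open_cover X ?\<O>"
    unfolding open_cover_def by (auto dest: openin_subset)
  then obtain \<V> where \<V>: "open_cover X \<V>" "refines \<V> ?\<O>" "locally_finite_in X \<V>"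
    by (rule paracompact_spaceE[OF assms(1)])
  have "\<exists>i\<in>I. X closure_of V \<subseteq> U i" if "V \<in> \<V>" for V
    using \<V>(2) that closure_of_mono unfolding refines_def by (smt (verit) mem_Collect_eq subset_trans)
  then obtain f where f: "\<And>V. V \<in> \<V> \<Longrightarrow> f V \<in> I" "\<And>V. V \<in> \<V> \<Longrightarrow> X closure_of V \<subseteq> U (f V)"
    by metis
  let ?S = "\<lambda>i. \<Union>{V \<in> \<V>. f V = i}"
  show thesis
  proof
    show "openin X (?S i)" for i
      using \<V>(1) by (auto simp: open_cover_def)
    show "X closure_of ?S i \<subseteq> U i" for i
      by (subst closure_of_locally_finite_UN[OF \<V>(3)]) (use f in auto)
    have "(\<Union>i\<in>I. ?S i) = \<Union>\<V>"
      using f(1) by blast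
    then show "(\<Union>i\<in>I. ?S i) = topspace X"
      using \<V>(1) by (simp add: open_cover_def)
    fix x assume "x \<in> topspace X"
    then obtain N where N: "openin X N" "x \<in> N" "finite {V \<in> \<V>. V \<inter> N \<noteq> {}}"
      using \<V>(3) unfolding locally_finite_in_def by meson
    moreover have "{i \<in> I. ?S i \<inter> N \<noteq> {}} \<subseteq> f ` {V \<in> \<V>. V \<inter> N \<noteq> {}}"
      by auto
    ultimately show "\<exists>N. openin X N \<and> x \<in> N \<and> finite {i \<in> I. ?S i \<inter> N \<noteq> {}}"
      by (meson finite_imageI finite_subset)
  qed
qed

section \<open>Partitions of unity and barycentric refinements\<close>

lemma continuous_map_locally:
  assumes "\<And>x. x \<in> topspace X \<Longrightarrow>
    \<exists>N. openin X N \<and> x \<in> N \<and> continuous_map (subtopology X N) Y f"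
  shows "continuous_map X Y f"
  by (rule pasting_lemma[where I = "{N. openin X N \<and> continuous_map (subtopology X N) Y f}"
        and T = id and f = "\<lambda>_. f"]) (use assms in auto)

text \<open>Shrinking twice separates two tasks: Urysohn functions that vanish off
  \<open>S U\<close> have closed support in \<open>U\<close> and are locally finite, while their
  value 1 on the smaller sets \<open>T U\<close>, which still cover, makes the sum positive.\<close>

lemma subordinated_partition_exists:
  assumes X: "paracompact_space X" "Hausdorff_space X" and \<U>: "open_cover X \<U>"
  obtains \<phi> where "subordinated_partition X \<U> \<phi>"
proof -
  obtain S where S: "\<And>U. U \<in> \<U> \<Longrightarrow> openin X (S U)" "\<And>U. U \<in> \<U> \<Longrightarrow> X closure_of (S U) \<subseteq> U"
    "(\<Union>U\<in>\<U>. S U) = topspace X"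
    "\<And>x. x \<in> topspace X \<Longrightarrow> \<exists>N. openin X N \<and> x \<in> N \<and> finite {U \<in> \<U>. S U \<inter> N \<noteq> {}}"
    using paracompact_shrinking[OF X, of \<U> "\<lambda>U. U"] \<U> unfolding open_cover_def by auto
  obtain T where T: "\<And>U. U \<in> \<U> \<Longrightarrow> openin X (T U)" "\<And>U. U \<in> \<U> \<Longrightarrow> X closure_of (T U) \<subseteq> S U"
    "(\<Union>U\<in>\<U>. T U) = topspace X"
    using paracompact_shrinking[OF X S(1,3)] by metis
  have "\<exists>f. continuous_map X (top_of_set {0..1::real}) f \<and>
      f ` (topspace X - S U) \<subseteq> {0} \<and> f ` (X closure_of (T U)) \<subseteq> {1}" if "U \<in> \<U>" for U
    by (rule Urysohn_lemma[OF paracompact_Hausdorff_imp_normal_space[OF X],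
          of "topspace X - S U" "X closure_of (T U)" 0 1])
      (use that S(1) T(2) in \<open>auto simp: disjnt_iff\<close>)
  then obtain f where f: "\<And>U. U \<in> \<U> \<Longrightarrow> continuous_map X (top_of_set {0..1::real}) (f U)"
    "\<And>U. U \<in> \<U> \<Longrightarrow> f U ` (topspace X - S U) \<subseteq> {0}"
    "\<And>U. U \<in> \<U> \<Longrightarrow> f U ` (X closure_of (T U)) \<subseteq> {1}"
    by metis
  have f_cont: "continuous_map X euclideanreal (f U)" and f_ge0: "x \<in> topspace X \<Longrightarrow> 0 \<le> f U x"
    if "U \<in> \<U>" for U x
    using f(1)[OF that] by (auto simp: continuous_map_in_subtopology Pi_iff)
  have f_S: "x \<in> S U" if "U \<in> \<U>" "x \<in> topspace X" "f U x \<noteq> 0" for U x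
    using f(2) that by blast
  define \<sigma> where "\<sigma> x = (\<Sum>U | U \<in> \<U> \<and> f U x \<noteq> 0. f U x)" for x
  have fin: "\<exists>N. openin X N \<and> x \<in> N \<and> finite {U \<in> \<U>. \<exists>y\<in>N. f U y \<noteq> 0}"
    if x: "x \<in> topspace X" for x
  proof -
    obtain N where N: "openin X N" "x \<in> N" "finite {U \<in> \<U>. S U \<inter> N \<noteq> {}}"
      using S(4)[OF x] by blast
    moreover have "{U \<in> \<U>. \<exists>y\<in>N. f U y \<noteq> 0} \<subseteq> {U \<in> \<U>. S U \<inter> N \<noteq> {}}"
      using f_S openin_subset[OF N(1)] by blast
    ultimately show ?thesis
      by (meson finite_subset)
  qed
  have \<sigma>_cont: "continuous_map X euclideanreal \<sigma>"
  proof (rule continuous_map_locally)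
    fix x assume x: "x \<in> topspace X"
    then obtain N where N: "openin X N" "x \<in> N" "finite {U \<in> \<U>. \<exists>y\<in>N. f U y \<noteq> 0}"
      using fin[OF x] by auto
    \<comment> \<open>The index set in the definition of \<sigma> varies with the point; on
      \<open>N\<close> it may be replaced by this fixed finite set.\<close>
    let ?J = "{U \<in> \<U>. \<exists>y\<in>N. f U y \<noteq> 0}"
    have "continuous_map (subtopology X N) euclideanreal (\<lambda>y. \<Sum>U\<in>?J. f U y)"
      using N(3) f_cont by (intro continuous_map_sum) (auto intro: continuous_map_from_subtopology)
    moreover have "(\<Sum>U\<in>?J. f U y) = \<sigma> y" if "y \<in> N" for y
      unfolding \<sigma>_def by (rule sum.mono_neutral_right) (use N(3) that in auto)
    ultimately have "continuous_map (subtopology X N) euclideanreal \<sigma>"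
      by (auto intro: continuous_map_eq)
    then show "\<exists>N. openin X N \<and> x \<in> N \<and> continuous_map (subtopology X N) euclideanreal \<sigma>"
      using N by blast
  qed
  have fin_at: "finite {U. U \<in> \<U> \<and> f U x \<noteq> 0}" if x: "x \<in> topspace X" for x
  proof -
    obtain N where "x \<in> N" "finite {U \<in> \<U>. \<exists>y\<in>N. f U y \<noteq> 0}"
      using fin[OF x] by auto
    then show ?thesis
      by (rule_tac finite_subset) auto
  qed
  have \<sigma>_pos: "0 < \<sigma> x" if x: "x \<in> topspace X" for x
  proof -
    obtain U where U: "U \<in> \<U>" "x \<in> T U"
      using T(3) x by blast
    then have "f U x = 1"
      using f(3)[OF U(1)] closure_of_subset[OF openin_subset[OF T(1)[OF U(1)]]] by blast
    then show ?thesis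
      unfolding \<sigma>_def by (intro sum_pos2[of _ U]) (use U x fin_at f_ge0 in auto)
  qed
  have \<phi>_iff: "f U x / \<sigma> x \<noteq> 0 \<longleftrightarrow> f U x \<noteq> 0" if "x \<in> topspace X" for U x
    using \<sigma>_pos[OF that] by simp
  show thesis
  proof
    show "subordinated_partition X \<U> (\<lambda>U x. f U x / \<sigma> x)"
      unfolding subordinated_partition_def
    proof (intro conjI ballI)
      fix U assume U: "U \<in> \<U>"
      show "continuous_map X euclideanreal (\<lambda>x. f U x / \<sigma> x)"
        using \<sigma>_pos by (intro continuous_map_real_divide f_cont U \<sigma>_cont) force
      show "0 \<le> f U x / \<sigma> x" if "x \<in> topspace X" for x
        using f_ge0[OF U that] \<sigma>_pos[OF that] by simp
      have "{x \<in> topspace X. f U x / \<sigma> x \<noteq> 0} \<subseteq> S U"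
        using f_S[OF U] \<phi>_iff by blast
      then show "X closure_of {x \<in> topspace X. f U x / \<sigma> x \<noteq> 0} \<subseteq> U"
        using S(2)[OF U] closure_of_mono by (metis subset_trans)
    next
      fix x assume x: "x \<in> topspace X"
      then obtain N where N: "openin X N" "x \<in> N" "finite {U \<in> \<U>. \<exists>y\<in>N. f U y \<noteq> 0}"
        using fin[OF x] by auto
      moreover have "{U \<in> \<U>. \<exists>y\<in>N. f U y / \<sigma> y \<noteq> 0} \<subseteq> {U \<in> \<U>. \<exists>y\<in>N. f U y \<noteq> 0}"
        by auto
      ultimately show "\<exists>N. openin X N \<and> x \<in> N \<and> finite {U \<in> \<U>. \<exists>y\<in>N. f U y / \<sigma> y \<noteq> 0}"
        by (meson finite_subset)
      have "(\<Sum>U | U \<in> \<U> \<and> f U x / \<sigma> x \<noteq> 0. f U x / \<sigma> x) = \<sigma> x / \<sigma> x"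
        by (simp only: \<phi>_iff[OF x] sum_divide_distrib[symmetric] \<sigma>_def[of x, symmetric])
      then show "(\<Sum>U | U \<in> \<U> \<and> f U x / \<sigma> x \<noteq> 0. f U x / \<sigma> x) = 1"
        using \<sigma>_pos[OF x] by simp
    qed
  qed
qed

text \<open>Each \<open>V x\<close> is chosen so small that it lies in every \<open>U\<close> whose
  shrunk closure it meets. If two of them share \<open>z\<close>, some \<open>S U\<close> contains
  \<open>z\<close>, and that one \<open>U\<close> contains both.\<close>

lemma barycentric_refinement:
  assumes X: "paracompact_space X" "Hausdorff_space X" and \<U>: "open_cover X \<U>"
  obtains \<V> where "open_cover X \<V>"
    "\<And>V V'. V \<in> \<V> \<Longrightarrow> V' \<in> \<V> \<Longrightarrow> V \<inter> V' \<noteq> {} \<Longrightarrow> \<exists>U\<in>\<U>. V \<union> V' \<subseteq> U"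
proof -
  obtain S where S: "\<And>U. U \<in> \<U> \<Longrightarrow> openin X (S U)" "\<And>U. U \<in> \<U> \<Longrightarrow> X closure_of (S U) \<subseteq> U"
    "(\<Union>U\<in>\<U>. S U) = topspace X"
    "\<And>x. x \<in> topspace X \<Longrightarrow> \<exists>N. openin X N \<and> x \<in> N \<and> finite {U \<in> \<U>. S U \<inter> N \<noteq> {}}"
    using paracompact_shrinking[OF X, of \<U> "\<lambda>U. U"] \<U> unfolding open_cover_def by auto
  let ?C = "\<lambda>U. X closure_of (S U)"
  let ?good = "\<lambda>x V. openin X V \<and> x \<in> V \<and> (\<forall>U\<in>\<U>. V \<inter> ?C U \<noteq> {} \<longrightarrow> V \<subseteq> U)"
  have "\<exists>V. ?good x V" if x: "x \<in> topspace X" for x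
  proof -
    obtain N where N: "openin X N" "x \<in> N" "finite {U \<in> \<U>. S U \<inter> N \<noteq> {}}"
      using S(4)[OF x] by blast
    define F where "F = {U \<in> \<U>. S U \<inter> N \<noteq> {}}"
    \<comment> \<open>For each \<open>U\<close> either \<open>V \<subseteq> U\<close> or
      \<open>V\<close> misses the closure of \<open>S U\<close>. Finitely many \<open>U\<close> need
      attention, because an open \<open>N\<close> that misses \<open>S U\<close> also misses its
      closure.\<close>
    define g where "g U = (if x \<in> ?C U then U else topspace X - ?C U)" for U
    define V where "V = N \<inter> (\<Inter>(g ` F) \<inter> topspace X)"
    have F: "U \<in> F" if "U \<in> \<U>" "N \<inter> ?C U \<noteq> {}" for U
    proof -
      have "N \<inter> S U \<noteq> {}"
        using that(2) openin_Int_closure_of_eq_empty[OF N(1)] by metis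
      then show ?thesis
        using that(1) unfolding F_def by blast
    qed
    have "openin X (g U)" if "U \<in> F" for U
      using that \<U> by (auto simp: g_def F_def open_cover_def)
    then have "openin X V"
      unfolding V_def by (intro openin_Int N(1) openin_INT) (use N(3) F_def in auto)
    moreover have "x \<in> V"
      unfolding V_def using N(2) x S(2) by (auto simp: g_def F_def)
    moreover have "V \<subseteq> U" if U: "U \<in> \<U>" "V \<inter> ?C U \<noteq> {}" for U
    proof -
      have "U \<in> F"
        using F U V_def by blast
      then have "V \<subseteq> g U"
        unfolding V_def by blast
      then show ?thesis
        using U(2) unfolding g_def by (auto split: if_splits)
    qed
    ultimately show ?thesis
      by blast
  qed
  then obtain V where V: "\<And>x. x \<in> topspace X \<Longrightarrow> ?good x (V x)"
    by metis
  show thesis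
  proof
    show "open_cover X (V ` topspace X)"
      unfolding open_cover_def using V openin_subset by fastforce
    fix A B assume A: "A \<in> V ` topspace X" and B: "B \<in> V ` topspace X" and "A \<inter> B \<noteq> {}"
    then obtain z where z: "z \<in> A" "z \<in> B"
      by blast
    then have "z \<in> topspace X"
      using A V openin_subset by fastforce
    then obtain U where U: "U \<in> \<U>" "z \<in> S U"
      using S(3) by blast
    then have "z \<in> ?C U"
      using closure_of_subset[OF openin_subset[OF S(1)[OF U(1)]]] by blast
    moreover have "V x \<subseteq> U" if "x \<in> topspace X" "z \<in> V x" "z \<in> ?C U" for x
      using V[OF that(1)] U(1) that by blast
    ultimately show "\<exists>U\<in>\<U>. A \<union> B \<subseteq> U"
      using A B U(1) z by blast
  qed
qed

text \<open>An index needs a partition of unity with value 1 at \<open>x0\<close> on the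
  distinguished member, which an arbitrary cover need not admit; the cover is modified near
  \<open>x0\<close> only.\<close>

lemma shape_index_refining:
  assumes X: "paracompact_space X" "Hausdorff_space X" and x0: "x0 \<in> topspace X"
    and \<U>: "open_cover X \<U>"
  obtains i where "i \<in> shape_index X x0" "refines (fst i) \<U>"
proof -
  obtain V0 where V0: "V0 \<in> \<U>" "x0 \<in> V0"
    using \<U> x0 by (auto simp: open_cover_def)
  \<comment> \<open>Since \<open>x0\<close> is removed from all other members, every partition of unity is 1 at \<open>x0\<close> on \<open>V0\<close>.\<close>
  define \<V> where "\<V> = insert V0 ((\<lambda>V. V - {x0}) ` \<U>)"
  have "closedin X {x0}"
    using X x0 by (simp add: closedin_Hausdorff_singleton)
  then have "openin X V" if "V \<in> \<V>" for V
    using that \<U> V0 by (auto simp: \<V>_def open_cover_def)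
  moreover have "\<Union>\<V> = topspace X"
    using \<U> V0 by (auto simp: \<V>_def open_cover_def)
  ultimately have \<V>: "open_cover X \<V>"
    by (auto simp: open_cover_def)
  obtain \<phi> where \<phi>: "subordinated_partition X \<V> \<phi>"
    using subordinated_partition_exists[OF X \<V>] .
  have zero: "\<phi> V x0 = 0" if "V \<in> \<V>" "V \<noteq> V0" for V
  proof (rule ccontr)
    assume "\<phi> V x0 \<noteq> 0"
    then have "x0 \<in> V"
      using \<phi> that x0 closure_of_subset[of "{x \<in> topspace X. \<phi> V x \<noteq> 0}" X]
      unfolding subordinated_partition_def by blast
    then show False
      using that by (auto simp: \<V>_def)
  qed
  have one: "(\<Sum>U | U \<in> \<V> \<and> \<phi> U x0 \<noteq> 0. \<phi> U x0) = 1"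
    using \<phi> x0 unfolding subordinated_partition_def by blast
  have "{U. U \<in> \<V> \<and> \<phi> U x0 \<noteq> 0} \<subseteq> {V0}"
    using zero by blast
  then have "(\<Sum>U | U \<in> \<V> \<and> \<phi> U x0 \<noteq> 0. \<phi> U x0) = (\<Sum>U\<in>{V0}. \<phi> U x0)"
    by (intro sum.mono_neutral_left) (auto simp: \<V>_def)
  then have "\<phi> V0 x0 = 1"
    using one by simp
  then have "(\<V>, V0) \<in> shape_index X x0"
    using \<V> \<phi> V0 by (auto simp: shape_index_def \<V>_def)
  moreover have "refines \<V> \<U>"
    using V0 by (auto simp: refines_def \<V>_def)
  ultimately show thesis
    by (intro that[of "(\<V>, V0)"]) auto
qed

section \<open>Algebra of path classes\<close>

declare path_homotopic_trans [trans]

text \<open>Paths are total functions on the reals, so two paths that agree on \<open>{0..1}\<close>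
  are in general homotopic and not equal. This bridges the gap when a lift is projected
  back.\<close>

lemma path_homotopic_cong:
  assumes "pathin X p" "\<And>s. s \<in> {0..1} \<Longrightarrow> p s = q s"
  shows "path_homotopic X p q"
  unfolding path_homotopic_def
  by (rule homotopic_with_equal) (use assms in \<open>auto simp: pathin_def\<close>)

lemma path_homotopic_concat_const:
  assumes "pathin X p" "p 1 = x" shows "path_homotopic X (p \<star> (\<lambda>_. x)) p"
proof -
  have "path_homotopic X (p \<circ> (\<lambda>s. min 1 (2 * s))) (p \<circ> (\<lambda>s. s))"
    by (rule path_homotopic_reparam) (use assms in \<open>auto intro!: continuous_intros\<close>)
  moreover have "(p \<circ> (\<lambda>s. min 1 (2 * s))) s = (p \<star> (\<lambda>_. x)) s" for s
    using assms by (cases "s \<le> 1/2") (simp_all add: path_concat_def)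
  then have "p \<circ> (\<lambda>s. min 1 (2 * s)) = p \<star> (\<lambda>_. x)" ..
  ultimately show ?thesis by (simp add: o_def)
qed

lemma path_rev_rev [simp]: "path_rev (path_rev p) = p"
  by (simp add: path_rev_def)

lemma path_rev_ends [simp]: "path_rev p 0 = p 1" "path_rev p 1 = p 0"
  by (simp_all add: path_rev_def)

lemma path_rev_concat:
  assumes "p 1 = q 0" shows "path_rev (p \<star> q) = path_rev q \<star> path_rev p"
proof
  fix s :: real
  consider "s < 1/2" | "s = 1/2" | "s > 1/2" by linarith
  then show "path_rev (p \<star> q) s = (path_rev q \<star> path_rev p) s"
    by cases (use assms in \<open>auto simp: path_rev_def path_concat_def algebra_simps\<close>)
qed

lemma path_homotopic_concat_rev:
  assumes "pathin X p" shows "path_homotopic X (p \<star> path_rev p) (\<lambda>_. p 0)"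
  using path_homotopic_rev_concat[OF pathin_rev[OF assms]] by simp

lemma comp_path_concat: "f \<circ> (p \<star> q) = (f \<circ> p) \<star> (f \<circ> q)"
  by (auto simp: path_concat_def)

lemma comp_path_rev: "f \<circ> path_rev p = path_rev (f \<circ> p)"
  by (auto simp: path_rev_def)

text \<open>The cancellation behind both transitivity of \<open>rel\<close> and its invariance under
  appending a path.\<close>

lemma path_homotopic_cancel_middle:
  assumes "pathin X p" "pathin X q" "pathin X s" "p 1 = q 0" "s 0 = q 0"
  shows "path_homotopic X ((p \<star> q) \<star> (path_rev q \<star> s)) (p \<star> s)"
proof -
  have refl: "path_homotopic X p p" "path_homotopic X s s"
    using assms by (auto simp: path_homotopic_refl)
  have q: "pathin X (path_rev q)" "pathin X (path_rev q \<star> s)"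
    using assms by (auto intro!: pathin_concat pathin_rev)
  have "path_homotopic X (q \<star> (path_rev q \<star> s)) ((q \<star> path_rev q) \<star> s)"
    by (rule path_homotopic_sym, rule path_homotopic_assoc) (use assms q in auto)
  also have "path_homotopic X \<dots> ((\<lambda>_. q 0) \<star> s)"
    by (rule path_homotopic_concat[OF path_homotopic_concat_rev refl(2)]) (use assms in auto)
  also have "path_homotopic X \<dots> s"
    by (rule path_homotopic_const_concat) (use assms in auto)
  finally have "path_homotopic X (q \<star> (path_rev q \<star> s)) s" .
  then have "path_homotopic X (p \<star> (q \<star> (path_rev q \<star> s))) (p \<star> s)"
    by (rule path_homotopic_concat[OF refl(1)]) (use assms in auto)
  moreover have "path_homotopic X ((p \<star> q) \<star> (path_rev q \<star> s)) (p \<star> (q \<star> (path_rev q \<star> s)))"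
    by (rule path_homotopic_assoc) (use assms q in auto)
  ultimately show ?thesis
    by (rule path_homotopic_trans[rotated])
qed

lemma path_homotopic_conjugate_null:
  assumes "pathin X p" "path_homotopic X q (\<lambda>_. p 1)"
  shows "path_homotopic X ((p \<star> q) \<star> path_rev p) (\<lambda>_. p 0)"
proof -
  have q: "q 0 = p 1" "q 1 = p 1"
    using path_homotopic_ends[OF assms(2)] by auto
  have "path_homotopic X (p \<star> q) (p \<star> (\<lambda>_. p 1))"
    by (rule path_homotopic_concat) (use assms q in \<open>auto simp: path_homotopic_refl\<close>)
  also have "path_homotopic X \<dots> p"
    using assms by (intro path_homotopic_concat_const) auto
  finally
  have "path_homotopic X ((p \<star> q) \<star> path_rev p) (p \<star> path_rev p)"
    by (rule path_homotopic_concat) (use assms q in \<open>auto simp: path_homotopic_refl pathin_rev\<close>)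
  also have "path_homotopic X \<dots> (\<lambda>_. p 0)"
    by (rule path_homotopic_concat_rev[OF assms(1)])
  finally show ?thesis .
qed

lemma path_class_eq_iff:
  assumes "pathin X q" shows "path_class X p = path_class X q \<longleftrightarrow> path_homotopic X p q"
  using path_class_self[OF assms] path_class_eq[of X p q] by (auto simp: path_class_def)

lemma loops_at_const: "x0 \<in> topspace X \<Longrightarrow> (\<lambda>_. x0) \<in> loops_at X x0"
  by (simp add: loops_at_def)

lemma loops_at_concat: "p \<in> loops_at X x0 \<Longrightarrow> q \<in> loops_at X x0 \<Longrightarrow> p \<star> q \<in> loops_at X x0"
  by (auto simp: loops_at_def pathin_concat)

lemma loops_at_rev: "p \<in> loops_at X x0 \<Longrightarrow> path_rev p \<in> loops_at X x0"
  by (auto simp: loops_at_def pathin_rev)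

lemma loops_at_comp:
  "continuous_map X Y f \<Longrightarrow> p \<in> loops_at X x0 \<Longrightarrow> f \<circ> p \<in> loops_at Y (f x0)"
  by (auto simp: loops_at_def pathin_def intro: continuous_map_compose)

lemma carrier_fundamental_group: "carrier (fundamental_group X x0) = path_class X ` loops_at X x0"
  by (simp add: fundamental_group_def)

lemma one_fundamental_group: "\<one>\<^bsub>fundamental_group X x0\<^esub> = path_class X (\<lambda>_. x0)"
  by (simp add: fundamental_group_def)

lemma inv_fundamental_group:
  assumes x0: "x0 \<in> topspace X" and p: "p \<in> loops_at X x0"
  shows "inv\<^bsub>fundamental_group X x0\<^esub> path_class X p = path_class X (path_rev p)"
proof (rule group.inv_equality[OF group_fundamental_group[OF x0]])
  have "path_homotopic X (path_rev p \<star> p) (\<lambda>_. x0)"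
    using path_homotopic_rev_concat[of X p] p by (simp add: loops_at_def)
  then show "path_class X (path_rev p) \<otimes>\<^bsub>fundamental_group X x0\<^esub> path_class X p =
      \<one>\<^bsub>fundamental_group X x0\<^esub>"
    using p by (simp add: fundamental_group_mult loops_at_rev one_fundamental_group path_class_eq)
qed (use p loops_at_rev[OF p] in \<open>auto simp: carrier_fundamental_group\<close>)

lemma path_class_conjugate_loop:
  assumes "pathin X \<alpha>" "\<alpha> 0 = x0" "\<gamma> \<in> loops_at X (\<alpha> 1)"
  shows "(\<alpha> \<star> \<gamma>) \<star> path_rev \<alpha> \<in> loops_at X x0"
  using assms by (auto simp: loops_at_def intro!: pathin_concat pathin_rev)

lemma spanier_group_subset:
  assumes "x0 \<in> topspace X" "subgroup H (fundamental_group X x0)"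
    and "\<And>\<alpha> \<gamma> U. pathin X \<alpha> \<Longrightarrow> \<alpha> 0 = x0 \<Longrightarrow> \<gamma> \<in> loops_at X (\<alpha> 1) \<Longrightarrow> U \<in> \<U> \<Longrightarrow> \<gamma> ` {0..1} \<subseteq> U \<Longrightarrow>
      path_class X ((\<alpha> \<star> \<gamma>) \<star> path_rev \<alpha>) \<in> H"
  shows "spanier_group X \<U> x0 \<subseteq> H"
  unfolding spanier_group_def
  by (rule group.generate_subgroup_incl[OF group_fundamental_group[OF assms(1)] _ assms(2)])
    (use assms(3) in blast)

section \<open>Paths in realizations\<close>

lemma realization_pointsD:
  assumes "b \<in> realization_points K"
  shows "0 \<le> b v" "bary_support b \<in> K" "b v \<noteq> 0 \<Longrightarrow> 0 < b v"
  using assms by (auto simp: realization_points_def less_le)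

lemma finite_imp_closed_real_functions:
  fixes T :: "('v \<Rightarrow> real) set"
  assumes "finite T" shows "closed T"
proof -
  have "closed {b}" for b :: "'v \<Rightarrow> real"
  proof -
    have "closed {x :: 'v \<Rightarrow> real. \<forall>v. x v = b v}"
      by (intro closed_Collect_all closed_Collect_eq continuous_on_const continuous_on_product_coordinates)
    moreover have "{x. \<forall>v. x v = b v} = {b}"
      by auto
    ultimately show ?thesis
      by simp
  qed
  then have "closed (\<Union>b\<in>T. {b})"
    using assms by (intro closed_UN) auto
  then show ?thesis
    by simp
qed

text \<open>Only nonempty faces are demanded, in accordance with \<open>nerve\<close>, which
  excludes the empty simplex.\<close>

locale finite_complex =
  fixes K :: "'v set set"
  assumes finite_simplex: "\<sigma> \<in> K \<Longrightarrow> finite \<sigma>"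
    and face_simplex: "\<sigma> \<in> K \<Longrightarrow> \<tau> \<subseteq> \<sigma> \<Longrightarrow> \<tau> \<noteq> {} \<Longrightarrow> \<tau> \<in> K"
begin

lemma finite_bary_support: "b \<in> realization_points K \<Longrightarrow> finite (bary_support b)"
  by (simp add: finite_simplex realization_pointsD)

text \<open>Coordinates outside the support add nothing, so the sum may run over any simplex that
  contains it; a sum of 1 also forces a nonempty support, which is then a face.\<close>

lemma realization_points_iff:
  assumes \<sigma>: "\<sigma> \<in> K" "bary_support b \<subseteq> \<sigma>"
  shows "b \<in> realization_points K \<longleftrightarrow> (\<forall>v. 0 \<le> b v) \<and> (\<Sum>v\<in>\<sigma>. b v) = 1"
proof -
  have "(\<Sum>v\<in>\<sigma>. b v) = (\<Sum>v\<in>bary_support b. b v)"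
    by (rule sum.mono_neutral_right) (use \<sigma> finite_simplex in \<open>auto simp: bary_support_def\<close>)
  moreover have "bary_support b \<in> K" if "(\<Sum>v\<in>bary_support b. b v) = 1"
    using that by (intro face_simplex[OF \<sigma>]) auto
  ultimately show ?thesis
    by (auto simp: realization_points_def)
qed

lemma closed_simplex_eq:
  assumes "\<sigma> \<in> K"
  shows "closed_simplex K \<sigma> = {b. (\<forall>v. 0 \<le> b v) \<and> (\<forall>v. v \<notin> \<sigma> \<longrightarrow> b v = 0) \<and> (\<Sum>v\<in>\<sigma>. b v) = 1}"
proof -
  have "bary_support b \<subseteq> \<sigma> \<longleftrightarrow> (\<forall>v. v \<notin> \<sigma> \<longrightarrow> b v = 0)" for b :: "'v \<Rightarrow> real"
    by (auto simp: bary_support_def)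
  then show ?thesis
    using realization_points_iff[OF assms] unfolding closed_simplex_def by blast
qed

lemma closed_closed_simplex:
  assumes "\<sigma> \<in> K" shows "closed (closed_simplex K \<sigma>)"
proof -
  have coord: "continuous_on UNIV (\<lambda>b :: 'v \<Rightarrow> real. b v)" for v
    by (rule continuous_on_product_coordinates)
  have "closed {b :: 'v \<Rightarrow> real. (\<forall>v. 0 \<le> b v) \<and> (\<forall>v. v \<notin> \<sigma> \<longrightarrow> b v = 0) \<and> (\<Sum>v\<in>\<sigma>. b v) = 1}"
    by (intro closed_Collect_conj closed_Collect_all closed_Collect_imp closed_Collect_le
        closed_Collect_eq continuous_on_const continuous_on_sum coord) auto
  then show ?thesis
    unfolding closed_simplex_eq[OF assms] .
qed

lemma realization_points_eq_Union: "realization_points K = (\<Union>\<sigma>\<in>K. closed_simplex K \<sigma>)"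
  by (auto simp: closed_simplex_def realization_points_def)

text \<open>Coordinatewise continuity is in general weaker than continuity into the weak topology.
  If all supports lie in a finite \<open>F\<close>, finitely many closed simplices cover the image,
  and the preimage of a closed set is a finite union of preimages of sets that are closed in the
  function space.\<close>

lemma continuous_map_into_realization_finite:
  assumes coord: "\<And>v. continuous_map Z euclideanreal (\<lambda>z. g z v)"
    and im: "\<And>z. z \<in> topspace Z \<Longrightarrow> g z \<in> realization_points K"
    and F: "finite F" "\<And>z. z \<in> topspace Z \<Longrightarrow> bary_support (g z) \<subseteq> F"
  shows "continuous_map Z (realization K) g"
  unfolding continuous_map_closedin
proof (intro conjI allI impI)
  show "g \<in> topspace Z \<rightarrow> topspace (realization K)"
    using im by auto
  have g: "continuous_map Z euclidean g"
    using coord by (metis continuous_map_componentwise_UNIV euclidean_product_topology)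
  fix C assume C: "closedin (realization K) C"
  have "closedin Z {z \<in> topspace Z. g z \<in> C \<inter> closed_simplex K \<sigma>}" if \<sigma>: "\<sigma> \<in> K" for \<sigma>
  proof -
    have "openin (top_of_set (closed_simplex K \<sigma>)) ((realization_points K - C) \<inter> closed_simplex K \<sigma>)"
      using C \<sigma> by (simp add: closedin_def openin_realization)
    moreover have "(realization_points K - C) \<inter> closed_simplex K \<sigma> =
        closed_simplex K \<sigma> - C \<inter> closed_simplex K \<sigma>"
      by (auto simp: closed_simplex_def)
    ultimately have "closedin (top_of_set (closed_simplex K \<sigma>)) (C \<inter> closed_simplex K \<sigma>)"
      by (simp add: closedin_def)
    then have "closed (C \<inter> closed_simplex K \<sigma>)"
      using closed_closed_simplex[OF \<sigma>] closedin_closed_trans by blast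
    then show ?thesis
      using g unfolding continuous_map_closedin by (metis closed_closedin)
  qed
  then have "closedin Z (\<Union>\<sigma>\<in>{\<sigma> \<in> K. \<sigma> \<subseteq> F}. {z \<in> topspace Z. g z \<in> C \<inter> closed_simplex K \<sigma>})"
    using F(1) by (intro closedin_Union) auto
  moreover have "{z \<in> topspace Z. g z \<in> C} =
      (\<Union>\<sigma>\<in>{\<sigma> \<in> K. \<sigma> \<subseteq> F}. {z \<in> topspace Z. g z \<in> C \<inter> closed_simplex K \<sigma>})"
    using F(2) im by (fastforce simp: closed_simplex_def realization_points_def)
  ultimately show "closedin Z {z \<in> topspace Z. g z \<in> C}"
    by simp
qed

text \<open>The form needed for maps given by a partition of unity, whose supports are bounded only
  locally.\<close>

lemma continuous_map_into_realization:
  assumes coord: "\<And>v. continuous_map Z euclideanreal (\<lambda>z. g z v)"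
    and im: "\<And>z. z \<in> topspace Z \<Longrightarrow> g z \<in> realization_points K"
    and loc: "\<And>z. z \<in> topspace Z \<Longrightarrow>
      \<exists>N F. openin Z N \<and> z \<in> N \<and> finite F \<and> (\<forall>y\<in>N. bary_support (g y) \<subseteq> F)"
  shows "continuous_map Z (realization K) g"
proof (rule continuous_map_locally)
  fix z assume "z \<in> topspace Z"
  from loc[OF this] obtain N F where "openin Z N" "z \<in> N" "finite F" "\<forall>y\<in>N. bary_support (g y) \<subseteq> F"
    by blast
  moreover from this have "continuous_map (subtopology Z N) (realization K) g"
    by (intro continuous_map_into_realization_finite[of _ _ F])
      (auto intro: im continuous_map_from_subtopology[OF coord])
  ultimately show "\<exists>N. openin Z N \<and> z \<in> N \<and> continuous_map (subtopology Z N) (realization K) g"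
    by blast
qed

lemma continuous_map_from_realization:
  assumes "\<And>\<sigma>. \<sigma> \<in> K \<Longrightarrow> continuous_map (top_of_set (closed_simplex K \<sigma>)) Z g"
  shows "continuous_map (realization K) Z g"
  unfolding continuous_map
proof (intro conjI allI impI)
  show "g ` topspace (realization K) \<subseteq> topspace Z"
    using assms unfolding topspace_realization realization_points_eq_Union
    by (fastforce simp: continuous_map_def)
  fix U assume "openin Z U"
  then have "openin (top_of_set (closed_simplex K \<sigma>)) {b \<in> closed_simplex K \<sigma>. g b \<in> U}"
    if "\<sigma> \<in> K" for \<sigma>
    using assms[OF that] by (simp add: continuous_map)
  moreover have "{b \<in> topspace (realization K). g b \<in> U} \<inter> closed_simplex K \<sigma> =
      {b \<in> closed_simplex K \<sigma>. g b \<in> U}" for \<sigma>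
    by (auto simp: closed_simplex_def)
  ultimately show "openin (realization K) {b \<in> topspace (realization K). g b \<in> U}"
    unfolding openin_realization by auto
qed

lemma continuous_map_coordinate: "continuous_map (realization K) euclideanreal (\<lambda>b. b v)"
proof (rule continuous_map_from_realization)
  show "continuous_map (top_of_set (closed_simplex K \<sigma>)) euclideanreal (\<lambda>b. b v)" for \<sigma>
    using continuous_on_subset[OF continuous_on_product_coordinates subset_UNIV] by simp
qed

lemma openin_open_star: "openin (realization K) (open_star K v)"
proof -
  have "openin (realization K) {b \<in> topspace (realization K). b v \<in> - {0}}"
    by (rule openin_continuous_map_preimage[OF continuous_map_coordinate]) auto
  then show ?thesis
    by (simp add: open_star_def)
qed

text \<open>Points with pairwise distinct supports form a closed discrete set, because a closed simplex
  contains only finitely many of them.\<close>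

lemma compactin_finite_supports:
  assumes A: "compactin (realization K) A"
  shows "finite (bary_support ` A)"
proof (rule ccontr)
  assume inf: "infinite (bary_support ` A)"
  from subset_image_inj[of "bary_support ` A" bary_support A]
  have "\<exists>B\<subseteq>A. inj_on bary_support B \<and> bary_support ` A = bary_support ` B"
    by (simp only: subset_refl)
  \<comment> \<open>\<open>B\<close> contains one point of \<open>A\<close> for each support that
    occurs.\<close>
  then obtain B where B: "B \<subseteq> A" "inj_on bary_support B" "bary_support ` B = bary_support ` A"
    by auto
  have BK: "B \<subseteq> realization_points K"
    using B(1) compactin_subset_topspace[OF A] by auto
  have op: "openin (realization K) (realization_points K - T)" if T: "T \<subseteq> B" for T
    unfolding openin_realization
  proof (intro conjI ballI)
    fix \<sigma> assume \<sigma>: "\<sigma> \<in> K"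
    have "bary_support ` (T \<inter> closed_simplex K \<sigma>) \<subseteq> Pow \<sigma>"
      by (auto simp: closed_simplex_def)
    then have "finite (bary_support ` (T \<inter> closed_simplex K \<sigma>))"
      using finite_simplex[OF \<sigma>] by (meson finite_Pow_iff finite_subset)
    then have "finite (T \<inter> closed_simplex K \<sigma>)"
      using inj_on_subset[OF B(2)] T by (meson finite_imageD inf_le1 subset_trans)
    then have "openin (top_of_set (closed_simplex K \<sigma>)) (closed_simplex K \<sigma> \<inter> - (T \<inter> closed_simplex K \<sigma>))"
      by (intro openin_open_Int open_Compl finite_imp_closed_real_functions)
    moreover have "(realization_points K - T) \<inter> closed_simplex K \<sigma> =
        closed_simplex K \<sigma> \<inter> - (T \<inter> closed_simplex K \<sigma>)"
      by (auto simp: closed_simplex_def)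
    ultimately show "openin (top_of_set (closed_simplex K \<sigma>))
        ((realization_points K - T) \<inter> closed_simplex K \<sigma>)"
      by simp
  qed auto
  \<comment> \<open>Compactness gives the infinite \<open>B\<close> a limit point \<open>x\<close>,
    but the complement of \<open>B - {x}\<close> is an open neighbourhood of \<open>x\<close>
    without other points of \<open>B\<close>.\<close>
  have "infinite B"
    using inf B(3) by (metis finite_imageI)
  then obtain x where x: "x \<in> realization K derived_set_of B"
    using compactin_imp_Bolzano_Weierstrass[OF A, of B] B(1) by blast
  then have "x \<in> realization_points K - (B - {x})"
    using derived_set_of_subset_topspace[of "realization K" B] by auto
  moreover have "openin (realization K) (realization_points K - (B - {x}))"
    by (rule op) auto
  ultimately have "\<exists>y. y \<noteq> x \<and> y \<in> B \<and> y \<in> realization_points K - (B - {x})"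
    using x by (simp only: in_derived_set_of)
  then show False
    by blast
qed

lemma pathin_realization_finite_support:
  assumes "pathin (realization K) a"
  obtains F where "finite F" "\<And>s. s \<in> {0..1} \<Longrightarrow> bary_support (a s) \<subseteq> F"
proof
  have "compactin (realization K) (a ` {0..1})"
    using assms unfolding pathin_def
    by (rule image_compactin[rotated]) (simp add: compactin_subtopology)
  then show "finite (\<Union>(bary_support ` a ` {0..1}))"
    using compactin_finite_supports compactin_subset_topspace finite_bary_support
    by (intro finite_Union) fastforce+
qed auto

lemma convex_combination_in_realization:
  assumes pq: "p \<in> realization_points K" "q \<in> realization_points K"
    "bary_support p \<union> bary_support q \<in> K" and t: "0 \<le> t" "t \<le> 1"
  shows "(\<lambda>v. (1 - t) * p v + t * q v) \<in> realization_points K"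
proof -
  let ?\<sigma> = "bary_support p \<union> bary_support q"
  have "(\<Sum>v\<in>?\<sigma>. p v) = 1" "(\<Sum>v\<in>?\<sigma>. q v) = 1"
    using realization_points_iff[OF pq(3)] pq(1,2) by auto
  then have "(\<Sum>v\<in>?\<sigma>. (1 - t) * p v + t * q v) = 1"
    by (simp add: sum.distrib flip: sum_distrib_left)
  moreover have "bary_support (\<lambda>v. (1 - t) * p v + t * q v) \<subseteq> ?\<sigma>"
    by (auto simp: bary_support_def)
  ultimately show ?thesis
    using realization_points_iff[OF pq(3)] pq(1,2)[THEN realization_pointsD(1)] t by auto
qed

text \<open>The straight-line homotopy stays in the realization because at each time both points lie
  in a common simplex. Compactness of the two paths confines all supports to one finite set, so that
  coordinatewise continuity suffices.\<close>

lemma contiguous_paths_homotopic: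
  assumes a: "pathin (realization K) a" and b: "pathin (realization K) b"
    and ends: "a 0 = b 0" "a 1 = b 1"
    and contiguous: "\<And>s. s \<in> {0..1} \<Longrightarrow> bary_support (a s) \<union> bary_support (b s) \<in> K"
  shows "path_homotopic (realization K) a b"
  unfolding path_homotopic_iff
proof (intro exI conjI)
  let ?I = "top_of_set {0..1::real}"
  let ?h = "\<lambda>z v. (1 - fst z) * a (snd z) v + fst z * b (snd z) v"
  obtain F where F: "finite F" "\<And>s. s \<in> {0..1} \<Longrightarrow> bary_support (a s) \<subseteq> F"
    using pathin_realization_finite_support[OF a] by blast
  obtain G where G: "finite G" "\<And>s. s \<in> {0..1} \<Longrightarrow> bary_support (b s) \<subseteq> G"
    using pathin_realization_finite_support[OF b] by blast
  have coord: "continuous_map (prod_topology ?I ?I) euclideanreal (\<lambda>z. c (snd z) v)"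
    if "pathin (realization K) c" for c v
    using continuous_map_compose[OF continuous_map_compose[OF continuous_map_snd
      that[unfolded pathin_def]] continuous_map_coordinate, of ?I v]
    by (simp add: o_def)
  have fst: "continuous_map (prod_topology ?I ?I) euclideanreal fst"
    using continuous_map_fst[of ?I ?I] by (simp add: continuous_map_in_subtopology)
  show "continuous_map (prod_topology ?I ?I) (realization K) ?h"
  proof (rule continuous_map_into_realization_finite)
    show "continuous_map (prod_topology ?I ?I) euclideanreal (\<lambda>z. ?h z v)" for v
      by (intro continuous_map_add continuous_map_real_mult continuous_map_diff coord[OF a] coord[OF b] fst) simp
    show "finite (F \<union> G)"
      using F(1) G(1) by simp
    fix z assume z: "z \<in> topspace (prod_topology ?I ?I)"
    then have "a (snd z) \<in> realization_points K" "b (snd z) \<in> realization_points K"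
      using a b by (auto simp: pathin_def continuous_map_def)
    then show "?h z \<in> realization_points K"
      using convex_combination_in_realization contiguous z by auto
    have "bary_support (?h z) \<subseteq> bary_support (a (snd z)) \<union> bary_support (b (snd z))"
      by (auto simp: bary_support_def)
    then show "bary_support (?h z) \<subseteq> F \<union> G"
      using F(2) G(2) z by fastforce
  qed
qed (use ends in \<open>auto simp: algebra_simps\<close>)

text \<open>The two concatenations below are contiguous; the first one runs along the segment from
  \<open>c\<close> to the vertex and back.\<close>

lemma loop_in_open_star_null:
  assumes b: "b \<in> loops_at (realization K) c"
    and star: "\<And>s. s \<in> {0..1} \<Longrightarrow> b s v \<noteq> 0"
  shows "path_homotopic (realization K) b (\<lambda>_. c)"
proof -
  let ?R = "realization K"
  have b': "pathin ?R b" "b 0 = c" "b 1 = c"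
    using b by (auto simp: loops_at_def)
  have bK: "b s \<in> realization_points K" if "s \<in> {0..1}" for s
    using b'(1) that by (auto simp: pathin_def continuous_map_def)
  have c: "c \<in> realization_points K" "c v \<noteq> 0"
    using bK[of 0] star[of 0] b' by auto
  let ?v = "vertex_point v :: 'v \<Rightarrow> real"
  have supp_v: "bary_support ?v = {v}"
    by (auto simp: bary_support_def vertex_point_def)
  have v: "?v \<in> realization_points K"
    using face_simplex[OF realization_pointsD(2)[OF c(1)], of "{v}"] c(2)
    by (subst realization_points_iff[of "{v}"]) (auto simp: supp_v bary_support_def vertex_point_def)
  define l where "l = (\<lambda>(s::real) u. (1 - s) * c u + s * ?v u)"
  have supp_l: "bary_support (l s) \<subseteq> bary_support c" for s
    using c(2) by (auto simp: l_def bary_support_def vertex_point_def)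
  have l: "pathin ?R l"
    unfolding pathin_def
  proof (rule continuous_map_into_realization_finite)
    show "continuous_map (top_of_set {0..1}) euclideanreal (\<lambda>s. l s u)" for u
      by (auto simp: l_def intro!: continuous_intros)
    show "l s \<in> realization_points K" if "s \<in> topspace (top_of_set {0..1})" for s
      unfolding l_def
    proof (rule convex_combination_in_realization[OF c(1) v])
      have "bary_support c \<union> bary_support ?v = bary_support c"
        using c(2) unfolding supp_v by (auto simp: bary_support_def)
      then show "bary_support c \<union> bary_support ?v \<in> K"
        using realization_pointsD(2)[OF c(1)] by simp
    qed (use that in auto)
  qed (use supp_l finite_bary_support[OF c(1)] in auto)
  have l_ends: "l 0 = c" "l 1 = ?v"
    by (auto simp: l_def)
  have const: "pathin ?R (\<lambda>_. c)" "pathin ?R (\<lambda>_. ?v)"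
    using c(1) v by auto
  \<comment> \<open>The constant pieces align the two timings: \<open>?q\<close> runs through
    \<open>b\<close> exactly while \<open>?p\<close> rests at the vertex \<open>v\<close>, which
    belongs to every support of \<open>b\<close>; at all other times \<open>?q\<close> rests at
    \<open>c\<close> and \<open>?p\<close> is on the segment, whose supports lie in that of
    \<open>c\<close>.\<close>
  let ?p = "(l \<star> (\<lambda>_. ?v)) \<star> path_rev l" and ?q = "((\<lambda>_. c) \<star> b) \<star> (\<lambda>_. c)"
  have pq: "pathin ?R ?p" "pathin ?R ?q"
    using l l_ends const b' by (auto intro!: pathin_concat pathin_rev)
  have "path_homotopic ?R b ((\<lambda>_. c) \<star> b)"
    by (rule path_homotopic_sym, rule path_homotopic_const_concat) (use b' in auto)
  also have "path_homotopic ?R \<dots> ?q"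
    by (rule path_homotopic_sym, rule path_homotopic_concat_const)
      (use b' const in \<open>auto intro!: pathin_concat\<close>)
  also have "path_homotopic ?R ?q ?p"
  proof (rule contiguous_paths_homotopic[OF pq(2,1)])
    fix s :: real assume s: "s \<in> {0..1}"
    have c_supp: "bary_support c \<in> K"
      using c(1) by (rule realization_pointsD(2))
    consider "s \<le> 1/4" | "1/4 < s" "s \<le> 1/2" | "s > 1/2" by linarith
    then show "bary_support (?q s) \<union> bary_support (?p s) \<in> K"
    proof cases
      case 1
      then have "?q s = c" "?p s = l (4 * s)"
        by (simp_all add: path_concat_def)
      then show ?thesis
        using supp_l c_supp by (simp add: sup.absorb1)
    next
      case 2
      then have "?q s = b (4 * s - 1)" "?p s = ?v"
        by (simp_all add: path_concat_def)
      moreover have "4 * s - 1 \<in> {0..1}"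
        using 2 by auto
      then have "bary_support (b (4 * s - 1)) \<union> {v} = bary_support (b (4 * s - 1))"
        "bary_support (b (4 * s - 1)) \<in> K"
        using star realization_pointsD(2)[OF bK] by (auto simp: bary_support_def)
      ultimately show ?thesis
        by (simp add: supp_v)
    next
      case 3
      then have "?q s = c" "?p s = l (1 - (2 * s - 1))"
        by (simp_all add: path_concat_def path_rev_def)
      then show ?thesis
        using supp_l c_supp by (simp add: sup.absorb1)
    qed
  qed (use l_ends in auto)
  also have "path_homotopic ?R ?p (l \<star> path_rev l)"
    by (rule path_homotopic_concat)
      (use l l_ends in \<open>auto simp: path_homotopic_refl pathin_rev intro: path_homotopic_concat_const\<close>)
  also have "path_homotopic ?R \<dots> (\<lambda>_. c)"
    using path_homotopic_concat_rev[OF l] l_ends by simp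
  finally show ?thesis .
qed

end

section \<open>Simplicial maps, and the nerve as a complex\<close>

text \<open>Nonnegative coordinates cannot cancel when the fibres of \<open>f\<close> are
  summed.\<close>

lemma bary_support_realization_map:
  assumes "\<And>v. 0 \<le> b v" "finite (bary_support b)"
  shows "bary_support (realization_map f b) = f ` bary_support b"
proof -
  have "realization_map f b w \<noteq> 0 \<longleftrightarrow> w \<in> f ` bary_support b" for w
  proof
    show "w \<in> f ` bary_support b" if "realization_map f b w \<noteq> 0"
    proof -
      have "{v. v \<in> bary_support b \<and> f v = w} \<noteq> {}"
        using that unfolding realization_map_def by (metis sum.empty)
      then show ?thesis by blast
    qed
    assume "w \<in> f ` bary_support b"
    then obtain v where v: "v \<in> bary_support b" "f v = w" by blast
    then have "0 < b v"
      using assms(1)[of v] by (simp add: bary_support_def less_le)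
    then have "0 < realization_map f b w"
      unfolding realization_map_def by (intro sum_pos2[of _ v]) (use v assms in auto)
    then show "realization_map f b w \<noteq> 0" by simp
  qed
  then show ?thesis
    by (auto simp: bary_support_def)
qed

lemma continuous_map_realization_map:
  assumes "finite_complex K" "finite_complex L" and f: "\<And>\<sigma>. \<sigma> \<in> K \<Longrightarrow> f ` \<sigma> \<in> L"
  shows "continuous_map (realization K) (realization L) (realization_map f)"
proof -
  interpret K: finite_complex K by fact
  interpret L: finite_complex L by fact
  have supp: "bary_support (realization_map f b) = f ` bary_support b"
    if "b \<in> realization_points K" for b
    using that by (intro bary_support_realization_map K.finite_bary_support realization_pointsD)
  have point: "realization_map f b \<in> realization_points L" if b: "b \<in> realization_points K" for b
  proof -
    let ?S = "bary_support b"
    have "(\<Sum>w\<in>f ` ?S. realization_map f b w) = (\<Sum>v\<in>?S. b v)"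
      using sum.image_gen[OF K.finite_bary_support[OF b], of b f]
      by (simp add: realization_map_def)
    then show ?thesis
      using b f[of ?S] supp[OF b] realization_pointsD[OF b]
      by (subst L.realization_points_iff[of "f ` ?S"])
        (auto simp: realization_map_def realization_points_def intro!: sum_nonneg)
  qed
  show ?thesis
  proof (rule K.continuous_map_from_realization)
    fix \<sigma> assume \<sigma>: "\<sigma> \<in> K"
    show "continuous_map (top_of_set (closed_simplex K \<sigma>)) (realization L) (realization_map f)"
    proof (rule L.continuous_map_into_realization_finite)
      fix w
      have eq: "(\<Sum>v | v \<in> \<sigma> \<and> f v = w. b v) = realization_map f b w"
        if "b \<in> closed_simplex K \<sigma>" for b
        unfolding realization_map_def
        by (rule sum.mono_neutral_right)
          (use that K.finite_simplex[OF \<sigma>] in \<open>auto simp: closed_simplex_def bary_support_def\<close>)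
      have "continuous_on (closed_simplex K \<sigma>) (\<lambda>b. \<Sum>v | v \<in> \<sigma> \<and> f v = w. b v)"
        by (intro continuous_on_sum continuous_on_subset[OF continuous_on_product_coordinates]) simp
      then have "continuous_on (closed_simplex K \<sigma>) (\<lambda>b. realization_map f b w)"
        by (rule continuous_on_eq) (rule eq)
      then show "continuous_map (top_of_set (closed_simplex K \<sigma>)) euclideanreal
          (\<lambda>b. realization_map f b w)"
        by simp
    next
      show "finite (f ` \<sigma>)"
        using K.finite_simplex[OF \<sigma>] by simp
    qed (use point supp in \<open>auto simp: closed_simplex_def\<close>)
  qed
qed

interpretation nerve: finite_complex "nerve \<U>" for \<U>
proof
  show "\<tau> \<in> nerve \<U>" if \<sigma>: "\<sigma> \<in> nerve \<U>" "\<tau> \<subseteq> \<sigma>" "\<tau> \<noteq> {}" for \<sigma> \<tau>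
  proof -
    have "\<Inter>\<sigma> \<subseteq> \<Inter>\<tau>"
      using \<sigma>(2) by (rule Inter_anti_mono)
    then show ?thesis
      using \<sigma> finite_subset by (auto simp: nerve_def)
  qed
qed (auto simp: nerve_def)

section \<open>Spaces glued from sheets\<close>

text \<open>\<open>E y y'\<close> says that \<open>y\<close> and \<open>y'\<close> lie in one sheet over a member of \<open>\<W>\<close>. Functions into \<open>X\<close>
  that are merely locally contained in a member of \<open>\<W>\<close>, hence possibly discontinuous,
  still have unique lifts to \<open>Y\<close>.\<close>

locale sheets =
  fixes X :: "'a topology" and \<W> :: "'a set set" and Y :: "'y set" and r :: "'y \<Rightarrow> 'a"
    and E :: "'y \<Rightarrow> 'y \<Rightarrow> bool"
  assumes cover: "open_cover X \<W>"
    and surj: "r ` Y = topspace X"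
    and E_refl: "y \<in> Y \<Longrightarrow> E y y"
    and E_sym: "y \<in> Y \<Longrightarrow> y' \<in> Y \<Longrightarrow> E y y' \<Longrightarrow> E y' y"
    and E_trans: "W \<in> \<W> \<Longrightarrow> y \<in> Y \<Longrightarrow> y' \<in> Y \<Longrightarrow> y'' \<in> Y \<Longrightarrow> r y \<in> W \<Longrightarrow> r y' \<in> W \<Longrightarrow> r y'' \<in> W \<Longrightarrow>
      E y y' \<Longrightarrow> E y' y'' \<Longrightarrow> E y y''"
    and E_ex: "W \<in> \<W> \<Longrightarrow> y \<in> Y \<Longrightarrow> r y \<in> W \<Longrightarrow> x \<in> W \<Longrightarrow> \<exists>y'\<in>Y. r y' = x \<and> E y y'"
    and E_inj: "y \<in> Y \<Longrightarrow> y' \<in> Y \<Longrightarrow> E y y' \<Longrightarrow> r y = r y' \<Longrightarrow> y = y'"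
begin

text \<open>Given by neighbourhoods and not by a basis: for an open \<open>U\<close> outside all
  members of \<W> the points over \<open>U\<close> related to \<open>y\<close> need not form an open
  set, as transitivity is known only over members.\<close>

definition sheet_topology :: "'y topology"
  where "sheet_topology = topology (\<lambda>G. G \<subseteq> Y \<and>
    (\<forall>y\<in>G. \<exists>U. openin X U \<and> r y \<in> U \<and> (\<forall>y'\<in>Y. r y' \<in> U \<and> E y y' \<longrightarrow> y' \<in> G)))"

lemma openin_sheet_topology:
  "openin sheet_topology G \<longleftrightarrow> G \<subseteq> Y \<and>
    (\<forall>y\<in>G. \<exists>U. openin X U \<and> r y \<in> U \<and> (\<forall>y'\<in>Y. r y' \<in> U \<and> E y y' \<longrightarrow> y' \<in> G))"
proof -
  have "istopology (\<lambda>G. G \<subseteq> Y \<and>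
    (\<forall>y\<in>G. \<exists>U. openin X U \<and> r y \<in> U \<and> (\<forall>y'\<in>Y. r y' \<in> U \<and> E y y' \<longrightarrow> y' \<in> G)))" (is "istopology ?op")
    unfolding istopology_def
  proof (intro conjI allI impI ballI)
    fix S T y assume S: "?op S" and T: "?op T" and y: "y \<in> S \<inter> T"
    obtain U where U: "openin X U" "r y \<in> U" "\<And>y'. y' \<in> Y \<Longrightarrow> r y' \<in> U \<Longrightarrow> E y y' \<Longrightarrow> y' \<in> S"
      using S y by blast
    obtain V where V: "openin X V" "r y \<in> V" "\<And>y'. y' \<in> Y \<Longrightarrow> r y' \<in> V \<Longrightarrow> E y y' \<Longrightarrow> y' \<in> T"
      using T y by blast
    show "\<exists>U. openin X U \<and> r y \<in> U \<and> (\<forall>y'\<in>Y. r y' \<in> U \<and> E y y' \<longrightarrow> y' \<in> S \<inter> T)"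
      by (rule exI[of _ "U \<inter> V"]) (use U V in auto)
  next
    fix \<K> y assume K: "\<forall>S\<in>\<K>. ?op S" and "y \<in> \<Union>\<K>"
    then obtain S where "S \<in> \<K>" "y \<in> S" by blast
    moreover from this obtain U where "openin X U" "r y \<in> U" "\<forall>y'\<in>Y. r y' \<in> U \<and> E y y' \<longrightarrow> y' \<in> S"
      using K by blast
    ultimately show "\<exists>U. openin X U \<and> r y \<in> U \<and> (\<forall>y'\<in>Y. r y' \<in> U \<and> E y y' \<longrightarrow> y' \<in> \<Union>\<K>)"
      by blast
  qed auto
  then show ?thesis
    unfolding sheet_topology_def by simp
qed

lemma openin_cover: "W \<in> \<W> \<Longrightarrow> openin X W"
  using cover by (simp add: open_cover_def)

lemma member_of_cover: "x \<in> topspace X \<Longrightarrow> \<exists>W\<in>\<W>. x \<in> W"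
  using cover by (auto simp: open_cover_def)

lemma r_in_topspace: "y \<in> Y \<Longrightarrow> r y \<in> topspace X"
  using surj by blast

lemma topspace_sheet_topology [simp]: "topspace sheet_topology = Y"
proof -
  have "openin sheet_topology Y"
    unfolding openin_sheet_topology using r_in_topspace by blast
  moreover have "topspace sheet_topology \<subseteq> Y"
    using openin_sheet_topology by blast
  ultimately show ?thesis
    using openin_subset by blast
qed

definition sheet :: "'y \<Rightarrow> 'a set \<Rightarrow> 'y set"
  where "sheet y W = {y' \<in> Y. r y' \<in> W \<and> E y y'}"

lemma openin_sheet:
  assumes W: "W \<in> \<W>" and y: "y \<in> Y" "r y \<in> W"
  shows "openin sheet_topology (sheet y W)"
  unfolding openin_sheet_topology
proof (intro conjI ballI)
  fix y' assume "y' \<in> sheet y W"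
  then have y': "y' \<in> Y" "r y' \<in> W" "E y y'"
    by (auto simp: sheet_def)
  have "y'' \<in> sheet y W" if "y'' \<in> Y" "r y'' \<in> W" "E y' y''" for y''
    using E_trans[OF W y(1) y'(1) that(1) y(2) y'(2) that(2) y'(3) that(3)] that
    by (simp add: sheet_def)
  moreover have "openin X W"
    using W by (rule openin_cover)
  ultimately show "\<exists>U. openin X U \<and> r y' \<in> U \<and> (\<forall>y''\<in>Y. r y'' \<in> U \<and> E y' y'' \<longrightarrow> y'' \<in> sheet y W)"
    using y'(2) by blast
qed (auto simp: sheet_def)

lemma continuous_map_r: "continuous_map sheet_topology X r"
  unfolding continuous_map
proof (intro conjI allI impI)
  fix U assume "openin X U"
  then show "openin sheet_topology {y \<in> topspace sheet_topology. r y \<in> U}"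
    unfolding openin_sheet_topology by auto
qed (use surj in auto)

lemma open_map_r: "open_map sheet_topology X r"
  unfolding open_map_def
proof (intro allI impI)
  fix G assume G: "openin sheet_topology G"
  have "\<exists>T. openin X T \<and> r y \<in> T \<and> T \<subseteq> r ` G" if y: "y \<in> G" for y
  proof -
    have yY: "y \<in> Y"
      using G y by (auto simp: openin_sheet_topology)
    obtain U where U: "openin X U" "r y \<in> U" "\<And>y'. y' \<in> Y \<Longrightarrow> r y' \<in> U \<Longrightarrow> E y y' \<Longrightarrow> y' \<in> G"
      using G y unfolding openin_sheet_topology by blast
    obtain W where W: "W \<in> \<W>" "r y \<in> W"
      using member_of_cover[OF r_in_topspace[OF yY]] by blast
    have "x \<in> r ` G" if "x \<in> U \<inter> W" for x
      using E_ex[OF W(1) yY W(2), of x] U(3) that by blast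
    moreover have "openin X (U \<inter> W)"
      using U(1) openin_cover[OF W(1)] by blast
    ultimately show ?thesis
      using U(2) W(2) by blast
  qed
  then show "openin X (r ` G)"
    by (subst openin_subopen) blast
qed

text \<open>Members of \<W> are evenly covered: over \<open>W\<close> the relation \<open>E\<close>
  is an equivalence, its classes are the sheets, and \<open>E_ex\<close> and \<open>E_inj\<close>
  make \<open>r\<close> a bijection from each sheet to \<open>W\<close>.\<close>

lemma covering_map_sheet_topology: "covering_map sheet_topology X r"
  unfolding covering_map_def
proof (intro conjI ballI)
  fix x assume "x \<in> topspace X"
  then obtain W where W: "W \<in> \<W>" "x \<in> W"
    using member_of_cover by blast
  let ?\<V> = "(\<lambda>y. sheet y W) ` {y \<in> Y. r y \<in> W}"
  have "\<Union>?\<V> = {y \<in> topspace sheet_topology. r y \<in> W}"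
    using E_refl by (auto simp: sheet_def)
  moreover have "\<forall>V\<in>?\<V>. openin sheet_topology V"
    using openin_sheet[OF W(1)] by auto
  moreover have "pairwise disjnt ?\<V>"
  proof -
    have sub: "sheet y W \<subseteq> sheet y' W"
      if "y \<in> Y" "r y \<in> W" "y' \<in> Y" "r y' \<in> W" "z \<in> sheet y W" "z \<in> sheet y' W" for y y' z
    proof -
      have z: "z \<in> Y" "r z \<in> W" "E y z" "E y' z"
        using that by (auto simp: sheet_def)
      have "E y' y"
        using E_trans[OF W(1) that(3) z(1) that(1) that(4) z(2) that(2) z(4)] E_sym z that by blast
      then show ?thesis
        using E_trans[OF W(1) that(3) that(1)] that by (auto simp: sheet_def)
    qed
    then have "sheet y W = sheet y' W"
      if "y \<in> Y" "r y \<in> W" "y' \<in> Y" "r y' \<in> W" "\<not> disjnt (sheet y W) (sheet y' W)" for y y'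
      using that by (auto simp: disjnt_iff)
    then show ?thesis
      unfolding pairwise_def by blast
  qed
  moreover have "homeomorphic_map (subtopology sheet_topology V) (subtopology X W) r"
    if V: "V \<in> ?\<V>" for V
  proof -
    obtain y where y: "y \<in> Y" "r y \<in> W" "V = sheet y W"
      using V by blast
    have VY: "V \<subseteq> Y" and WX: "W \<subseteq> topspace X"
      using y cover W by (auto simp: sheet_def open_cover_def)
    have img: "r ` V = W"
      using E_ex[OF W(1) y(1,2)] by (auto simp: y(3) sheet_def image_iff)
    show ?thesis
    proof (rule bijective_open_imp_homeomorphic_map)
      show "continuous_map (subtopology sheet_topology V) (subtopology X W) r"
        using continuous_map_r img
        by (auto simp: continuous_map_in_subtopology intro: continuous_map_from_subtopology)
      have "openin X (r ` G)" if "openin (subtopology sheet_topology V) G" for G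
        using that open_map_r openin_sheet[OF W(1) y(1,2)]
        by (metis open_map_def openin_open_subtopology y(3))
      moreover have "G \<subseteq> V" if "openin (subtopology sheet_topology V) G" for G
        using openin_subset[OF that] by auto
      ultimately show "open_map (subtopology sheet_topology V) (subtopology X W) r"
        using img cover W(1) unfolding open_map_def
        by (metis image_mono open_cover_def openin_open_subtopology)
      show "r ` topspace (subtopology sheet_topology V) = topspace (subtopology X W)"
        using img VY WX by (simp add: inf.absorb2)
      show "inj_on r (topspace (subtopology sheet_topology V))"
      proof (rule inj_onI)
        fix a b assume "a \<in> topspace (subtopology sheet_topology V)"
          "b \<in> topspace (subtopology sheet_topology V)" "r a = r b"
        then have ab: "a \<in> Y" "b \<in> Y" "r a \<in> W" "r b \<in> W" "E y a" "E y b" "r a = r b"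
          by (auto simp: y(3) sheet_def)
        then have "E a b"
          using E_trans[OF W(1) ab(1) y(1) ab(2) ab(3) y(2) ab(4)] E_sym y by blast
        then show "a = b"
          using E_inj ab by blast
      qed
    qed
  qed
  ultimately show "\<exists>T. openin X T \<and> x \<in> T \<and>
      (\<exists>\<V>. \<Union>\<V> = {y \<in> topspace sheet_topology. r y \<in> T} \<and>
        (\<forall>V\<in>\<V>. openin sheet_topology V) \<and> pairwise disjnt \<V> \<and>
        (\<forall>V\<in>\<V>. homeomorphic_map (subtopology sheet_topology V) (subtopology X T) r))"
    using W cover unfolding open_cover_def by (intro exI[of _ W] conjI exI[of _ ?\<V>]) auto
qed (use continuous_map_r surj in auto)

section \<open>Lifting functions that need not be continuous\<close>

definition small_on :: "'z::metric_space set \<Rightarrow> ('z \<Rightarrow> 'a) \<Rightarrow> bool"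
  where "small_on S k \<longleftrightarrow> (\<forall>z\<in>S. \<exists>d>0. \<exists>W\<in>\<W>. \<forall>z'\<in>S. dist z' z < d \<longrightarrow> k z' \<in> W)"

text \<open>Staying locally in one sheet replaces continuity of the lift; for continuous
  \<open>k\<close> the two notions agree, by \<open>lift_on_continuous\<close> and
  \<open>continuous_lift\<close>.\<close>

definition lift_on :: "'z::metric_space set \<Rightarrow> ('z \<Rightarrow> 'a) \<Rightarrow> ('z \<Rightarrow> 'y) \<Rightarrow> bool"
  where "lift_on S k \<kappa> \<longleftrightarrow>
    (\<forall>z\<in>S. \<kappa> z \<in> Y \<and> r (\<kappa> z) = k z \<and> (\<exists>d>0. \<forall>z'\<in>S. dist z' z < d \<longrightarrow> E (\<kappa> z) (\<kappa> z')))"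

text \<open>The starting point is arbitrary in \<open>S\<close>, so that gluing can begin in either
  piece and enter the other through any common point.\<close>

definition liftable :: "'z::metric_space set \<Rightarrow> ('z \<Rightarrow> 'a) \<Rightarrow> bool"
  where "liftable S k \<longleftrightarrow> (\<forall>z\<in>S. \<forall>y\<in>Y. r y = k z \<longrightarrow> (\<exists>\<kappa>. lift_on S k \<kappa> \<and> \<kappa> z = y))"

lemma small_on_subset: "small_on S k \<Longrightarrow> T \<subseteq> S \<Longrightarrow> small_on T k"
  unfolding small_on_def by (meson subsetD)

lemma lift_on_subset: "lift_on S k \<kappa> \<Longrightarrow> T \<subseteq> S \<Longrightarrow> lift_on T k \<kappa>"
  unfolding lift_on_def by (meson subsetD)

lemma lift_onD:
  assumes "lift_on S k \<kappa>" "z \<in> S"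
  shows "\<kappa> z \<in> Y" "r (\<kappa> z) = k z"
  using assms by (auto simp: lift_on_def)

text \<open>Agreement is locally constant: near \<open>a\<close> both lifts stay in their sheets
  over a single \<open>W\<close>, and two points of one sheet with the same projection coincide by
  \<open>E_inj\<close>.\<close>

lemma lift_on_unique:
  assumes S: "connected S" and small: "small_on S k"
    and lift: "lift_on S k \<kappa>" "lift_on S k \<kappa>'"
    and eq: "\<kappa> z0 = \<kappa>' z0" and z: "z0 \<in> S" "z \<in> S"
  shows "\<kappa> z = \<kappa>' z"
proof -
  have "\<forall>\<^sub>F b in at a within S. (\<kappa> a = \<kappa>' a) = (\<kappa> b = \<kappa>' b)" if a: "a \<in> S" for a
  proof -
    obtain d W where d: "d > 0" "W \<in> \<W>" "\<And>b. b \<in> S \<Longrightarrow> dist b a < d \<Longrightarrow> k b \<in> W"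
      using small a unfolding small_on_def by meson
    obtain d1 where d1: "d1 > 0" "\<And>b. b \<in> S \<Longrightarrow> dist b a < d1 \<Longrightarrow> E (\<kappa> a) (\<kappa> b)"
      using lift(1) a unfolding lift_on_def by meson
    obtain d2 where d2: "d2 > 0" "\<And>b. b \<in> S \<Longrightarrow> dist b a < d2 \<Longrightarrow> E (\<kappa>' a) (\<kappa>' b)"
      using lift(2) a unfolding lift_on_def by meson
    have "(\<kappa> a = \<kappa>' a) = (\<kappa> b = \<kappa>' b)" if b: "b \<in> S" "dist b a < min d (min d1 d2)" for b
    proof -
      have W: "k a \<in> W" "k b \<in> W"
        using d a b by auto
      have E: "E (\<kappa> a) (\<kappa> b)" "E (\<kappa>' a) (\<kappa>' b)"
        using d1 d2 b by auto
      note Y = lift_onD[OF lift(1) a] lift_onD[OF lift(1) b(1)]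
        lift_onD[OF lift(2) a] lift_onD[OF lift(2) b(1)]
      show ?thesis
      proof
        assume "\<kappa> a = \<kappa>' a"
        then have "E (\<kappa> b) (\<kappa>' b)"
          using E_trans[OF d(2), of "\<kappa> b" "\<kappa> a" "\<kappa>' b"] E_sym E W Y by metis
        then show "\<kappa> b = \<kappa>' b"
          using E_inj Y by metis
      next
        assume "\<kappa> b = \<kappa>' b"
        then have "E (\<kappa> a) (\<kappa>' a)"
          using E_trans[OF d(2), of "\<kappa> a" "\<kappa> b" "\<kappa>' a"] E_sym E W Y by metis
        then show "\<kappa> a = \<kappa>' a"
          using E_inj Y by metis
      qed
    qed
    then show ?thesis
      using d(1) d1(1) d2(1) unfolding eventually_at by (intro exI[of _ "min d (min d1 d2)"]) auto
  qed
  then show ?thesis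
    using connected_local_const[OF S z, of "\<lambda>z. \<kappa> z = \<kappa>' z"] eq by blast
qed

lemma lift_on_glue:
  assumes closed: "closed S" "closed T" and lift: "lift_on S k \<kappa>" "lift_on T k \<kappa>'"
    and eq: "\<And>z. z \<in> S \<Longrightarrow> z \<in> T \<Longrightarrow> \<kappa> z = \<kappa>' z"
  shows "lift_on (S \<union> T) k (\<lambda>z. if z \<in> S then \<kappa> z else \<kappa>' z)"
proof -
  \<comment> \<open>Closedness enters here: if \<open>z\<close> is outside \<open>A\<close>, a small
    ball around it misses \<open>A\<close> and the claim is vacuous. Hence only the pieces that
    contain \<open>z\<close> matter near \<open>z\<close>.\<close>
  have near: "\<exists>d>0. \<forall>z'\<in>A. dist z' z < d \<longrightarrow> z \<in> A \<and> E (\<mu> z) (\<mu> z')"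
    if A: "closed A" "lift_on A k \<mu>" for A z \<mu>
  proof (cases "z \<in> A")
    case True
    then show ?thesis
      using A(2) unfolding lift_on_def by meson
  next
    case False
    then obtain d where "d > 0" "ball z d \<subseteq> - A"
      using A(1) open_contains_ball by (metis ComplI open_Compl)
    then show ?thesis
      by (intro exI[of _ d]) (auto simp: dist_commute subset_iff)
  qed
  show ?thesis
    unfolding lift_on_def
  proof (intro ballI conjI)
    fix z assume z: "z \<in> S \<union> T"
    obtain d1 where d1: "d1 > 0" "\<And>z'. z' \<in> S \<Longrightarrow> dist z' z < d1 \<Longrightarrow> z \<in> S \<and> E (\<kappa> z) (\<kappa> z')"
      using near[OF closed(1) lift(1)] by meson
    obtain d2 where d2: "d2 > 0" "\<And>z'. z' \<in> T \<Longrightarrow> dist z' z < d2 \<Longrightarrow> z \<in> T \<and> E (\<kappa>' z) (\<kappa>' z')"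
      using near[OF closed(2) lift(2)] by meson
    show "\<exists>d>0. \<forall>z'\<in>S \<union> T. dist z' z < d \<longrightarrow>
        E (if z \<in> S then \<kappa> z else \<kappa>' z) (if z' \<in> S then \<kappa> z' else \<kappa>' z')"
      by (rule exI[of _ "min d1 d2"]) (use d1 d2 eq in fastforce)
  qed (use lift in \<open>auto simp: lift_on_def\<close>)
qed

text \<open>Lifts on the two pieces are matched at one common point \<open>w\<close>; connectedness
  of the intersection and uniqueness extend the agreement to all common points.\<close>

lemma liftable_glue:
  assumes closed: "closed S" "closed T" and conn: "connected (S \<inter> T)" "S \<inter> T \<noteq> {}"
    and small: "small_on (S \<union> T) k" and lift: "liftable S k" "liftable T k"
  shows "liftable (S \<union> T) k"
  unfolding liftable_def
proof (intro ballI impI)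
  fix z y assume z: "z \<in> S \<union> T" and y: "y \<in> Y" "r y = k z"
  obtain w where w: "w \<in> S" "w \<in> T"
    using conn(2) by blast
  have "\<exists>\<kappa> \<kappa>'. lift_on S k \<kappa> \<and> lift_on T k \<kappa>' \<and> \<kappa> w = \<kappa>' w \<and> (z \<in> S \<longrightarrow> \<kappa> z = y) \<and> (z \<notin> S \<longrightarrow> \<kappa>' z = y)"
  proof (cases "z \<in> S")
    case True
    then obtain \<kappa> where \<kappa>: "lift_on S k \<kappa>" "\<kappa> z = y"
      using lift(1) y unfolding liftable_def by meson
    moreover obtain \<kappa>' where "lift_on T k \<kappa>'" "\<kappa>' w = \<kappa> w"
      using lift(2) w lift_onD[OF \<kappa>(1) w(1)] unfolding liftable_def by meson
    ultimately show ?thesis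
      using True by metis
  next
    case False
    then obtain \<kappa>' where \<kappa>': "lift_on T k \<kappa>'" "\<kappa>' z = y"
      using lift(2) y z unfolding liftable_def by blast
    moreover obtain \<kappa> where "lift_on S k \<kappa>" "\<kappa> w = \<kappa>' w"
      using lift(1) w lift_onD[OF \<kappa>'(1) w(2)] unfolding liftable_def by meson
    ultimately show ?thesis
      using False by metis
  qed
  then obtain \<kappa> \<kappa>' where \<kappa>: "lift_on S k \<kappa>" "lift_on T k \<kappa>'" "\<kappa> w = \<kappa>' w"
    "z \<in> S \<longrightarrow> \<kappa> z = y" "z \<notin> S \<longrightarrow> \<kappa>' z = y"
    by blast
  have "lift_on (S \<union> T) k (\<lambda>z. if z \<in> S then \<kappa> z else \<kappa>' z)"
  proof (rule lift_on_glue[OF closed \<kappa>(1,2)])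
    fix u assume "u \<in> S" "u \<in> T"
    then show "\<kappa> u = \<kappa>' u"
      using lift_on_unique[OF conn(1) small_on_subset[OF small] lift_on_subset[OF \<kappa>(1)]
          lift_on_subset[OF \<kappa>(2)] \<kappa>(3)] w by blast
  qed
  moreover have "(if z \<in> S then \<kappa> z else \<kappa>' z) = y"
    using \<kappa>(4,5) by simp
  ultimately show "\<exists>\<kappa>. lift_on (S \<union> T) k \<kappa> \<and> \<kappa> z = y"
    by (intro exI[of _ "\<lambda>z. if z \<in> S then \<kappa> z else \<kappa>' z"]) simp
qed

text \<open>Over a single member the lift is the choice, at each point, of the partner of
  \<open>y\<close> in its sheet.\<close>

lemma liftable_small:
  assumes W: "W \<in> \<W>" "\<And>z. z \<in> S \<Longrightarrow> k z \<in> W"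
  shows "liftable S k"
  unfolding liftable_def
proof (intro ballI impI)
  fix z0 y assume z0: "z0 \<in> S" and y: "y \<in> Y" "r y = k z0"
  then have "r y \<in> W"
    using W(2) by simp
  then have "\<forall>z\<in>S. \<exists>y'. y' \<in> Y \<and> r y' = k z \<and> E y y'"
    using E_ex[OF W(1) y(1) _ W(2)] by blast
  from bchoice[OF this] obtain \<kappa> where \<kappa>: "\<And>z. z \<in> S \<Longrightarrow> \<kappa> z \<in> Y"
    "\<And>z. z \<in> S \<Longrightarrow> r (\<kappa> z) = k z" "\<And>z. z \<in> S \<Longrightarrow> E y (\<kappa> z)"
    by blast
  have "E (\<kappa> z) (\<kappa> z')" if z: "z \<in> S" "z' \<in> S" for z z'
  proof (rule E_trans[OF W(1) \<kappa>(1)[OF z(1)] y(1) \<kappa>(1)[OF z(2)]])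
    show "E (\<kappa> z) y"
      by (rule E_sym[OF y(1) \<kappa>(1)[OF z(1)] \<kappa>(3)[OF z(1)]])
  qed (use \<kappa>(2,3) z y(2) z0 W(2) in simp_all)
  then have "lift_on S k \<kappa>"
    unfolding lift_on_def using \<kappa> zero_less_one by blast
  moreover have "\<kappa> z0 = y"
    using E_inj[OF y(1) \<kappa>(1)[OF z0] \<kappa>(3)[OF z0]] \<kappa>(2)[OF z0] y(2) by simp
  ultimately show "\<exists>\<kappa>. lift_on S k \<kappa> \<and> \<kappa> z0 = y"
    by blast
qed

lemma dist_Pair_le: "dist (a, b) (c, d) \<le> dist a c + dist b d"
  by (simp add: dist_Pair_Pair sqrt_sum_squares_le_sum)

text \<open>Two nested bisections. For fixed \<open>x\<close>, the vertical one glues small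
  rectangles to a full strip around \<open>x\<close>; the horizontal one then glues strips. The
  widths belong to the induction predicate \<open>?Q\<close>, since a strip can be no wider than its
  narrowest rectangle.\<close>

lemma liftable_square:
  fixes k :: "real \<times> real \<Rightarrow> 'a"
  assumes small: "small_on ({0..1} \<times> {0..1}) k"
  shows "liftable ({0..1} \<times> {0..1}) k"
proof -
  have strip: "\<exists>\<delta>>0. \<forall>a b. a \<le> x \<and> x \<le> b \<and> b - a < \<delta> \<longrightarrow>
      (0 \<le> a \<and> b \<le> 1 \<longrightarrow> liftable ({a..b} \<times> {0..1}) k)" if x: "0 \<le> x" "x \<le> 1" for x
  proof -
    let ?Q = "\<lambda>c e. 0 \<le> c \<and> e \<le> 1 \<longrightarrow> (\<exists>\<delta>>0. \<forall>a b. a \<le> x \<and> x \<le> b \<and> b - a < \<delta> \<longrightarrow>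
      0 \<le> a \<and> b \<le> 1 \<longrightarrow> liftable ({a..b} \<times> {c..e}) k)"
    have "?Q 0 1"
    proof (rule Bolzano[where P = ?Q])
      fix c e f assume Q: "?Q c e" "?Q e f" and le: "c \<le> e" "e \<le> f"
      show "?Q c f"
      proof
        assume cf: "0 \<le> c \<and> f \<le> 1"
        obtain \<delta> where \<delta>: "\<delta> > 0" "\<And>a b. a \<le> x \<Longrightarrow> x \<le> b \<Longrightarrow> b - a < \<delta> \<Longrightarrow> 0 \<le> a \<Longrightarrow> b \<le> 1 \<Longrightarrow>
            liftable ({a..b} \<times> {c..e}) k"
          using Q(1) le cf by auto
        obtain \<epsilon> where \<epsilon>: "\<epsilon> > 0" "\<And>a b. a \<le> x \<Longrightarrow> x \<le> b \<Longrightarrow> b - a < \<epsilon> \<Longrightarrow> 0 \<le> a \<Longrightarrow> b \<le> 1 \<Longrightarrow>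
            liftable ({a..b} \<times> {e..f}) k"
          using Q(2) le cf by auto
        have "liftable ({a..b} \<times> {c..f}) k"
          if ab: "a \<le> x" "x \<le> b" "b - a < min \<delta> \<epsilon>" "0 \<le> a" "b \<le> 1" for a b
        proof -
          have un: "{a..b} \<times> {c..e} \<union> {a..b} \<times> {e..f} = {a..b} \<times> {c..f}"
            and int: "{a..b} \<times> {c..e} \<inter> {a..b} \<times> {e..f} = {a..b} \<times> {e}"
            using le by auto
          have "small_on ({a..b} \<times> {c..f}) k"
            by (rule small_on_subset[OF small]) (use ab cf in auto)
          then have "liftable ({a..b} \<times> {c..e} \<union> {a..b} \<times> {e..f}) k"
            using ab by (intro liftable_glue \<delta>(2) \<epsilon>(2)) (auto simp: un int intro!: closed_Times connected_Times)
          then show ?thesis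
            by (simp only: un)
        qed
        then show "\<exists>\<delta>>0. \<forall>a b. a \<le> x \<and> x \<le> b \<and> b - a < \<delta> \<longrightarrow>
            0 \<le> a \<and> b \<le> 1 \<longrightarrow> liftable ({a..b} \<times> {c..f}) k"
          using \<delta>(1) \<epsilon>(1) by (intro exI[of _ "min \<delta> \<epsilon>"]) auto
      qed
    next
      fix y :: real assume y: "0 \<le> y" "y \<le> 1"
      have "(x, y) \<in> {0..1} \<times> {0..1}"
        using x y by simp
      then obtain d W where d: "d > 0" "W \<in> \<W>"
        "\<And>z'. z' \<in> {0..1} \<times> {0..1} \<Longrightarrow> dist z' (x, y) < d \<Longrightarrow> k z' \<in> W"
        using small unfolding small_on_def by meson
      \<comment> \<open>Sides shorter than \<open>d/2\<close> keep the rectangle within distance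
        \<open>d\<close> of \<open>(x, y)\<close>, by the sum bound of
        \<open>dist_Pair_le\<close>.\<close>
      have "liftable ({a..b} \<times> {c..e}) k"
        if *: "a \<le> x" "x \<le> b" "b - a < d/2" "0 \<le> a" "b \<le> 1" "c \<le> y" "y \<le> e" "e - c < d/2" "0 \<le> c" "e \<le> 1"
        for a b c e
      proof (rule liftable_small[OF d(2)])
        fix z assume "z \<in> {a..b} \<times> {c..e}"
        then obtain u v where z: "z = (u, v)" "a \<le> u" "u \<le> b" "c \<le> v" "v \<le> e"
          by auto
        have "dist u x < d/2" "dist v y < d/2"
          using z * by (auto simp: dist_real_def abs_if)
        then have "dist z (x, y) < d"
          using dist_Pair_le[of u v x y] z(1) by simp
        then show "k z \<in> W"
          using d(3) z * by auto
      qed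
      then show "\<exists>\<delta>>0. \<forall>c e. c \<le> y \<and> y \<le> e \<and> e - c < \<delta> \<longrightarrow> ?Q c e"
        using d(1) by (intro exI[of _ "d/2"] conjI allI impI) auto
    qed simp
    then show ?thesis
      by auto
  qed
  let ?P = "\<lambda>a b. 0 \<le> a \<and> b \<le> 1 \<longrightarrow> liftable ({a..b} \<times> {0..1}) k"
  have "?P 0 1"
  proof (rule Bolzano[where P = ?P])
    fix a b c assume P: "?P a b" "?P b c" and le: "a \<le> b" "b \<le> c"
    show "?P a c"
    proof
      assume ac: "0 \<le> a \<and> c \<le> 1"
      have un: "{a..b} \<times> {0..1} \<union> {b..c} \<times> {0..1} = {a..c} \<times> {0..1::real}"
        and int: "({a..b} \<times> {0..1}) \<inter> ({b..c} \<times> {0..1}) = {b} \<times> {0..1::real}"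
        using le by auto
      have "small_on ({a..c} \<times> {0..1}) k"
        by (rule small_on_subset[OF small]) (use ac in auto)
      then have "liftable ({a..b} \<times> {0..1} \<union> {b..c} \<times> {0..1}) k"
        using P le ac by (intro liftable_glue) (auto simp: un int intro!: closed_Times connected_Times)
      then show "liftable ({a..c} \<times> {0..1}) k"
        by (simp only: un)
    qed
  qed (use strip in auto)
  then show ?thesis
    by simp
qed

text \<open>Lift the whole square. On the three edges where \<open>k\<close> is constant the lift is
  constant by uniqueness, so it has equal values at both ends of the remaining edge, where it is
  \<kappa>.\<close>

lemma lift_of_null_loop_closed:
  fixes k :: "real \<times> real \<Rightarrow> 'a"
  assumes small: "small_on ({0..1} \<times> {0..1}) k"
    and const: "\<And>t. t \<in> {0..1} \<Longrightarrow> k (t, 0) = x" "\<And>t. t \<in> {0..1} \<Longrightarrow> k (t, 1) = x"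
      "\<And>s. s \<in> {0..1} \<Longrightarrow> k (1, s) = x"
    and lift: "lift_on {0..1} (\<lambda>s. k (0, s)) \<kappa>"
  shows "\<kappa> 1 = \<kappa> 0"
proof -
  let ?I = "{0..1::real}"
  have 0: "\<kappa> 0 \<in> Y" "r (\<kappa> 0) = k (0, 0)"
    using lift_onD[OF lift] by auto
  obtain \<mu> where \<mu>: "lift_on (?I \<times> ?I) k \<mu>" "\<mu> (0, 0) = \<kappa> 0"
    using liftable_square[OF small, unfolded liftable_def, rule_format, of "(0, 0)" "\<kappa> 0"] 0 by auto
  let ?L = "?I \<times> {0} \<union> ({1} \<times> ?I \<union> ?I \<times> {1})"
  have L: "?L \<subseteq> ?I \<times> ?I"
    by auto
  have edges: "connected (?I \<times> {0})" "connected ({1} \<times> ?I)" "connected (?I \<times> {1})"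
    by (simp_all add: connected_Times)
  have corners: "(1, 1) \<in> {1} \<times> ?I \<inter> ?I \<times> {1}" "(1, 0) \<in> ?I \<times> {0} \<inter> ({1} \<times> ?I \<union> ?I \<times> {1})"
    by auto
  have "connected ?L"
    using connected_Un[OF edges(1) connected_Un[OF edges(2,3)]] corners by blast
  moreover have "lift_on ?L k (\<lambda>_. \<kappa> 0)"
    unfolding lift_on_def
  proof (intro ballI conjI)
    fix z assume "z \<in> ?L"
    then show "r (\<kappa> 0) = k z"
      using const 0(2) by auto
    show "\<exists>d>0. \<forall>z'\<in>?L. dist z' z < d \<longrightarrow> E (\<kappa> 0) (\<kappa> 0)"
      using E_refl[OF 0(1)] by (intro exI[of _ 1]) simp
  qed (rule 0(1))
  ultimately have "\<mu> (0, 1) = \<kappa> 0"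
    by (rule lift_on_unique[OF _ small_on_subset[OF small L] lift_on_subset[OF \<mu>(1) L] _ \<mu>(2)]) auto
  moreover have "\<mu> (0, 1) = \<kappa> 1"
  proof (rule lift_on_unique[where S = ?I and k = "\<lambda>s. k (0, s)" and \<kappa> = "\<lambda>s. \<mu> (0, s)"
        and \<kappa>' = \<kappa> and ?z0.0 = 0])
    have dist: "dist (0::real, s) (0, s') = dist s s'" for s s' :: real
      by (simp add: dist_Pair_Pair)
    have "\<exists>d>0. \<exists>W\<in>\<W>. \<forall>s'\<in>?I. dist s' s < d \<longrightarrow> k (0, s') \<in> W" if s: "s \<in> ?I" for s
    proof -
      have "(0, s) \<in> ?I \<times> ?I" using s by simp
      then obtain d W where "d > 0" "W \<in> \<W>" "\<And>z. z \<in> ?I \<times> ?I \<Longrightarrow> dist z (0, s) < d \<Longrightarrow> k z \<in> W"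
        using small unfolding small_on_def by meson
      then show ?thesis
        using dist by (intro exI[of _ d] conjI bexI[of _ W]) auto
    qed
    then show "small_on ?I (\<lambda>s. k (0, s))"
      by (simp add: small_on_def)
    have "\<exists>d>0. \<forall>s'\<in>?I. dist s' s < d \<longrightarrow> E (\<mu> (0, s)) (\<mu> (0, s'))" if s: "s \<in> ?I" for s
    proof -
      have "(0, s) \<in> ?I \<times> ?I" using s by simp
      then obtain d where "d > 0" "\<And>z. z \<in> ?I \<times> ?I \<Longrightarrow> dist z (0, s) < d \<Longrightarrow> E (\<mu> (0, s)) (\<mu> z)"
        using \<mu>(1) unfolding lift_on_def by meson
      then show ?thesis
        using dist by (intro exI[of _ d]) auto
    qed
    then show "lift_on ?I (\<lambda>s. k (0, s)) (\<lambda>s. \<mu> (0, s))"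
      using \<mu>(1) by (auto simp: lift_on_def)
  qed (use lift \<mu>(2) in auto)
  ultimately show ?thesis
    by simp
qed

section \<open>Comparison with continuous lifts\<close>

lemma small_on_continuous:
  fixes S :: "'z::metric_space set"
  assumes k: "continuous_map (top_of_set S) X k"
  shows "small_on S k"
  unfolding small_on_def
proof
  fix z assume z: "z \<in> S"
  then have "k z \<in> topspace X"
    using k by (auto simp: continuous_map_def)
  then obtain W where W: "W \<in> \<W>" "k z \<in> W"
    using member_of_cover by blast
  then have "openin (top_of_set S) {z \<in> S. k z \<in> W}"
    using openin_continuous_map_preimage[OF k openin_cover[OF W(1)]] by simp
  then obtain d where "d > 0" "\<forall>z'\<in>S. dist z' z < d \<longrightarrow> k z' \<in> W"
    using W(2) z unfolding openin_euclidean_subtopology_iff by auto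
  then show "\<exists>d>0. \<exists>W\<in>\<W>. \<forall>z'\<in>S. dist z' z < d \<longrightarrow> k z' \<in> W"
    using W(1) by blast
qed

lemma lift_on_continuous:
  fixes S :: "'z::metric_space set"
  assumes \<beta>: "continuous_map (top_of_set S) sheet_topology \<beta>"
  shows "lift_on S (r \<circ> \<beta>) \<beta>"
  unfolding lift_on_def
proof (intro ballI conjI)
  fix z assume z: "z \<in> S"
  show y: "\<beta> z \<in> Y"
    using \<beta> z by (auto simp: continuous_map_def)
  obtain W where W: "W \<in> \<W>" "r (\<beta> z) \<in> W"
    using member_of_cover[OF r_in_topspace[OF y]] by blast
  have "openin (top_of_set S) {z' \<in> S. \<beta> z' \<in> sheet (\<beta> z) W}"
    using openin_continuous_map_preimage[OF \<beta> openin_sheet[OF W(1) y W(2)]] by simp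
  moreover have "\<beta> z \<in> sheet (\<beta> z) W"
    using y W E_refl by (simp add: sheet_def)
  ultimately have "\<exists>d>0. \<forall>z'\<in>S. dist z' z < d \<longrightarrow> \<beta> z' \<in> sheet (\<beta> z) W"
    using z unfolding openin_euclidean_subtopology_iff by blast
  then show "\<exists>d>0. \<forall>z'\<in>S. dist z' z < d \<longrightarrow> E (\<beta> z) (\<beta> z')"
    by (auto simp: sheet_def)
qed simp

lemma continuous_lift:
  fixes S :: "'z::metric_space set"
  assumes lift: "lift_on S k \<kappa>" and k: "continuous_map (top_of_set S) X k"
  shows "continuous_map (top_of_set S) sheet_topology \<kappa>"
  unfolding continuous_map
proof (intro conjI allI impI)
  show "\<kappa> ` topspace (top_of_set S) \<subseteq> topspace sheet_topology"
    using lift by (auto simp: lift_on_def)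
  fix G assume G: "openin sheet_topology G"
  have "\<exists>d>0. \<forall>z'\<in>S. dist z' z < d \<longrightarrow> \<kappa> z' \<in> G" if z: "z \<in> S" "\<kappa> z \<in> G" for z
  proof -
    obtain U where U: "openin X U" "r (\<kappa> z) \<in> U" "\<And>y'. y' \<in> Y \<Longrightarrow> r y' \<in> U \<Longrightarrow> E (\<kappa> z) y' \<Longrightarrow> y' \<in> G"
      using G z(2) unfolding openin_sheet_topology by blast
    have "openin (top_of_set S) {z' \<in> S. k z' \<in> U}"
      using openin_continuous_map_preimage[OF k U(1)] by simp
    then obtain d where d: "d > 0" "\<And>z'. z' \<in> S \<Longrightarrow> dist z' z < d \<Longrightarrow> k z' \<in> U"
      using z U(2) lift_onD(2)[OF lift z(1)] unfolding openin_euclidean_subtopology_iff by auto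
    obtain e where e: "e > 0" "\<And>z'. z' \<in> S \<Longrightarrow> dist z' z < e \<Longrightarrow> E (\<kappa> z) (\<kappa> z')"
      using lift z(1) unfolding lift_on_def by meson
    have "\<kappa> z' \<in> G" if "z' \<in> S" "dist z' z < min d e" for z'
      using that d e lift_onD[OF lift that(1)] U(3) by simp
    then show ?thesis
      using d(1) e(1) by (intro exI[of _ "min d e"]) auto
  qed
  then show "openin (top_of_set S) {z \<in> topspace (top_of_set S). \<kappa> z \<in> G}"
    unfolding openin_euclidean_subtopology_iff by auto
qed

end

section \<open>The shape topology\<close>

lemma canonical_map_exists:
  assumes i: "i \<in> shape_index X x0" and x0: "x0 \<in> topspace X"
  shows "\<exists>p. canonical_map X x0 i p"
proof -
  obtain \<U> U0 \<phi> where i_eq: "i = (\<U>, U0)" and U0: "U0 \<in> \<U>"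
    and \<phi>: "subordinated_partition X \<U> \<phi>" "\<phi> U0 x0 = 1"
    using i by (auto simp: shape_index_def)
  \<comment> \<open>The partition functions serve as barycentric coordinates. They are unspecified
    outside \<U>, while \<open>bary_support\<close> ranges over all sets; hence the default
    0.\<close>
  define p where "p x U = (if U \<in> \<U> \<and> x \<in> topspace X then \<phi> U x else 0)" for x U
  have in_U: "x \<in> U" if "U \<in> \<U>" "x \<in> topspace X" "\<phi> U x \<noteq> 0" for x U
    using that \<phi>(1) closure_of_subset[of "{x \<in> topspace X. \<phi> U x \<noteq> 0}" X]
    unfolding subordinated_partition_def by blast
  have supp: "bary_support (p x) = {U \<in> \<U>. \<phi> U x \<noteq> 0}" if "x \<in> topspace X" for x
    using that by (auto simp: bary_support_def p_def)
  have loc: "\<exists>N F. openin X N \<and> x \<in> N \<and> finite F \<and> (\<forall>y\<in>N. bary_support (p y) \<subseteq> F)"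
    if x: "x \<in> topspace X" for x
  proof -
    have "\<forall>x\<in>topspace X. \<exists>N. openin X N \<and> x \<in> N \<and> finite {U \<in> \<U>. \<exists>y\<in>N. \<phi> U y \<noteq> 0}"
      using \<phi>(1) unfolding subordinated_partition_def by (elim conjE)
    from bspec[OF this x] obtain N
      where N: "openin X N" "x \<in> N" "finite {U \<in> \<U>. \<exists>y\<in>N. \<phi> U y \<noteq> 0}"
      by blast
    moreover have "bary_support (p y) \<subseteq> {U \<in> \<U>. \<exists>y\<in>N. \<phi> U y \<noteq> 0}" if "y \<in> N" for y
      using that by (auto simp: bary_support_def p_def)
    ultimately show ?thesis
      by blast
  qed
  have sum: "(\<Sum>U\<in>bary_support (p x). p x U) = 1" if x: "x \<in> topspace X" for x
  proof -
    have "(\<Sum>U\<in>bary_support (p x). p x U) = (\<Sum>U | U \<in> \<U> \<and> \<phi> U x \<noteq> 0. \<phi> U x)"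
      unfolding supp[OF x] by (rule sum.cong) (auto simp: p_def x)
    then show ?thesis
      using \<phi>(1) x unfolding subordinated_partition_def by simp
  qed
  have fin: "finite (bary_support (p x))" if "x \<in> topspace X" for x
    using loc[OF that] by (meson finite_subset)
  have nonneg: "0 \<le> p x U" for x U
    using \<phi>(1) by (auto simp: p_def subordinated_partition_def)
  have point: "p x \<in> realization_points (nerve \<U>)" if x: "x \<in> topspace X" for x
  proof -
    have "bary_support (p x) \<noteq> {}"
      using sum[OF x] by auto
    moreover have "x \<in> \<Inter>(bary_support (p x))"
      using in_U x supp[OF x] by blast
    moreover have "bary_support (p x) \<subseteq> \<U>"
      using supp[OF x] by blast
    ultimately have "bary_support (p x) \<in> nerve \<U>"
      using fin[OF x] unfolding nerve_def by blast
    then show ?thesis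
      using sum[OF x] nonneg by (simp add: realization_points_def)
  qed
  have "continuous_map X (realization (nerve \<U>)) p"
  proof (rule nerve.continuous_map_into_realization)
    show "continuous_map X euclideanreal (\<lambda>x. p x U)" for U
    proof (cases "U \<in> \<U>")
      case True
      then have "continuous_map X euclideanreal (\<phi> U)"
        using \<phi>(1) by (simp add: subordinated_partition_def)
      then show ?thesis
        by (rule continuous_map_eq) (simp add: p_def True)
    qed (simp add: p_def)
  qed (use point loc in auto)
  moreover have "p x0 = vertex_point U0"
  proof
    fix U
    have "p x0 U0 = 1" "U0 \<in> bary_support (p x0)"
      using U0 x0 \<phi>(2) by (auto simp: p_def bary_support_def)
    then have "(\<Sum>U\<in>bary_support (p x0) - {U0}. p x0 U) = 0"
      using sum[OF x0] fin[OF x0] by (simp add: sum.remove[of _ U0])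
    then have "p x0 U = 0" if "U \<in> bary_support (p x0) - {U0}"
      using that fin[OF x0] nonneg by (subst (asm) sum_nonneg_eq_0_iff) auto
    then show "p x0 U = vertex_point U0 U"
      using \<open>p x0 U0 = 1\<close> by (auto simp: vertex_point_def bary_support_def)
  qed
  moreover have "{x \<in> topspace X. p x \<in> open_star (nerve \<U>) U} \<subseteq> U" if "U \<in> \<U>" for U
    using in_U that by (auto simp: open_star_def p_def split: if_splits)
  ultimately show ?thesis
    unfolding canonical_map_def i_eq by auto
qed

context
  fixes X :: "'a topology" and x0 :: 'a and i :: "'a set set \<times> 'a set"
    and p :: "'a \<Rightarrow> 'a set \<Rightarrow> real"
  assumes p: "canonical_map X x0 i p"
begin

lemma canonical_map_point: "x \<in> topspace X \<Longrightarrow> p x \<in> realization_points (nerve (fst i))"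
  using p by (auto simp: canonical_map_def continuous_map_def)

lemma canonical_map_support:
  assumes x: "x \<in> topspace X" and U: "U \<in> bary_support (p x)"
  shows "U \<in> fst i" "x \<in> U"
proof -
  show U': "U \<in> fst i"
    using realization_pointsD(2)[OF canonical_map_point[OF x]] U by (auto simp: nerve_def)
  have "p x \<in> open_star (nerve (fst i)) U"
    using canonical_map_point[OF x] U by (simp add: open_star_def bary_support_def)
  then show "x \<in> U"
    using p x U' unfolding canonical_map_def by blast
qed

lemma canonical_map_loop:
  "\<alpha> \<in> loops_at X x0 \<Longrightarrow> p \<circ> \<alpha> \<in> loops_at (realization (nerve (fst i))) (vertex_point (snd i))"
  using loops_at_comp[of X _ p \<alpha> x0] p by (simp add: canonical_map_def)

end

text \<open>All vertices in the supports of \<open>p x\<close> and \<open>q x\<close> are members of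
  the cover that contain \<open>x\<close>, so together they span a simplex: the two maps are
  contiguous.\<close>

lemma canonical_maps_homotopic:
  assumes p: "canonical_map X x0 i p" and q: "canonical_map X x0 i q" and \<alpha>: "\<alpha> \<in> loops_at X x0"
  shows "path_homotopic (realization (nerve (fst i))) (p \<circ> \<alpha>) (q \<circ> \<alpha>)"
proof (rule nerve.contiguous_paths_homotopic)
  have ends: "\<alpha> 0 = x0" "\<alpha> 1 = x0"
    using \<alpha> by (auto simp: loops_at_def)
  show "(p \<circ> \<alpha>) 0 = (q \<circ> \<alpha>) 0" "(p \<circ> \<alpha>) 1 = (q \<circ> \<alpha>) 1"
    using p q ends by (auto simp: canonical_map_def)
  show "pathin (realization (nerve (fst i))) (p \<circ> \<alpha>)" "pathin (realization (nerve (fst i))) (q \<circ> \<alpha>)"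
    using canonical_map_loop[OF p \<alpha>] canonical_map_loop[OF q \<alpha>] by (auto simp: loops_at_def)
  fix s :: real assume "s \<in> {0..1}"
  then have x: "\<alpha> s \<in> topspace X"
    using \<alpha> by (auto simp: loops_at_def pathin_def continuous_map_def)
  let ?P = "bary_support (p (\<alpha> s))" and ?Q = "bary_support (q (\<alpha> s))"
  have "\<alpha> s \<in> \<Inter>(?P \<union> ?Q)" "?P \<union> ?Q \<subseteq> fst i"
    using canonical_map_support[OF p x] canonical_map_support[OF q x] by auto
  moreover have "?P \<in> nerve (fst i)" "?Q \<in> nerve (fst i)"
    using canonical_map_point[OF p x] canonical_map_point[OF q x] by (auto dest: realization_pointsD)
  then have "finite (?P \<union> ?Q)" "?P \<union> ?Q \<noteq> {}"
    by (auto simp: nerve_def)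
  ultimately show "bary_support ((p \<circ> \<alpha>) s) \<union> bary_support ((q \<circ> \<alpha>) s) \<in> nerve (fst i)"
    unfolding nerve_def by auto
qed

lemma shape_hom_path_class:
  assumes i: "i \<in> shape_index X x0" and p: "canonical_map X x0 i p" and \<alpha>: "\<alpha> \<in> loops_at X x0"
  shows "shape_hom X x0 (path_class X \<alpha>) i = path_class (realization (nerve (fst i))) (p \<circ> \<alpha>)"
proof -
  let ?q = "SOME p. canonical_map X x0 i p"
  have q: "canonical_map X x0 i ?q"
    using p by (rule someI[where P = "canonical_map X x0 i"])
  have "shape_hom X x0 (path_class X \<alpha>) i = path_class (realization (nerve (fst i))) (?q \<circ> \<alpha>)"
    using i q \<alpha> induced_hom_path_class[of X _ ?q \<alpha>]
    by (simp add: shape_hom_def canonical_map_def loops_at_def)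
  then show ?thesis
    using path_class_eq[OF canonical_maps_homotopic[OF q p \<alpha>]] by simp
qed

text \<open>Since \<open>V \<subseteq> f V\<close>, a canonical map for the finer cover followed by
  the simplicial map is canonical for the coarser one. Uniqueness up to homotopy then yields
  compatibility with the bonding maps.\<close>

lemma canonical_map_vertex_assignment:
  assumes q: "canonical_map X x0 j q" and f: "vertex_assignment i j f"
  shows "canonical_map X x0 i (realization_map f \<circ> q)"
    and "continuous_map (realization (nerve (fst j))) (realization (nerve (fst i))) (realization_map f)"
proof -
  have f_simplicial: "f ` \<sigma> \<in> nerve (fst i)" if \<sigma>: "\<sigma> \<in> nerve (fst j)" for \<sigma>
  proof -
    have "\<Inter>\<sigma> \<subseteq> \<Inter>(f ` \<sigma>)"
      using f \<sigma> by (fastforce simp: vertex_assignment_def nerve_def)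
    moreover have "f ` \<sigma> \<subseteq> fst i"
      using f \<sigma> by (auto simp: vertex_assignment_def nerve_def)
    ultimately show ?thesis
      using \<sigma> by (auto simp: nerve_def)
  qed
  then show cont: "continuous_map (realization (nerve (fst j))) (realization (nerve (fst i))) (realization_map f)"
    by (intro continuous_map_realization_map nerve.finite_complex_axioms)
  have supp: "bary_support (realization_map f (q x)) = f ` bary_support (q x)" if "x \<in> topspace X" for x
    using canonical_map_point[OF q that]
    by (intro bary_support_realization_map nerve.finite_bary_support) (auto dest: realization_pointsD)
  show "canonical_map X x0 i (realization_map f \<circ> q)"
    unfolding canonical_map_def
  proof (intro conjI ballI subsetI)
    show "continuous_map X (realization (nerve (fst i))) (realization_map f \<circ> q)"
      using q cont by (auto simp: canonical_map_def intro: continuous_map_compose)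
    have "bary_support (vertex_point (snd j)) = {snd j}"
      by (auto simp: bary_support_def vertex_point_def)
    then have "{v. v \<in> bary_support (vertex_point (snd j)) \<and> f v = w} = (if f (snd j) = w then {snd j} else {})" for w
      by auto
    then show "(realization_map f \<circ> q) x0 = vertex_point (snd i)"
      using q f by (auto simp: canonical_map_def vertex_assignment_def realization_map_def vertex_point_def)
    fix U x assume "U \<in> fst i" and x: "x \<in> {x \<in> topspace X. (realization_map f \<circ> q) x \<in> open_star (nerve (fst i)) U}"
    then have "x \<in> topspace X" "U \<in> bary_support (realization_map f (q x))"
      by (auto simp: open_star_def bary_support_def)
    then obtain V where V: "x \<in> topspace X" "V \<in> bary_support (q x)" "U = f V"
      using supp by auto
    then show "x \<in> U"
      using canonical_map_support[OF q V(1,2)] f by (auto simp: vertex_assignment_def)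
  qed
qed

lemma vertex_assignment_exists:
  assumes i: "i \<in> shape_index X x0" and "refines_pointed j i"
  shows "\<exists>f. vertex_assignment i j f"
proof -
  have "\<forall>V\<in>fst j. \<exists>U\<in>fst i. V \<subseteq> U" and j0: "snd j \<subseteq> snd i"
    using assms by (auto simp: refines_pointed_def refines_def)
  then obtain f where f: "\<And>V. V \<in> fst j \<Longrightarrow> f V \<in> fst i" "\<And>V. V \<in> fst j \<Longrightarrow> V \<subseteq> f V"
    by metis
  have "snd i \<in> fst i"
    using i by (auto simp: shape_index_def)
  then have "vertex_assignment i j (f(snd j := snd i))"
    using f j0 by (auto simp: vertex_assignment_def)
  then show ?thesis
    by blast
qed

lemma shape_hom_in_shape_group:
  assumes x0: "x0 \<in> topspace X" and \<alpha>: "\<alpha> \<in> loops_at X x0"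
  shows "shape_hom X x0 (path_class X \<alpha>) \<in> shape_group X x0"
  unfolding shape_group_def
proof (intro CollectI conjI ballI impI PiE_I)
  fix i assume i: "i \<in> shape_index X x0"
  obtain p where p: "canonical_map X x0 i p"
    using canonical_map_exists[OF i x0] by blast
  show "shape_hom X x0 (path_class X \<alpha>) i \<in> carrier (nerve_group i)"
    using canonical_map_loop[OF p \<alpha>]
    by (simp add: shape_hom_path_class[OF i p \<alpha>] nerve_group_def carrier_fundamental_group)
  fix j assume j: "j \<in> shape_index X x0" and ji: "refines_pointed j i"
  obtain q where q: "canonical_map X x0 j q"
    using canonical_map_exists[OF j x0] by blast
  let ?f = "SOME f. vertex_assignment i j f"
  have f: "vertex_assignment i j ?f"
    using vertex_assignment_exists[OF i ji] by (rule someI_ex)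
  have "bonding_hom i j (shape_hom X x0 (path_class X \<alpha>) j) =
      path_class (realization (nerve (fst i))) (realization_map ?f \<circ> (q \<circ> \<alpha>))"
    unfolding bonding_hom_def shape_hom_path_class[OF j q \<alpha>]
    using canonical_map_loop[OF q \<alpha>]
    by (intro induced_hom_path_class[OF canonical_map_vertex_assignment(2)[OF q f]])
      (simp add: loops_at_def)
  then show "bonding_hom i j (shape_hom X x0 (path_class X \<alpha>) j) = shape_hom X x0 (path_class X \<alpha>) i"
    by (simp add: shape_hom_path_class[OF i canonical_map_vertex_assignment(1)[OF q f] \<alpha>] o_assoc)
qed (simp add: shape_hom_def)

text \<open>In a product of discrete groups a basic neighbourhood prescribes finitely many
  coordinates, and the image of every loop lies in the limit, so only those coordinates remain in
  the criterion.\<close>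

lemma openin_shape_topology_iff:
  assumes x0: "x0 \<in> topspace X" and S: "S \<subseteq> carrier (fundamental_group X x0)"
  shows "openin (shape_topology X x0) S \<longleftrightarrow>
    (\<forall>\<alpha>\<in>loops_at X x0. path_class X \<alpha> \<in> S \<longrightarrow>
      (\<exists>F. finite F \<and> F \<subseteq> shape_index X x0 \<and> (\<forall>\<beta>\<in>loops_at X x0.
        (\<forall>i\<in>F. shape_hom X x0 (path_class X \<beta>) i = shape_hom X x0 (path_class X \<alpha>) i) \<longrightarrow>
        path_class X \<beta> \<in> S)))"
    (is "_ \<longleftrightarrow> (\<forall>\<alpha>\<in>_. _ \<longrightarrow> (\<exists>F. ?basic F \<alpha>))")
proof -
  let ?\<Psi> = "\<lambda>\<alpha>. shape_hom X x0 (path_class X \<alpha>)" and ?I = "shape_index X x0"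
  let ?C = "\<lambda>i. carrier (nerve_group i)"
  let ?T = "product_topology (\<lambda>i. discrete_topology (?C i)) ?I"
  have \<Psi>: "?\<Psi> \<alpha> \<in> shape_group X x0" "?\<Psi> \<alpha> \<in> Pi\<^sub>E ?I ?C" if "\<alpha> \<in> loops_at X x0" for \<alpha>
    using shape_hom_in_shape_group[OF x0 that] by (auto simp: shape_group_def)
  have pullback: "openin (shape_topology X x0) S \<longleftrightarrow>
      (\<exists>T. openin ?T T \<and> S = shape_hom X x0 -` (T \<inter> shape_group X x0) \<inter> carrier (fundamental_group X x0))"
    unfolding shape_topology_def shape_group_topology_def openin_pullback_topology openin_subtopology
    by blast
  show ?thesis
  proof
    assume "openin (shape_topology X x0) S"
    then obtain T where T: "openin ?T T"
      and S_eq: "S = shape_hom X x0 -` (T \<inter> shape_group X x0) \<inter> carrier (fundamental_group X x0)"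
      unfolding pullback by blast
    show "\<forall>\<alpha>\<in>loops_at X x0. path_class X \<alpha> \<in> S \<longrightarrow> (\<exists>F. ?basic F \<alpha>)"
    proof (intro ballI impI)
      fix \<alpha> assume \<alpha>: "\<alpha> \<in> loops_at X x0" "path_class X \<alpha> \<in> S"
      then have "?\<Psi> \<alpha> \<in> T"
        using S_eq by blast
      then obtain B where B: "finite {i \<in> ?I. B i \<noteq> ?C i}" "?\<Psi> \<alpha> \<in> Pi\<^sub>E ?I B" "Pi\<^sub>E ?I B \<subseteq> T"
        using T unfolding openin_product_topology_alt by auto
      have "path_class X \<beta> \<in> S"
        if \<beta>: "\<beta> \<in> loops_at X x0" "\<forall>i\<in>{i \<in> ?I. B i \<noteq> ?C i}. ?\<Psi> \<beta> i = ?\<Psi> \<alpha> i" for \<beta>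
      proof -
        have "?\<Psi> \<beta> i \<in> B i" if "i \<in> ?I" for i
        proof (cases "B i = ?C i")
          case True
          then show ?thesis
            using PiE_mem[OF \<Psi>(2)[OF \<beta>(1)] that] by simp
        next
          case False
          then have "?\<Psi> \<beta> i = ?\<Psi> \<alpha> i"
            using \<beta>(2) that by blast
          then show ?thesis
            using PiE_mem[OF B(2) that] by simp
        qed
        then have "?\<Psi> \<beta> \<in> Pi\<^sub>E ?I B"
          using \<Psi>(2)[OF \<beta>(1)] unfolding PiE_iff by blast
        then have "?\<Psi> \<beta> \<in> T"
          using B(3) by blast
        then show ?thesis
          using \<Psi>(1)[OF \<beta>(1)] \<beta>(1) by (auto simp: S_eq carrier_fundamental_group)
      qed
      then show "\<exists>F. ?basic F \<alpha>"
        using B(1) by (intro exI[of _ "{i \<in> ?I. B i \<noteq> ?C i}"]) blast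
    qed
  next
    assume basic: "\<forall>\<alpha>\<in>loops_at X x0. path_class X \<alpha> \<in> S \<longrightarrow> (\<exists>F. ?basic F \<alpha>)"
    \<comment> \<open>The union of the basic boxes that the hypothesis attaches to loops;
      \<open>?basic F \<alpha>\<close> itself says that a loop whose image lies in such a box has
      its class in \<open>S\<close>.\<close>
    define T where "T = {g \<in> Pi\<^sub>E ?I ?C. \<exists>\<alpha>\<in>loops_at X x0. \<exists>F. ?basic F \<alpha> \<and> (\<forall>i\<in>F. g i = ?\<Psi> \<alpha> i)}"
    have "openin ?T T"
      unfolding openin_product_topology_alt topspace_discrete_topology
    proof
      fix g assume g: "g \<in> T"
      then obtain \<alpha> F where \<alpha>: "\<alpha> \<in> loops_at X x0" and F: "?basic F \<alpha>" "\<forall>i\<in>F. g i = ?\<Psi> \<alpha> i"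
        unfolding T_def by blast
      have gC: "g \<in> Pi\<^sub>E ?I ?C"
        using g by (simp add: T_def)
      let ?B = "\<lambda>i. if i \<in> F then {g i} else ?C i"
      have "{i \<in> ?I. ?B i \<noteq> ?C i} \<subseteq> F"
        by auto
      then have "finite {i \<in> ?I. ?B i \<noteq> ?C i}"
        using F(1) finite_subset by blast
      moreover have "\<forall>i\<in>?I. openin (discrete_topology (?C i)) (?B i)" "g \<in> Pi\<^sub>E ?I ?B"
        using gC by (auto simp: PiE_iff)
      moreover have "h \<in> T" if h: "h \<in> Pi\<^sub>E ?I ?B" for h
      proof -
        have hg: "h i = g i" if "i \<in> F" for i
          using PiE_mem[OF h, of i] that F(1) by auto
        moreover have "h i \<in> ?C i" if "i \<in> ?I" for i
          using PiE_mem[OF h that] PiE_mem[OF gC that] by (cases "i \<in> F") simp_all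
        then have "h \<in> Pi\<^sub>E ?I ?C"
          using h unfolding PiE_iff by blast
        moreover have "\<forall>i\<in>F. h i = ?\<Psi> \<alpha> i"
          using hg F(2) by simp
        ultimately show ?thesis
          using \<alpha> F(1) unfolding T_def by blast
      qed
      ultimately show "\<exists>U. finite {i \<in> ?I. U i \<noteq> ?C i} \<and>
          (\<forall>i\<in>?I. openin (discrete_topology (?C i)) (U i)) \<and> g \<in> Pi\<^sub>E ?I U \<and> Pi\<^sub>E ?I U \<subseteq> T"
        by (intro exI[of _ ?B]) blast
    qed
    moreover have "path_class X \<beta> \<in> S \<longleftrightarrow> ?\<Psi> \<beta> \<in> T" if \<beta>: "\<beta> \<in> loops_at X x0" for \<beta>
    proof
      assume "path_class X \<beta> \<in> S"
      from mp[OF bspec[OF basic \<beta>] this] obtain F where "?basic F \<beta>" ..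
      then show "?\<Psi> \<beta> \<in> T"
        using \<beta> \<Psi>(2)[OF \<beta>] unfolding T_def by blast
    next
      assume "?\<Psi> \<beta> \<in> T"
      then obtain \<alpha> F where "?basic F \<alpha>" "\<forall>i\<in>F. ?\<Psi> \<beta> i = ?\<Psi> \<alpha> i"
        unfolding T_def by blast
      then show "path_class X \<beta> \<in> S"
        using \<beta> by blast
    qed
    then have "S = shape_hom X x0 -` (T \<inter> shape_group X x0) \<inter> carrier (fundamental_group X x0)"
      using S \<Psi>(1) unfolding carrier_fundamental_group by auto
    ultimately show "openin (shape_topology X x0) S"
      unfolding pullback by blast
  qed
qed

lemma openin_shape_topology_imp_spanier_subset:
  assumes x0: "x0 \<in> topspace X" and H: "subgroup H (fundamental_group X x0)"
    and op: "openin (shape_topology X x0) H"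
  shows "\<exists>\<U>. open_cover X \<U> \<and> spanier_group X \<U> x0 \<subseteq> H"
proof -
  let ?c = "\<lambda>_::real. x0"
  have "path_class X ?c \<in> H"
    using subgroup.one_closed[OF H] by (simp add: one_fundamental_group)
  then obtain F where F: "finite F" "F \<subseteq> shape_index X x0"
    "\<And>\<beta>. \<beta> \<in> loops_at X x0 \<Longrightarrow> \<forall>i\<in>F. shape_hom X x0 (path_class X \<beta>) i = shape_hom X x0 (path_class X ?c) i \<Longrightarrow>
      path_class X \<beta> \<in> H"
    using op loops_at_const[OF x0] unfolding openin_shape_topology_iff[OF x0 subgroup.subset[OF H]] by meson
  have "\<forall>i\<in>F. \<exists>p. canonical_map X x0 i p"
    using canonical_map_exists[OF _ x0] F(2) by blast
  from bchoice[OF this] obtain p where p: "\<And>i. i \<in> F \<Longrightarrow> canonical_map X x0 i (p i)"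
    by blast
  \<comment> \<open>The vertex \<open>v\<close> may depend on \<open>U\<close> and \<open>i\<close>
    but not on \<open>x\<close>: the whole of \<open>U\<close> goes into one star of each of the
    finitely many nerves.\<close>
  define \<U> where "\<U> = {U. openin X U \<and> (\<forall>i\<in>F. \<exists>v. \<forall>x\<in>U. p i x v \<noteq> 0)}"
  have "\<exists>U\<in>\<U>. x \<in> U" if x: "x \<in> topspace X" for x
  proof -
    have "\<forall>i\<in>F. \<exists>v. v \<in> bary_support (p i x)"
    proof
      fix i assume "i \<in> F"
      then have "bary_support (p i x) \<in> nerve (fst i)"
        by (intro realization_pointsD(2) canonical_map_point[OF p x])
      then show "\<exists>v. v \<in> bary_support (p i x)"
        by (auto simp: nerve_def)
    qed
    from bchoice[OF this] obtain v where v: "\<And>i. i \<in> F \<Longrightarrow> v i \<in> bary_support (p i x)"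
      by blast
    define U where "U = (\<Inter>i\<in>F. {y \<in> topspace X. p i y \<in> open_star (nerve (fst i)) (v i)}) \<inter> topspace X"
    have "openin X {y \<in> topspace X. p i y \<in> open_star (nerve (fst i)) (v i)}" if "i \<in> F" for i
      using p[OF that] nerve.openin_open_star
      by (auto simp: canonical_map_def intro: openin_continuous_map_preimage)
    then have "openin X U"
      unfolding U_def using F(1) by (intro openin_INT) auto
    moreover have "\<forall>y\<in>U. p i y (v i) \<noteq> 0" if "i \<in> F" for i
      using that by (auto simp: U_def open_star_def)
    moreover have "x \<in> U"
      using v canonical_map_point[OF p x] x by (auto simp: U_def open_star_def bary_support_def)
    ultimately show ?thesis
      unfolding \<U>_def by blast
  qed
  then have "open_cover X \<U>"
    unfolding open_cover_def using openin_subset by (fastforce simp: \<U>_def)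
  moreover have "spanier_group X \<U> x0 \<subseteq> H"
  proof (rule spanier_group_subset[OF x0 H])
    fix \<alpha> \<gamma> U
    assume \<alpha>: "pathin X \<alpha>" "\<alpha> 0 = x0" and \<gamma>: "\<gamma> \<in> loops_at X (\<alpha> 1)" and U: "U \<in> \<U>" "\<gamma> ` {0..1} \<subseteq> U"
    let ?\<beta> = "(\<alpha> \<star> \<gamma>) \<star> path_rev \<alpha>"
    have \<beta>: "?\<beta> \<in> loops_at X x0"
      using \<alpha> \<gamma> by (rule path_class_conjugate_loop)
    show "path_class X ?\<beta> \<in> H"
    proof (rule F(3)[OF \<beta>], rule ballI)
      fix i assume iF: "i \<in> F"
      then have i: "i \<in> shape_index X x0"
        using F(2) by blast
      let ?R = "realization (nerve (fst i))"
      have cont: "continuous_map X ?R (p i)"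
        using p[OF iF] by (simp add: canonical_map_def)
      obtain v where v: "\<And>x. x \<in> U \<Longrightarrow> p i x v \<noteq> 0"
        using U(1) iF unfolding \<U>_def by blast
      have "path_homotopic ?R (p i \<circ> \<gamma>) (\<lambda>_. p i (\<alpha> 1))"
      proof (rule nerve.loop_in_open_star_null[OF loops_at_comp[OF cont \<gamma>]])
        show "(p i \<circ> \<gamma>) s v \<noteq> 0" if "s \<in> {0..1}" for s
        proof -
          have "\<gamma> s \<in> U"
            using U(2) that by blast
          then show ?thesis
            using v by simp
        qed
      qed
      moreover have "pathin ?R (p i \<circ> \<alpha>)"
        using \<alpha>(1) cont by (auto simp: pathin_def intro: continuous_map_compose)
      moreover have "p i \<circ> ?c = (\<lambda>_. p i x0)"
        by auto
      ultimately have "path_homotopic ?R (p i \<circ> ?\<beta>) (p i \<circ> ?c)"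
        using path_homotopic_conjugate_null[of ?R "p i \<circ> \<alpha>" "p i \<circ> \<gamma>"] \<alpha>(2)
        by (simp add: comp_path_concat comp_path_rev)
      then show "shape_hom X x0 (path_class X ?\<beta>) i = shape_hom X x0 (path_class X ?c) i"
        using shape_hom_path_class[OF i p[OF iF]] \<beta> loops_at_const[OF x0] by (simp add: path_class_eq)
    qed
  qed
  ultimately show ?thesis
    by blast
qed

section \<open>The covering space of a subgroup containing a Spanier group\<close>

lemma pathin_reparam:
  assumes "pathin X p" "continuous_on {0..1} f" "f \<in> {0..1} \<rightarrow> {0..1}"
  shows "pathin X (p \<circ> f)"
  using path_homotopic_reparam[OF assms assms(2,3)] by (simp add: path_homotopic_refl)

text \<open>\<open>small_conjugate\<close> is the only trace of the Spanier group left here: it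
  covers loops in the union of two meeting members.\<close>

locale spanier_cover =
  fixes X :: "'a topology" and x0 :: 'a and H :: "(real \<Rightarrow> 'a) set set" and \<W> :: "'a set set"
  assumes basepoint: "x0 \<in> topspace X" and subgroup_H: "subgroup H (fundamental_group X x0)"
    and path_connected: "path_connected_space X"
    and cover_W: "open_cover X \<W>" and path_connected_W: "W \<in> \<W> \<Longrightarrow> path_connectedin X W"
    and small_conjugate: "W \<in> \<W> \<Longrightarrow> W' \<in> \<W> \<Longrightarrow> W \<inter> W' \<noteq> {} \<Longrightarrow> pathin X \<alpha> \<Longrightarrow> \<alpha> 0 = x0 \<Longrightarrow>
      \<gamma> \<in> loops_at X (\<alpha> 1) \<Longrightarrow> \<gamma> ` {0..1} \<subseteq> W \<union> W' \<Longrightarrow>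
      path_class X ((\<alpha> \<star> \<gamma>) \<star> path_rev \<alpha>) \<in> H"
begin

definition based_paths :: "(real \<Rightarrow> 'a) set"
  where "based_paths = {p. pathin X p \<and> p 0 = x0}"

definition rel :: "(real \<Rightarrow> 'a) \<Rightarrow> (real \<Rightarrow> 'a) \<Rightarrow> bool"
  where "rel p q \<longleftrightarrow> p \<in> based_paths \<and> q \<in> based_paths \<and> p 1 = q 1 \<and> path_class X (p \<star> path_rev q) \<in> H"

definition coset :: "(real \<Rightarrow> 'a) \<Rightarrow> (real \<Rightarrow> 'a) set"
  where "coset p = {q. rel p q}"

text \<open>The choice is harmless on a coset, because \<open>rel\<close> requires equal
  ends.\<close>

definition endpoint :: "(real \<Rightarrow> 'a) set \<Rightarrow> 'a"
  where "endpoint A = (SOME q. q \<in> A) 1"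

text \<open>Asserts only that some representative, some short path and some member exist;
  \<open>adjacentD\<close> allows any others to be used instead.\<close>

definition adjacent :: "(real \<Rightarrow> 'a) set \<Rightarrow> (real \<Rightarrow> 'a) set \<Rightarrow> bool"
  where "adjacent y y' \<longleftrightarrow> (\<exists>p \<delta> W. p \<in> based_paths \<and> pathin X \<delta> \<and> \<delta> 0 = p 1 \<and> W \<in> \<W> \<and>
    \<delta> ` {0..1} \<subseteq> W \<and> y = coset p \<and> y' = coset (p \<star> \<delta>))"

lemma based_pathsD: "p \<in> based_paths \<Longrightarrow> pathin X p" "p \<in> based_paths \<Longrightarrow> p 0 = x0"
  by (auto simp: based_paths_def)

lemma based_path_end: "p \<in> based_paths \<Longrightarrow> p 1 \<in> topspace X"
  by (auto simp: based_paths_def pathin_def continuous_map_def)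

lemma based_paths_concat:
  "p \<in> based_paths \<Longrightarrow> pathin X \<delta> \<Longrightarrow> \<delta> 0 = p 1 \<Longrightarrow> p \<star> \<delta> \<in> based_paths"
  by (auto simp: based_paths_def intro!: pathin_concat)

lemma loops_at_concat_rev:
  "p \<in> based_paths \<Longrightarrow> q \<in> based_paths \<Longrightarrow> p 1 = q 1 \<Longrightarrow> p \<star> path_rev q \<in> loops_at X x0"
  by (auto simp: based_paths_def loops_at_def intro!: pathin_concat pathin_rev)

lemma const_in_H: "path_class X (\<lambda>_. x0) \<in> H"
  using subgroup.one_closed[OF subgroup_H] by (simp add: one_fundamental_group)

lemma rel_homotopic:
  assumes p: "p \<in> based_paths" and pq: "path_homotopic X p q"
  shows "rel p q"
proof -
  have q: "q \<in> based_paths" "p 1 = q 1"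
    using p path_homotopic_ends[OF pq] path_homotopic_pathin[OF pq] by (auto simp: based_paths_def)
  have "path_homotopic X (p \<star> path_rev q) (q \<star> path_rev q)"
    by (rule path_homotopic_concat[OF pq])
      (use q in \<open>auto simp: path_homotopic_refl pathin_rev based_pathsD\<close>)
  also have "path_homotopic X \<dots> (\<lambda>_. x0)"
    using path_homotopic_concat_rev[OF based_pathsD(1)[OF q(1)]] based_pathsD(2)[OF q(1)] by simp
  finally have "path_class X (p \<star> path_rev q) \<in> H"
    using const_in_H path_class_eq by metis
  then show ?thesis
    using p q by (simp add: rel_def)
qed

lemma rel_refl: "p \<in> based_paths \<Longrightarrow> rel p p"
  by (simp add: rel_homotopic path_homotopic_refl based_pathsD)

lemma rel_sym:
  assumes "rel p q" shows "rel q p"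
proof -
  have p: "p \<in> based_paths" "q \<in> based_paths" "p 1 = q 1" and H: "path_class X (p \<star> path_rev q) \<in> H"
    using assms by (auto simp: rel_def)
  have "path_rev (p \<star> path_rev q) = q \<star> path_rev p"
    using p by (simp add: path_rev_concat)
  then have "path_class X (q \<star> path_rev p) \<in> H"
    using subgroup.m_inv_closed[OF subgroup_H H]
      inv_fundamental_group[OF basepoint loops_at_concat_rev[OF p]] by simp
  then show ?thesis
    using p by (simp add: rel_def)
qed

lemma rel_trans:
  assumes "rel p q" "rel q s" shows "rel p s"
proof -
  have p: "p \<in> based_paths" "q \<in> based_paths" "s \<in> based_paths" "p 1 = q 1" "q 1 = s 1"
    and H: "path_class X (p \<star> path_rev q) \<in> H" "path_class X (q \<star> path_rev s) \<in> H"
    using assms by (auto simp: rel_def)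
  have "path_homotopic X ((p \<star> path_rev q) \<star> (q \<star> path_rev s)) (p \<star> path_rev s)"
    using path_homotopic_cancel_middle[of X p "path_rev q" "path_rev s"] p
    by (simp add: pathin_rev based_pathsD)
  then have "path_class X (p \<star> path_rev s) =
      path_class X (p \<star> path_rev q) \<otimes>\<^bsub>fundamental_group X x0\<^esub> path_class X (q \<star> path_rev s)"
    using p by (simp add: fundamental_group_mult loops_at_concat_rev path_class_eq)
  then show ?thesis
    using p subgroup.m_closed[OF subgroup_H H] by (simp add: rel_def)
qed

lemma coset_eq_iff:
  assumes "p \<in> based_paths" shows "coset p = coset q \<longleftrightarrow> rel p q"
proof
  show "rel p q" if "coset p = coset q"
    using rel_refl[OF assms] rel_sym that unfolding coset_def by blast
  show "coset p = coset q" if "rel p q"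
    using rel_sym[OF that] rel_trans that unfolding coset_def by blast
qed

lemma endpoint_coset [simp]:
  assumes "p \<in> based_paths" shows "endpoint (coset p) = p 1"
proof -
  define q where "q = (SOME q. q \<in> coset p)"
  have "p \<in> coset p"
    using rel_refl[OF assms] by (simp add: coset_def)
  then have "q \<in> coset p"
    unfolding q_def by (rule someI[where P = "\<lambda>q. q \<in> coset p"])
  then show ?thesis
    unfolding endpoint_def q_def[symmetric] by (simp add: coset_def rel_def)
qed

lemma coset_concat_cong:
  assumes p: "p \<in> based_paths" "q \<in> based_paths" "coset p = coset q" and \<delta>: "pathin X \<delta>" "\<delta> 0 = p 1"
  shows "coset (p \<star> \<delta>) = coset (q \<star> \<delta>)"
proof -
  have rel: "p 1 = q 1" "path_class X (p \<star> path_rev q) \<in> H"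
    using p coset_eq_iff by (auto simp: rel_def)
  have "path_homotopic X ((p \<star> \<delta>) \<star> path_rev (q \<star> \<delta>)) (p \<star> path_rev q)"
    using path_homotopic_cancel_middle[of X p \<delta> "path_rev q"] p \<delta> rel
    by (simp add: path_rev_concat pathin_rev based_pathsD)
  then have "rel (p \<star> \<delta>) (q \<star> \<delta>)"
    using p \<delta> rel by (simp add: rel_def based_paths_concat path_class_eq)
  then show ?thesis
    using p \<delta> by (simp add: coset_eq_iff based_paths_concat)
qed

text \<open>Both paths start at the same point, so \<open>W\<close> and \<open>W'\<close> meet, and
  going out along \<delta> and back along \<delta>' is a loop in their union. Its conjugate by
  \<open>p\<close> is in \<open>H\<close> by \<open>small_conjugate\<close>. This makes sheets well
  defined.\<close>

lemma coset_small_cong: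
  assumes p: "p \<in> based_paths" and \<delta>: "pathin X \<delta>" "\<delta> 0 = p 1" and \<delta>': "pathin X \<delta>'" "\<delta>' 0 = p 1"
    and ends: "\<delta> 1 = \<delta>' 1" and W: "W \<in> \<W>" "\<delta> ` {0..1} \<subseteq> W" "W' \<in> \<W>" "\<delta>' ` {0..1} \<subseteq> W'"
  shows "coset (p \<star> \<delta>) = coset (p \<star> \<delta>')"
proof -
  let ?\<gamma> = "\<delta> \<star> path_rev \<delta>'"
  note paths = based_pathsD(1)[OF p] \<delta> \<delta>' ends
  have p': "p \<star> \<delta> \<in> based_paths" "p \<star> \<delta>' \<in> based_paths"
    using based_paths_concat p \<delta> \<delta>' by auto
  have "\<delta> 0 \<in> W \<inter> W'"
    using W \<delta> \<delta>' by force
  then have "W \<inter> W' \<noteq> {}"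
    by blast
  moreover have "?\<gamma> \<in> loops_at X (p 1)"
    using paths by (auto simp: loops_at_def intro!: pathin_concat pathin_rev)
  moreover have "?\<gamma> ` {0..1} \<subseteq> W \<union> W'"
  proof
    fix x assume "x \<in> ?\<gamma> ` {0..1}"
    then obtain s where s: "s \<in> {0..1}" "x = ?\<gamma> s" by blast
    show "x \<in> W \<union> W'"
    proof (cases "s \<le> 1/2")
      case True
      then have "x = \<delta> (2 * s)" "2 * s \<in> {0..1}"
        using s by (auto simp: path_concat_def)
      then show ?thesis using W(2) by blast
    next
      case False
      then have "x = \<delta>' (1 - (2 * s - 1))" "1 - (2 * s - 1) \<in> {0..1}"
        using s by (auto simp: path_concat_def path_rev_def)
      then show ?thesis using W(4) by blast
    qed
  qed
  ultimately have H: "path_class X ((p \<star> ?\<gamma>) \<star> path_rev p) \<in> H"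
    using small_conjugate[OF W(1,3)] p by (simp add: based_pathsD)
  have "path_homotopic X ((p \<star> \<delta>) \<star> path_rev (p \<star> \<delta>')) (((p \<star> \<delta>) \<star> path_rev \<delta>') \<star> path_rev p)"
    unfolding path_rev_concat[of p \<delta>', OF \<delta>'(2)[symmetric]]
    by (rule path_homotopic_sym, rule path_homotopic_assoc)
      (use paths in \<open>auto intro: pathin_concat pathin_rev\<close>)
  also have "path_homotopic X \<dots> ((p \<star> ?\<gamma>) \<star> path_rev p)"
  proof (rule path_homotopic_concat)
    show "path_homotopic X ((p \<star> \<delta>) \<star> path_rev \<delta>') (p \<star> ?\<gamma>)"
      by (rule path_homotopic_assoc) (use paths in \<open>auto intro: pathin_rev\<close>)
  qed (use paths in \<open>auto simp: path_homotopic_refl pathin_rev\<close>)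
  finally have "rel (p \<star> \<delta>) (p \<star> \<delta>')"
    using H p' ends by (simp add: rel_def path_class_eq)
  then show ?thesis
    by (simp add: coset_eq_iff[OF p'(1)])
qed

lemma path_within_W:
  assumes "W \<in> \<W>" "a \<in> W" "b \<in> W"
  obtains \<delta> where "pathin X \<delta>" "\<delta> ` {0..1} \<subseteq> W" "\<delta> 0 = a" "\<delta> 1 = b"
proof -
  have "\<exists>g. pathin X g \<and> g \<in> {0..1} \<rightarrow> W \<and> g 0 = a \<and> g 1 = b"
    using path_connected_W[OF assms(1)] assms(2,3) by (simp add: path_connectedin)
  then show thesis
    using that by (auto simp: image_subset_iff_funcset)
qed

lemma adjacentI:
  assumes "p \<in> based_paths" "pathin X \<delta>" "\<delta> 0 = p 1" "W \<in> \<W>" "\<delta> ` {0..1} \<subseteq> W"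
  shows "adjacent (coset p) (coset (p \<star> \<delta>))"
  using assms unfolding adjacent_def by blast

text \<open>Replace the representative by \<open>coset_concat_cong\<close>, then the short path by
  \<open>coset_small_cong\<close>.\<close>

lemma adjacentD:
  assumes adj: "adjacent (coset p) y'" and p: "p \<in> based_paths"
    and \<delta>: "pathin X \<delta>" "\<delta> 0 = p 1" "\<delta> 1 = endpoint y'" and W: "W \<in> \<W>" "\<delta> ` {0..1} \<subseteq> W"
  shows "y' = coset (p \<star> \<delta>)"
proof -
  obtain q \<epsilon> W' where q: "q \<in> based_paths" "pathin X \<epsilon>" "\<epsilon> 0 = q 1" "W' \<in> \<W>" "\<epsilon> ` {0..1} \<subseteq> W'"
      "coset p = coset q" "y' = coset (q \<star> \<epsilon>)"
    using adj unfolding adjacent_def by blast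
  have pq: "p 1 = q 1"
    using q(6) p q(1) endpoint_coset by metis
  have y': "y' = coset (p \<star> \<epsilon>)"
    using coset_concat_cong[OF p q(1,6,2)] q(3,7) pq by simp
  then have "\<epsilon> 1 = \<delta> 1"
    using \<delta>(3) endpoint_coset[OF based_paths_concat[OF p q(2)]] q(3) pq by simp
  then show ?thesis
    unfolding y' using coset_small_cong[OF p q(2) _ \<delta>(1,2) _ q(4,5) W] q(3) pq by simp
qed

sublocale sheets X \<W> "coset ` based_paths" endpoint adjacent
proof
  show "open_cover X \<W>"
    by (rule cover_W)
  show "endpoint ` coset ` based_paths = topspace X"
  proof
    show "endpoint ` coset ` based_paths \<subseteq> topspace X"
      using based_path_end by auto
    show "topspace X \<subseteq> endpoint ` coset ` based_paths"
    proof
      fix x assume "x \<in> topspace X"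
      then obtain p where "pathin X p" "p 0 = x0" "p 1 = x"
        using path_connected basepoint unfolding path_connected_space_def by blast
      then have "p \<in> based_paths" "endpoint (coset p) = x"
        by (auto simp: based_paths_def)
      then show "x \<in> endpoint ` coset ` based_paths"
        by blast
    qed
  qed
  show "adjacent y y" if y: "y \<in> coset ` based_paths" for y
  proof -
    obtain p where p: "p \<in> based_paths" "y = coset p"
      using y by blast
    then have "p 1 \<in> topspace X"
      by (simp add: based_path_end)
    then obtain W where W: "W \<in> \<W>" "p 1 \<in> W"
      using cover_W by (auto simp: open_cover_def)
    have "adjacent (coset p) (coset (p \<star> (\<lambda>_. p 1)))"
      using W \<open>p 1 \<in> topspace X\<close> p by (intro adjacentI) auto
    moreover have "rel (p \<star> (\<lambda>_. p 1)) p"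
      using p \<open>p 1 \<in> topspace X\<close>
      by (intro rel_homotopic based_paths_concat path_homotopic_concat_const) (auto simp: based_pathsD)
    then have "coset (p \<star> (\<lambda>_. p 1)) = coset p"
      using coset_eq_iff rel_def by blast
    ultimately show ?thesis
      by (simp add: p(2))
  qed
  show "adjacent y' y" if "adjacent y y'" for y y'
  proof -
    obtain p \<delta> W where p: "p \<in> based_paths" "pathin X \<delta>" "\<delta> 0 = p 1" "W \<in> \<W>" "\<delta> ` {0..1} \<subseteq> W"
        "y = coset p" "y' = coset (p \<star> \<delta>)"
      using \<open>adjacent y y'\<close> unfolding adjacent_def by blast
    have "path_rev \<delta> ` {0..1} \<subseteq> W"
      using p(5) by (force simp: path_rev_def)
    then have "adjacent (coset (p \<star> \<delta>)) (coset ((p \<star> \<delta>) \<star> path_rev \<delta>))"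
      using p by (intro adjacentI) (auto simp: based_paths_concat pathin_rev)
    moreover have "path_homotopic X ((p \<star> \<delta>) \<star> path_rev \<delta>) p"
    proof -
      have "path_homotopic X ((p \<star> \<delta>) \<star> path_rev \<delta>) (p \<star> (\<delta> \<star> path_rev \<delta>))"
        by (rule path_homotopic_assoc) (use p in \<open>auto simp: based_pathsD pathin_rev\<close>)
      also have "path_homotopic X \<dots> (p \<star> (\<lambda>_. p 1))"
        using p path_homotopic_concat_rev[OF p(2)]
        by (intro path_homotopic_concat) (auto simp: based_pathsD path_homotopic_refl)
      also have "path_homotopic X \<dots> p"
        using p by (intro path_homotopic_concat_const) (auto simp: based_pathsD)
      finally show ?thesis .
    qed
    then have "coset ((p \<star> \<delta>) \<star> path_rev \<delta>) = coset p"
      using p rel_homotopic coset_eq_iff by (simp add: based_paths_concat pathin_rev)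
    ultimately show ?thesis
      by (simp add: p(6,7))
  qed
  \<comment> \<open>The given adjacencies may use other members of \<W>. As all three endpoints lie
    in the path connected \<open>W\<close>, both short paths can be rechosen in \<open>W\<close>,
    and then so does their concatenation lie in \<open>W\<close>.\<close>
  show "adjacent y y''"
    if W: "W \<in> \<W>" and Y: "y \<in> coset ` based_paths" "y' \<in> coset ` based_paths" "y'' \<in> coset ` based_paths"
      and inW: "endpoint y \<in> W" "endpoint y' \<in> W" "endpoint y'' \<in> W"
      and adj: "adjacent y y'" "adjacent y' y''" for W y y' y''
  proof -
    obtain p where p: "p \<in> based_paths" "y = coset p"
      using Y(1) by blast
    obtain \<delta> where \<delta>: "pathin X \<delta>" "\<delta> ` {0..1} \<subseteq> W" "\<delta> 0 = p 1" "\<delta> 1 = endpoint y'"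
      using path_within_W[OF W inW(1,2)] p by auto
    have p': "p \<star> \<delta> \<in> based_paths"
      using p(1) \<delta>(1,3) by (rule based_paths_concat)
    have y': "y' = coset (p \<star> \<delta>)"
      using adjacentD[OF _ p(1) \<delta>(1,3,4) W \<delta>(2)] adj(1) p(2) by simp
    obtain \<epsilon> where \<epsilon>: "pathin X \<epsilon>" "\<epsilon> ` {0..1} \<subseteq> W" "\<epsilon> 0 = \<delta> 1" "\<epsilon> 1 = endpoint y''"
      using path_within_W[OF W inW(2,3)] \<delta>(4) by auto
    have "y'' = coset ((p \<star> \<delta>) \<star> \<epsilon>)"
      using adjacentD[OF _ p' \<epsilon>(1) _ \<epsilon>(4) W \<epsilon>(2)] adj(2) y' \<epsilon>(3) by simp
    moreover have "path_homotopic X ((p \<star> \<delta>) \<star> \<epsilon>) (p \<star> (\<delta> \<star> \<epsilon>))"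
      by (rule path_homotopic_assoc) (use p \<delta> \<epsilon> in \<open>auto simp: based_pathsD\<close>)
    then have "coset ((p \<star> \<delta>) \<star> \<epsilon>) = coset (p \<star> (\<delta> \<star> \<epsilon>))"
      using rel_homotopic coset_eq_iff based_paths_concat[OF p' \<epsilon>(1)] \<epsilon>(3) by simp
    moreover have "adjacent (coset p) (coset (p \<star> (\<delta> \<star> \<epsilon>)))"
    proof (rule adjacentI[OF p(1) _ _ W])
      show "(\<delta> \<star> \<epsilon>) ` {0..1} \<subseteq> W"
      proof
        fix x assume "x \<in> (\<delta> \<star> \<epsilon>) ` {0..1}"
        then obtain s where s: "s \<in> {0..1}" "x = (\<delta> \<star> \<epsilon>) s" by blast
        show "x \<in> W"
        proof (cases "s \<le> 1/2")
          case True
          then have "x = \<delta> (2 * s)" "2 * s \<in> {0..1}"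
            using s by (auto simp: path_concat_def)
          then show ?thesis using \<delta>(2) by blast
        next
          case False
          then have "x = \<epsilon> (2 * s - 1)" "2 * s - 1 \<in> {0..1}"
            using s by (auto simp: path_concat_def)
          then show ?thesis using \<epsilon>(2) by blast
        qed
      qed
    qed (use \<delta> \<epsilon> in \<open>auto intro: pathin_concat\<close>)
    ultimately show ?thesis
      by (simp add: p(2))
  qed
  show "\<exists>y'\<in>coset ` based_paths. endpoint y' = x \<and> adjacent y y'"
    if "W \<in> \<W>" "y \<in> coset ` based_paths" "endpoint y \<in> W" "x \<in> W" for W y x
  proof -
    obtain p where p: "p \<in> based_paths" "y = coset p"
      using \<open>y \<in> coset ` based_paths\<close> by blast
    obtain \<delta> where \<delta>: "pathin X \<delta>" "\<delta> ` {0..1} \<subseteq> W" "\<delta> 0 = p 1" "\<delta> 1 = x"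
      using path_within_W[OF \<open>W \<in> \<W>\<close> \<open>endpoint y \<in> W\<close> \<open>x \<in> W\<close>] p by auto
    have "p \<star> \<delta> \<in> based_paths"
      using p(1) \<delta>(1,3) by (rule based_paths_concat)
    moreover have "adjacent y (coset (p \<star> \<delta>))"
      unfolding p(2) by (rule adjacentI[OF p(1) \<delta>(1,3) \<open>W \<in> \<W>\<close> \<delta>(2)])
    ultimately show ?thesis
      using \<delta>(4) by (intro bexI[of _ "coset (p \<star> \<delta>)"]) auto
  qed
  \<comment> \<open>With equal endpoints the constant path is an admissible short path, and
    appending it does not change the coset.\<close>
  show "y = y'"
    if "y \<in> coset ` based_paths" and adj: "adjacent y y'" and eq: "endpoint y = endpoint y'" for y y'
  proof -
    obtain p \<delta> W where p: "p \<in> based_paths" "pathin X \<delta>" "\<delta> 0 = p 1" "W \<in> \<W>" "\<delta> ` {0..1} \<subseteq> W"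
        "y = coset p" "y' = coset (p \<star> \<delta>)"
      using adj unfolding adjacent_def by blast
    have W: "p 1 \<in> W" "p 1 \<in> topspace X"
      using p(3,5) based_path_end[OF p(1)] by force+
    have "rel (p \<star> (\<lambda>_. p 1)) p"
      using p W by (intro rel_homotopic based_paths_concat path_homotopic_concat_const) (auto simp: based_pathsD)
    then have "coset (p \<star> (\<lambda>_. p 1)) = coset p"
      using coset_eq_iff rel_def by blast
    moreover have "y' = coset (p \<star> (\<lambda>_. p 1))"
      using adjacentD[OF _ p(1), of y' "\<lambda>_. p 1" W] adj p(4,6) W eq endpoint_coset[OF p(1)] by auto
    ultimately show ?thesis
      by (simp add: p(6))
  qed
qed

section \<open>Lifts of loops and the image of the fundamental group\<close>

lemma initial_segment_based:
  assumes "\<alpha> \<in> based_paths" "t \<in> {0..1}"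
  shows "(\<lambda>s. \<alpha> (t * s)) \<in> based_paths"
  using pathin_reparam[of X \<alpha> "\<lambda>s. t * s"] assms
  by (auto simp: based_paths_def o_def mult_le_one intro!: continuous_intros)

text \<open>The classical lift: the point at time \<open>t\<close> is the class of the path up to
  \<open>t\<close>. Nearby times differ by a short piece of \<alpha>, which is an adjacency.\<close>

lemma lift_on_initial_segments:
  assumes \<alpha>: "\<alpha> \<in> based_paths"
  shows "lift_on {0..1} \<alpha> (\<lambda>t. coset (\<lambda>s. \<alpha> (t * s)))"
  unfolding lift_on_def
proof (intro ballI conjI)
  fix t :: real assume t: "t \<in> {0..1}"
  let ?p = "\<lambda>t s. \<alpha> (t * s)"
  show "coset (?p t) \<in> coset ` based_paths"
    using initial_segment_based[OF \<alpha> t] by blast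
  show "endpoint (coset (?p t)) = \<alpha> t"
    using initial_segment_based[OF \<alpha> t] by simp
  have "continuous_map (top_of_set {0..1}) X \<alpha>"
    using \<alpha> by (simp add: based_paths_def pathin_def)
  then have "small_on {0..1} \<alpha>"
    by (rule small_on_continuous)
  then obtain d W where d: "d > 0" "W \<in> \<W>" "\<And>t'. t' \<in> {0..1} \<Longrightarrow> dist t' t < d \<Longrightarrow> \<alpha> t' \<in> W"
    using t unfolding small_on_def by meson
  have "adjacent (coset (?p t)) (coset (?p t'))" if t': "t' \<in> {0..1}" "dist t' t < d" for t'
  proof -
    let ?\<delta> = "\<lambda>s. \<alpha> (t + s * (t' - t))"
    have I: "t + s * (t' - t) \<in> {0..1}" if "s \<in> {0..1}" for s
    proof -
      have "t + s * (t' - t) = (1 - s) * t + s * t'"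
        by (simp add: algebra_simps)
      moreover have "0 \<le> (1 - s) * t + s * t'" "(1 - s) * t + s * t' \<le> 1"
        using that t t' by (auto intro!: convex_bound_le)
      ultimately show ?thesis by simp
    qed
    have \<delta>: "pathin X ?\<delta>"
    proof -
      have "continuous_on {0..1} (\<lambda>s. t + s * (t' - t))"
        by (intro continuous_intros)
      then show ?thesis
        using pathin_reparam[OF based_pathsD(1)[OF \<alpha>]] I by (fastforce simp: o_def)
    qed
    have "\<alpha> (t + s * (t' - t)) \<in> W" if s: "s \<in> {0..1}" for s
    proof (rule d(3)[OF I[OF s]])
      have "\<bar>s\<bar> * \<bar>t' - t\<bar> \<le> 1 * \<bar>t' - t\<bar>"
        using s by (intro mult_right_mono) auto
      then show "dist (t + s * (t' - t)) t < d"
        using t'(2) by (simp add: dist_real_def abs_mult)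
    qed
    then have W: "?\<delta> ` {0..1} \<subseteq> W"
      by blast
    \<comment> \<open>Runs from 0 to \<open>t\<close> in the first half and from \<open>t\<close> to
      \<open>t'\<close> in the second, so that \<open>\<alpha> \<circ> ?f\<close> is the
      concatenation on the nose, and a reparametrisation of the segment up to
      \<open>t'\<close>.\<close>
    let ?f = "\<lambda>s. t * min (2 * s) 1 + max (2 * s - 1) 0 * (t' - t)"
    have f: "?f s \<in> {0..1}" if s: "s \<in> {0..1}" for s
    proof (cases "s \<le> 1/2")
      case True
      then show ?thesis using s t by (auto simp: mult_le_one)
    next
      case False
      then show ?thesis using s I[of "2 * s - 1"] by auto
    qed
    have "path_homotopic X (\<alpha> \<circ> ?f) (\<alpha> \<circ> (\<lambda>s. t' * s))"
      by (rule path_homotopic_reparam)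
        (use \<alpha> t' f in \<open>auto simp: based_paths_def mult_le_one intro!: continuous_intros\<close>)
    moreover have "(\<alpha> \<circ> ?f) s = (?p t \<star> ?\<delta>) s" for s
      by (cases "s \<le> 1/2") (simp_all add: path_concat_def)
    then have "\<alpha> \<circ> ?f = ?p t \<star> ?\<delta>" ..
    ultimately have "path_homotopic X (?p t \<star> ?\<delta>) (?p t')"
      by (simp add: o_def)
    moreover have "?p t \<star> ?\<delta> \<in> based_paths"
      using based_paths_concat[OF initial_segment_based[OF \<alpha> t] \<delta>] by simp
    ultimately have "coset (?p t \<star> ?\<delta>) = coset (?p t')"
      using rel_homotopic coset_eq_iff by simp
    then show ?thesis
      using adjacentI[OF initial_segment_based[OF \<alpha> t] \<delta> _ d(2) W] by simp
  qed
  then show "\<exists>d>0. \<forall>t'\<in>{0..1}. dist t' t < d \<longrightarrow> adjacent (coset (?p t)) (coset (?p t'))"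
    using d(1) by blast
qed

lemma coset_loop_iff:
  assumes "\<alpha> \<in> loops_at X x0"
  shows "coset \<alpha> = coset (\<lambda>_. x0) \<longleftrightarrow> path_class X \<alpha> \<in> H"
proof -
  have \<alpha>: "\<alpha> \<in> based_paths" "pathin X \<alpha>" "\<alpha> 1 = x0" "(\<lambda>_. x0) \<in> based_paths"
    using assms basepoint by (auto simp: based_paths_def loops_at_def)
  have "path_homotopic X (\<alpha> \<star> path_rev (\<lambda>_. x0)) \<alpha>"
    using path_homotopic_concat_const[OF \<alpha>(2,3)] by (simp add: path_rev_def)
  then show ?thesis
    using \<alpha> by (simp add: coset_eq_iff rel_def path_class_eq)
qed

text \<open>By uniqueness the lift is the one by initial segments, which ends at
  \<open>coset \<alpha>\<close>.\<close>

lemma closed_lift_iff: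
  assumes \<alpha>: "\<alpha> \<in> loops_at X x0" and lift: "lift_on {0..1} \<alpha> \<kappa>" "\<kappa> 0 = coset (\<lambda>_. x0)"
  shows "\<kappa> 1 = \<kappa> 0 \<longleftrightarrow> path_class X \<alpha> \<in> H"
proof -
  have \<alpha>': "\<alpha> \<in> based_paths" "\<alpha> 0 = x0"
    using \<alpha> by (auto simp: based_paths_def loops_at_def)
  have small: "small_on {0..1} \<alpha>"
    using \<alpha> by (intro small_on_continuous) (simp add: loops_at_def pathin_def)
  have "\<kappa> 1 = coset (\<lambda>s. \<alpha> (1 * s))"
    by (rule lift_on_unique[OF _ small lift(1) lift_on_initial_segments[OF \<alpha>'(1)], of 0])
      (use lift(2) \<alpha>'(2) in simp_all)
  then show ?thesis
    using lift(2) coset_loop_iff[OF \<alpha>] by simp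
qed

lemma covering_image_H: "covering_image TYPE((real \<Rightarrow> 'a) set) X x0 H"
proof -
  let ?y0 = "coset (\<lambda>_. x0)" and ?Y = sheet_topology
  have const: "(\<lambda>_. x0) \<in> based_paths"
    using basepoint by (simp add: based_paths_def)
  have "induced_hom X endpoint ` carrier (fundamental_group ?Y ?y0) = H"
  proof (intro equalityI subsetI)
    fix A assume "A \<in> induced_hom X endpoint ` carrier (fundamental_group ?Y ?y0)"
    then obtain \<beta> where \<beta>: "\<beta> \<in> loops_at ?Y ?y0" "A = induced_hom X endpoint (path_class ?Y \<beta>)"
      by (auto simp: carrier_fundamental_group)
    have cont: "continuous_map (top_of_set {0..1}) ?Y \<beta>"
      using \<beta>(1) by (simp add: loops_at_def pathin_def)
    have ends: "\<beta> 0 = ?y0" "\<beta> 1 = ?y0"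
      using \<beta>(1) by (auto simp: loops_at_def)
    have A: "A = path_class X (endpoint \<circ> \<beta>)"
      using \<beta> induced_hom_path_class[OF continuous_map_r] by (simp add: loops_at_def)
    have loop: "endpoint \<circ> \<beta> \<in> loops_at X x0"
      using loops_at_comp[OF continuous_map_r \<beta>(1)] endpoint_coset[OF const] by simp
    show "A \<in> H"
      using closed_lift_iff[OF loop lift_on_continuous[OF cont] ends(1)] ends A by simp
  next
    fix A assume A: "A \<in> H"
    then obtain \<alpha> where \<alpha>: "\<alpha> \<in> loops_at X x0" "A = path_class X \<alpha>"
      using subgroup.subset[OF subgroup_H] by (auto simp: carrier_fundamental_group)
    let ?\<beta> = "\<lambda>t. coset (\<lambda>s. \<alpha> (t * s))"
    have \<alpha>': "\<alpha> \<in> based_paths" "pathin X \<alpha>" "\<alpha> 0 = x0"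
      using \<alpha> by (auto simp: based_paths_def loops_at_def)
    note lift = lift_on_initial_segments[OF \<alpha>'(1)]
    have "continuous_map (top_of_set {0..1}) ?Y ?\<beta>"
      using continuous_lift[OF lift] \<alpha>' by (simp add: pathin_def)
    moreover have "?\<beta> 0 = ?y0" "?\<beta> 1 = ?y0"
      using \<alpha>' coset_loop_iff[OF \<alpha>(1)] \<alpha>(2) A by simp_all
    ultimately have \<beta>: "?\<beta> \<in> loops_at ?Y ?y0"
      by (simp add: loops_at_def pathin_def)
    have "path_homotopic X \<alpha> (endpoint \<circ> ?\<beta>)"
      by (rule path_homotopic_cong[OF \<alpha>'(2)]) (use lift_onD(2)[OF lift] in simp)
    then have "A = path_class X (endpoint \<circ> ?\<beta>)"
      by (simp add: \<alpha>(2) path_class_eq)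
    also have "\<dots> = induced_hom X endpoint (path_class ?Y ?\<beta>)"
      using \<beta> induced_hom_path_class[OF continuous_map_r] by (simp add: loops_at_def)
    finally show "A \<in> induced_hom X endpoint ` carrier (fundamental_group ?Y ?y0)"
      using \<beta> by (auto simp: carrier_fundamental_group)
  qed
  then show ?thesis
    unfolding covering_image_def using covering_map_sheet_topology const endpoint_coset[OF const]
    by (intro exI[of _ ?Y] exI[of _ ?y0] exI[of _ endpoint]) auto
qed

end

section \<open>Equivalence of the three conditions\<close>

context spanier_cover
begin

lemma null_in_nerve_imp_in_H:
  assumes i: "i \<in> shape_index X x0" and refines: "refines (fst i) \<W>"
    and p: "canonical_map X x0 i p" and \<alpha>: "\<alpha> \<in> loops_at X x0"
    and null: "path_homotopic (realization (nerve (fst i))) (p \<circ> \<alpha>) (\<lambda>_. vertex_point (snd i))"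
  shows "path_class X \<alpha> \<in> H"
proof -
  let ?R = "realization (nerve (fst i))" and ?I = "{0..1::real}"
  let ?v = "vertex_point (snd i) :: 'a set \<Rightarrow> real"
  have \<alpha>': "\<alpha> \<in> based_paths" "\<alpha> 0 = x0" "\<alpha> 1 = x0"
    using \<alpha> by (auto simp: based_paths_def loops_at_def)
  have px0: "p x0 = ?v"
    using p by (simp add: canonical_map_def)
  have x0_mem: "x0 \<in> snd i"
    using i by (auto simp: shape_index_def)
  obtain h where h: "continuous_map (prod_topology (top_of_set ?I) (top_of_set ?I)) ?R h"
      "\<And>s. h (0, s) = p (\<alpha> s)" "\<And>s. h (1, s) = ?v"
      "\<And>t. t \<in> ?I \<Longrightarrow> h (t, 0) = ?v" "\<And>t. t \<in> ?I \<Longrightarrow> h (t, 1) = ?v"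
    using null unfolding path_homotopic_iff by (auto simp: \<alpha>' px0)
  have eq: "prod_topology (top_of_set ?I) (top_of_set ?I) = top_of_set (?I \<times> ?I)"
    by (auto simp: prod_topology_subtopology subtopology_subtopology Times_Int_Times)
  note h_cont = h(1)[unfolded eq]
  have h_point: "h z \<in> realization_points (nerve (fst i))" if "z \<in> ?I \<times> ?I" for z
    using h_cont that by (auto simp: continuous_map_def)
  \<comment> \<open>Any point of the intersection would do, except that the base vertex must go to
    \<open>x0\<close>: then \<open>k\<close> is constant on the three edges where \<open>h\<close>
    is.\<close>
  define c where "c b = (if b = ?v then x0 else SOME x. x \<in> \<Inter>(bary_support b))" for b
  have c: "c b \<in> V" if b: "b \<in> realization_points (nerve (fst i))" "V \<in> bary_support b" for b V
  proof (cases "b = ?v")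
    case True
    then show ?thesis
      using b(2) x0_mem by (auto simp: c_def bary_support_def vertex_point_def split: if_splits)
  next
    case False
    have "\<exists>x. x \<in> \<Inter>(bary_support b)"
      using realization_pointsD(2)[OF b(1)] by (auto simp: nerve_def)
    then have "(SOME x. x \<in> \<Inter>(bary_support b)) \<in> \<Inter>(bary_support b)"
      by (rule someI_ex)
    then show ?thesis
      using False b(2) by (simp add: c_def)
  qed
  \<comment> \<open>\<open>k\<close> need not be continuous, but near \<open>z\<close> it stays in every vertex \<open>V\<close> of the carrier of \<open>h z\<close>.\<close>
  define k where "k z = (if fst z = 0 then \<alpha> (snd z) else c (h z))" for z
  \<comment> \<open>On the edge \<open>fst z = 0\<close> the function is \<alpha> itself, so that
    the lift there is the lift of \<alpha>; membership in \<open>V\<close> then comes from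
    canonicity of \<open>p\<close> instead of the choice \<open>c\<close>.\<close>
  have k_mem: "k z \<in> V" if z: "z \<in> ?I \<times> ?I" and V: "V \<in> bary_support (h z)" for z V
  proof (cases "fst z = 0")
    case True
    have "\<alpha> (snd z) \<in> topspace X"
      using \<alpha> z by (auto simp: loops_at_def pathin_def continuous_map_def)
    moreover have "h z = p (\<alpha> (snd z))"
      using h(2)[of "snd z"] True by (metis prod.collapse)
    ultimately show ?thesis
      using canonical_map_support(2)[OF p] V True by (simp add: k_def)
  next
    case False
    then show ?thesis
      using c[OF h_point[OF z] V] by (simp add: k_def)
  qed
  have "small_on (?I \<times> ?I) k"
    unfolding small_on_def
  proof
    fix z assume z: "z \<in> ?I \<times> ?I"
    have "bary_support (h z) \<in> nerve (fst i)"
      using h_point[OF z] by (rule realization_pointsD)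
    then obtain V where V: "V \<in> bary_support (h z)" "V \<in> fst i"
      by (auto simp: nerve_def)
    then obtain W where W: "W \<in> \<W>" "V \<subseteq> W"
      using refines by (auto simp: refines_def)
    have "openin (top_of_set (?I \<times> ?I)) {z' \<in> ?I \<times> ?I. h z' \<in> open_star (nerve (fst i)) V}"
      using openin_continuous_map_preimage[OF h_cont nerve.openin_open_star] by simp
    moreover have "h z \<in> open_star (nerve (fst i)) V"
      using h_point[OF z] V(1) by (simp add: open_star_def bary_support_def)
    ultimately have "\<exists>d>0. \<forall>z'\<in>?I \<times> ?I. dist z' z < d \<longrightarrow>
        z' \<in> {z' \<in> ?I \<times> ?I. h z' \<in> open_star (nerve (fst i)) V}"
      using z unfolding openin_euclidean_subtopology_iff by blast
    then obtain d where d: "d > 0"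
      "\<And>z'. z' \<in> ?I \<times> ?I \<Longrightarrow> dist z' z < d \<Longrightarrow> h z' \<in> open_star (nerve (fst i)) V"
      by blast
    have "k z' \<in> W" if "z' \<in> ?I \<times> ?I" "dist z' z < d" for z'
    proof -
      have "V \<in> bary_support (h z')"
        using d(2)[OF that] by (simp add: open_star_def bary_support_def)
      then show ?thesis
        using k_mem[OF that(1)] W(2) by blast
    qed
    then show "\<exists>d>0. \<exists>W\<in>\<W>. \<forall>z'\<in>?I \<times> ?I. dist z' z < d \<longrightarrow> k z' \<in> W"
      using d(1) W(1) by blast
  qed
  moreover have "k (t, 0) = x0" "k (t, 1) = x0" if "t \<in> ?I" for t
    using that h(4,5) \<alpha>' by (auto simp: k_def c_def)
  moreover have "k (1, s) = x0" for s
    using h(3) by (simp add: k_def c_def)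
  moreover have lift: "lift_on ?I \<alpha> (\<lambda>t. coset (\<lambda>s. \<alpha> (t * s)))"
    by (rule lift_on_initial_segments[OF \<alpha>'(1)])
  then have "lift_on ?I (\<lambda>s. k (0, s)) (\<lambda>t. coset (\<lambda>s. \<alpha> (t * s)))"
    by (simp add: k_def)
  ultimately have "coset (\<lambda>s. \<alpha> (1 * s)) = coset (\<lambda>s. \<alpha> (0 * s))"
    by (rule lift_of_null_loop_closed)
  then show ?thesis
    using closed_lift_iff[OF \<alpha> lift] \<alpha>' by simp
qed

text \<open>One coordinate suffices: if \<alpha> and \<beta> have the same class in the nerve of a
  refinement of \<W>, then \<open>\<beta> \<star> path_rev \<alpha>\<close> is null there, so
  \<alpha> and \<beta> define the same coset.\<close>

lemma openin_shape_topology_H: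
  assumes X: "paracompact_space X" "Hausdorff_space X"
  shows "openin (shape_topology X x0) H"
proof -
  obtain i where i: "i \<in> shape_index X x0" "refines (fst i) \<W>"
    using shape_index_refining[OF X basepoint cover_W] by blast
  obtain p where p: "canonical_map X x0 i p"
    using canonical_map_exists[OF i(1) basepoint] by blast
  let ?R = "realization (nerve (fst i))"
  have "path_class X \<beta> \<in> H"
    if \<alpha>: "\<alpha> \<in> loops_at X x0" "path_class X \<alpha> \<in> H" and \<beta>: "\<beta> \<in> loops_at X x0"
      and eq: "shape_hom X x0 (path_class X \<beta>) i = shape_hom X x0 (path_class X \<alpha>) i" for \<alpha> \<beta>
  proof -
    let ?v = "vertex_point (snd i) :: 'a set \<Rightarrow> real"
    have p\<alpha>: "pathin ?R (p \<circ> \<alpha>)" "(p \<circ> \<alpha>) 0 = ?v" "(p \<circ> \<alpha>) 1 = ?v"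
      using canonical_map_loop[OF p \<alpha>(1)] by (auto simp: loops_at_def)
    have "path_homotopic ?R (p \<circ> \<beta>) (p \<circ> \<alpha>)"
      using eq shape_hom_path_class[OF i(1) p] \<alpha>(1) \<beta> path_class_eq_iff[OF p\<alpha>(1)] by simp
    then have "path_homotopic ?R (p \<circ> (\<beta> \<star> path_rev \<alpha>)) ((p \<circ> \<alpha>) \<star> path_rev (p \<circ> \<alpha>))"
      unfolding comp_path_concat comp_path_rev
      by (rule path_homotopic_concat)
        (use p\<alpha> canonical_map_loop[OF p \<beta>] in \<open>auto simp: path_homotopic_refl pathin_rev loops_at_def\<close>)
    also have "path_homotopic ?R \<dots> (\<lambda>_. ?v)"
      using path_homotopic_concat_rev[OF p\<alpha>(1)] p\<alpha>(2) by simp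
    finally have "path_class X (\<beta> \<star> path_rev \<alpha>) \<in> H"
      using null_in_nerve_imp_in_H[OF i p] \<alpha>(1) \<beta> by (simp add: loops_at_concat loops_at_rev)
    then have "rel \<beta> \<alpha>"
      using \<alpha>(1) \<beta> by (simp add: rel_def based_paths_def loops_at_def)
    then have "coset \<beta> = coset \<alpha>"
      using coset_eq_iff by (auto simp: rel_def)
    then show ?thesis
      using coset_loop_iff[OF \<alpha>(1)] coset_loop_iff[OF \<beta>] \<alpha>(2) by simp
  qed
  then show ?thesis
    unfolding openin_shape_topology_iff[OF basepoint subgroup.subset[OF subgroup_H]]
    using i(1) by (intro ballI impI exI[of _ "{i}"]) auto
qed

end

text \<open>Containment of unions of meeting members passes to smaller sets, so the barycentric
  refinement may be cut down to path connected open sets.\<close>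

lemma spanier_cover_exists:
  assumes X: "path_connected_space X" "locally_path_connected_space X"
      "paracompact_space X" "Hausdorff_space X"
    and x0: "x0 \<in> topspace X" and H: "subgroup H (fundamental_group X x0)"
    and \<U>: "open_cover X \<U>" "spanier_group X \<U> x0 \<subseteq> H"
  obtains \<W> where "spanier_cover X x0 H \<W>"
proof -
  obtain \<V> where \<V>: "open_cover X \<V>"
    "\<And>V V'. V \<in> \<V> \<Longrightarrow> V' \<in> \<V> \<Longrightarrow> V \<inter> V' \<noteq> {} \<Longrightarrow> \<exists>U\<in>\<U>. V \<union> V' \<subseteq> U"
    using barycentric_refinement[OF X(3,4) \<U>(1)] by metis
  define \<W> where "\<W> = {W. openin X W \<and> path_connectedin X W \<and> (\<exists>V\<in>\<V>. W \<subseteq> V)}"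
  have "spanier_cover X x0 H \<W>"
  proof (rule spanier_cover.intro)
    have "\<exists>W\<in>\<W>. x \<in> W" if x: "x \<in> topspace X" for x
    proof -
      obtain V where V: "V \<in> \<V>" "x \<in> V" "openin X V"
        using \<V>(1) x by (auto simp: open_cover_def)
      then obtain W where "openin X W" "path_connectedin X W" "x \<in> W" "W \<subseteq> V"
        using X(2) unfolding locally_path_connected_space by blast
      then show ?thesis
        using V(1) unfolding \<W>_def by blast
    qed
    then show "open_cover X \<W>"
      unfolding open_cover_def using openin_subset by (fastforce simp: \<W>_def)
  next
    fix W W' \<alpha> \<gamma>
    assume W: "W \<in> \<W>" "W' \<in> \<W>" "W \<inter> W' \<noteq> {}"
      and \<alpha>: "pathin X \<alpha>" "\<alpha> 0 = x0" and \<gamma>: "\<gamma> \<in> loops_at X (\<alpha> 1)" "\<gamma> ` {0..1} \<subseteq> W \<union> W'"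
    obtain V V' where V: "V \<in> \<V>" "W \<subseteq> V" "V' \<in> \<V>" "W' \<subseteq> V'"
      using W(1,2) unfolding \<W>_def by blast
    then have "V \<inter> V' \<noteq> {}"
      using W(3) by blast
    then obtain U where U: "U \<in> \<U>" "V \<union> V' \<subseteq> U"
      using \<V>(2) V by blast
    then have "\<gamma> ` {0..1} \<subseteq> U"
      using \<gamma>(2) V by blast
    then have "path_class X ((\<alpha> \<star> \<gamma>) \<star> path_rev \<alpha>) \<in> spanier_group X \<U> x0"
      unfolding spanier_group_def using \<alpha> \<gamma>(1) U(1) by (intro generate.incl) blast
    then show "path_class X ((\<alpha> \<star> \<gamma>) \<star> path_rev \<alpha>) \<in> H"
      using \<U>(2) by blast
  qed (use X(1) x0 H in \<open>auto simp: \<W>_def\<close>)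
  then show thesis
    by (rule that)
qed

section \<open>Path lifting in covering spaces\<close>

definition evenly_covered :: "'b topology \<Rightarrow> 'a topology \<Rightarrow> ('b \<Rightarrow> 'a) \<Rightarrow> 'a set \<Rightarrow> bool"
  where "evenly_covered Y X r T \<longleftrightarrow> openin X T \<and>
    (\<exists>\<V>. \<Union>\<V> = {y \<in> topspace Y. r y \<in> T} \<and> (\<forall>V\<in>\<V>. openin Y V) \<and> pairwise disjnt \<V> \<and>
      (\<forall>V\<in>\<V>. homeomorphic_map (subtopology Y V) (subtopology X T) r))"

text \<open>The inverse of \<open>r\<close> on the slice through \<open>y\<close>. A map with image
  in \<open>T\<close> is lifted by composing with it.\<close>

lemma evenly_covered_section:
  assumes T: "evenly_covered Y X r T" and y: "y \<in> topspace Y" "r y \<in> T"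
  obtains g where "continuous_map (subtopology X T) Y g" "g (r y) = y" "\<And>x. x \<in> T \<Longrightarrow> r (g x) = x"
proof -
  obtain V where V: "openin Y V" "y \<in> V" and hom: "homeomorphic_map (subtopology Y V) (subtopology X T) r"
    using T y unfolding evenly_covered_def by blast
  obtain g where g: "homeomorphic_maps (subtopology Y V) (subtopology X T) r g"
    using hom homeomorphic_map_maps by blast
  have T': "T \<subseteq> topspace X" "y \<in> topspace Y \<inter> V"
    using T V(2) y(1) openin_subset by (auto simp: evenly_covered_def)
  show thesis
  proof
    show "continuous_map (subtopology X T) Y g"
      using g by (simp add: homeomorphic_maps_def continuous_map_in_subtopology)
    show "g (r y) = y"
      using g T' by (simp add: homeomorphic_maps_def)
    show "r (g x) = x" if "x \<in> T" for x
      using g T' that by (auto simp: homeomorphic_maps_def)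
  qed
qed

lemma covering_map_evenly_covered:
  assumes "covering_map Y X r" "x \<in> topspace X"
  obtains T where "evenly_covered Y X r T" "x \<in> T"
proof -
  have "\<forall>x\<in>topspace X. \<exists>T. evenly_covered Y X r T \<and> x \<in> T"
    using assms(1) unfolding covering_map_def evenly_covered_def by meson
  then show thesis
    using assms(2) that by blast
qed

text \<open>Bisection of the interval; the predicate allows every start in the fibre over the left
  end, so that a second lift can begin where the first one ends.\<close>

lemma covering_map_path_lift:
  assumes cov: "covering_map Y X r" and \<alpha>: "pathin X \<alpha>" and y: "y \<in> topspace Y" "r y = \<alpha> 0"
  obtains \<beta> where "pathin Y \<beta>" "\<beta> 0 = y" "\<And>t. t \<in> {0..1} \<Longrightarrow> r (\<beta> t) = \<alpha> t"
proof -
  let ?lift = "\<lambda>a b y \<beta>. continuous_map (top_of_set {a..b}) Y \<beta> \<and> \<beta> a = y \<and> (\<forall>t\<in>{a..b}. r (\<beta> t) = \<alpha> t)"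
  let ?P = "\<lambda>a b::real. 0 \<le> a \<and> b \<le> 1 \<longrightarrow> (\<forall>y\<in>topspace Y. r y = \<alpha> a \<longrightarrow> (\<exists>\<beta>. ?lift a b y \<beta>))"
  have "?P 0 1"
  proof (rule Bolzano[where P = ?P])
    fix a b c :: real assume P: "?P a b" "?P b c" and le: "a \<le> b" "b \<le> c"
    show "?P a c"
    proof (intro impI ballI)
      fix y assume ac: "0 \<le> a \<and> c \<le> 1" and y: "y \<in> topspace Y" "r y = \<alpha> a"
      have "\<forall>y\<in>topspace Y. r y = \<alpha> a \<longrightarrow> (\<exists>\<beta>. ?lift a b y \<beta>)"
        by (rule mp[OF P(1)]) (use ac le in linarith)
      from mp[OF bspec[OF this y(1)] y(2)] obtain \<beta>1 where \<beta>1: "?lift a b y \<beta>1" ..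
      have b: "\<beta>1 b \<in> topspace Y" "r (\<beta>1 b) = \<alpha> b"
        using \<beta>1 le by (auto simp: continuous_map_def)
      have "\<forall>y\<in>topspace Y. r y = \<alpha> b \<longrightarrow> (\<exists>\<beta>. ?lift b c y \<beta>)"
        by (rule mp[OF P(2)]) (use ac le in linarith)
      from mp[OF bspec[OF this b(1)] b(2)] obtain \<beta>2 where \<beta>2: "?lift b c (\<beta>1 b) \<beta>2" ..
      have halves: "subtopology (top_of_set {a..c}) {x \<in> topspace (top_of_set {a..c}). x \<le> b} = top_of_set {a..b}"
        "subtopology (top_of_set {a..c}) {x \<in> topspace (top_of_set {a..c}). b \<le> x} = top_of_set {b..c}"
        unfolding subtopology_subtopology
        by (rule arg_cong[where f = top_of_set], use le in auto)+
      have "continuous_map (top_of_set {a..c}) Y (\<lambda>t. if t \<le> b then \<beta>1 t else \<beta>2 t)"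
      proof (rule continuous_map_cases_le)
        show "continuous_map (subtopology (top_of_set {a..c}) {x \<in> topspace (top_of_set {a..c}). x \<le> b}) Y \<beta>1"
          unfolding halves using \<beta>1 by blast
        show "continuous_map (subtopology (top_of_set {a..c}) {x \<in> topspace (top_of_set {a..c}). b \<le> x}) Y \<beta>2"
          unfolding halves using \<beta>2 by blast
      qed (use \<beta>2 in auto)
      then show "\<exists>\<beta>. ?lift a c y \<beta>"
        using \<beta>1 \<beta>2 le by (intro exI[of _ "\<lambda>t. if t \<le> b then \<beta>1 t else \<beta>2 t"]) auto
    qed
  next
    fix x :: real assume x: "0 \<le> x" "x \<le> 1"
    have cont: "continuous_map (top_of_set {0..1}) X \<alpha>"
      using \<alpha> by (simp add: pathin_def)
    then have "\<alpha> x \<in> topspace X"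
      using x by (auto simp: continuous_map_def)
    then obtain T where T: "evenly_covered Y X r T" "\<alpha> x \<in> T"
      by (rule covering_map_evenly_covered[OF cov])
    then have "openin (top_of_set {0..1}) {t \<in> {0..1}. \<alpha> t \<in> T}"
      using openin_continuous_map_preimage[OF cont, of T] by (simp add: evenly_covered_def)
    then obtain d where d: "d > 0" "\<And>t. t \<in> {0..1} \<Longrightarrow> dist t x < d \<Longrightarrow> \<alpha> t \<in> T"
      using x T(2) unfolding openin_euclidean_subtopology_iff by auto
    have "\<exists>\<beta>. ?lift a b y \<beta>"
      if ab: "a \<le> x" "x \<le> b" "b - a < d" "0 \<le> a" "b \<le> 1" and y: "y \<in> topspace Y" "r y = \<alpha> a" for a b y
    proof -
      have \<alpha>T: "\<alpha> t \<in> T" if "t \<in> {a..b}" for t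
        using that ab by (intro d(2)) (auto simp: dist_real_def)
      then have "r y \<in> T"
        using y(2) ab by simp
      then obtain g where g: "continuous_map (subtopology X T) Y g" "g (r y) = y" "\<And>x. x \<in> T \<Longrightarrow> r (g x) = x"
        using evenly_covered_section[OF T(1) y(1)] by blast
      have "continuous_map (top_of_set {a..b}) X \<alpha>"
        using continuous_map_from_subtopology[OF cont, of "{a..b}"] ab
        by (simp add: subtopology_subtopology Int_absorb1)
      then have "continuous_map (top_of_set {a..b}) (subtopology X T) \<alpha>"
        using \<alpha>T by (auto simp: continuous_map_in_subtopology)
      then have "continuous_map (top_of_set {a..b}) Y (g \<circ> \<alpha>)"
        using g(1) by (rule continuous_map_compose)
      then show ?thesis
        using g(2,3) y(2) \<alpha>T by (intro exI[of _ "g \<circ> \<alpha>"]) auto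
    qed
    then show "\<exists>d>0. \<forall>a b. a \<le> x \<and> x \<le> b \<and> b - a < d \<longrightarrow> ?P a b"
      using d(1) by (intro exI[of _ d]) blast
  qed simp
  then obtain \<beta> where "?lift 0 1 y \<beta>"
    using y by auto
  then show thesis
    by (intro that[of \<beta>]) (auto simp: pathin_def)
qed

lemma covering_image_imp_spanier_subset:
  assumes x0: "x0 \<in> topspace X" and H: "subgroup H (fundamental_group X x0)"
    and cov: "covering_image TYPE('b) X x0 H"
  shows "\<exists>\<U>. open_cover X \<U> \<and> spanier_group X \<U> x0 \<subseteq> H"
proof -
  obtain Y :: "'b topology" and y0 r where r: "covering_map Y X r" and y0: "y0 \<in> topspace Y" "r y0 = x0"
    and H_eq: "induced_hom X r ` carrier (fundamental_group Y y0) = H"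
    using cov unfolding covering_image_def by blast
  have r_cont: "continuous_map Y X r"
    using r by (simp add: covering_map_def)
  let ?\<U> = "{T. evenly_covered Y X r T}"
  have "x \<in> \<Union>?\<U>" if "x \<in> topspace X" for x
    using covering_map_evenly_covered[OF r that] by blast
  then have "open_cover X ?\<U>"
    unfolding open_cover_def using openin_subset by (fastforce simp: evenly_covered_def)
  moreover have "spanier_group X ?\<U> x0 \<subseteq> H"
  proof (rule spanier_group_subset[OF x0 H])
    fix \<alpha> \<gamma> T
    assume \<alpha>: "pathin X \<alpha>" "\<alpha> 0 = x0" and \<gamma>: "\<gamma> \<in> loops_at X (\<alpha> 1)" and T: "T \<in> ?\<U>" "\<gamma> ` {0..1} \<subseteq> T"
    have \<gamma>': "pathin X \<gamma>" "\<gamma> 0 = \<alpha> 1" "\<gamma> 1 = \<alpha> 1"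
      using \<gamma> by (auto simp: loops_at_def)
    obtain \<beta> where \<beta>: "pathin Y \<beta>" "\<beta> 0 = y0" "\<And>t. t \<in> {0..1} \<Longrightarrow> r (\<beta> t) = \<alpha> t"
      using covering_map_path_lift[OF r \<alpha>(1) y0(1)] y0(2) \<alpha>(2) by metis
    have \<beta>1: "\<beta> 1 \<in> topspace Y" "r (\<beta> 1) = \<gamma> 0"
      using \<beta>(1) \<beta>(3)[of 1] \<gamma>'(2) by (auto simp: pathin_def continuous_map_def)
    have T_mem: "\<gamma> s \<in> T" if "s \<in> {0..1}" for s
      using T(2) that by blast
    obtain g where g: "continuous_map (subtopology X T) Y g" "g (r (\<beta> 1)) = \<beta> 1" "\<And>x. x \<in> T \<Longrightarrow> r (g x) = x"
      using evenly_covered_section[of Y X r T "\<beta> 1"] T(1) \<beta>1 T_mem[of 0] by auto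
    have "continuous_map (top_of_set {0..1}) (subtopology X T) \<gamma>"
      using \<gamma>'(1) T_mem by (auto simp: pathin_def continuous_map_in_subtopology)
    then have g\<gamma>: "pathin Y (g \<circ> \<gamma>)"
      unfolding pathin_def using g(1) by (rule continuous_map_compose)
    have g\<gamma>_ends: "(g \<circ> \<gamma>) 0 = \<beta> 1" "(g \<circ> \<gamma>) 1 = \<beta> 1"
      using g(2) \<beta>1(2) \<gamma>' by auto
    \<comment> \<open>The section carries the small loop \<gamma> to a loop, so the return along
      \<beta> ends at \<open>y0\<close>. The projection of this loop agrees with the conjugate only
      on \<open>{0..1}\<close>, hence the homotopies below.\<close>
    let ?\<mu> = "(\<beta> \<star> (g \<circ> \<gamma>)) \<star> path_rev \<beta>"
    have \<mu>: "?\<mu> \<in> loops_at Y y0"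
      using \<beta>(1,2) g\<gamma> g\<gamma>_ends by (intro path_class_conjugate_loop) (auto simp: loops_at_def)
    have "path_homotopic X \<alpha> (r \<circ> \<beta>)" "path_homotopic X \<gamma> (r \<circ> (g \<circ> \<gamma>))"
      using \<alpha>(1) \<gamma>'(1) \<beta>(3) g(3) T_mem by (auto intro!: path_homotopic_cong)
    moreover have "path_homotopic X (path_rev \<alpha>) (path_rev (r \<circ> \<beta>))"
      by (rule path_homotopic_cong[OF pathin_rev[OF \<alpha>(1)]]) (use \<beta>(3) in \<open>auto simp: path_rev_def\<close>)
    ultimately
    have "path_homotopic X ((\<alpha> \<star> \<gamma>) \<star> path_rev \<alpha>) (r \<circ> ?\<mu>)"
      unfolding comp_path_concat comp_path_rev
      by (intro path_homotopic_concat) (use \<gamma>' in auto)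
    then have "path_class X ((\<alpha> \<star> \<gamma>) \<star> path_rev \<alpha>) = induced_hom X r (path_class Y ?\<mu>)"
      using \<mu> by (simp add: induced_hom_path_class[OF r_cont] loops_at_def path_class_eq)
    then show "path_class X ((\<alpha> \<star> \<gamma>) \<star> path_rev \<alpha>) \<in> H"
      using \<mu> H_eq by (auto simp: carrier_fundamental_group)
  qed
  ultimately show ?thesis
    by blast
qed

text \<open>Condition (3) appears at two types: the coset type provides a covering for each open
  \<open>H\<close>, and the last conjunct, with \<open>'b\<close> arbitrary, gives the converse for
  coverings with points of any type.\<close>

theorem theorem46:
  fixes X :: "'a topology" and x0 :: 'a and H :: "(real \<Rightarrow> 'a) set set"
  assumes "path_connected_space X" and "locally_path_connected_space X"
    and "paracompact_space X" and "Hausdorff_space X"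
    and "x0 \<in> topspace X"
    and "subgroup H (fundamental_group X x0)"
  shows "(openin (shape_topology X x0) H \<longleftrightarrow>
            (\<exists>\<U>. open_cover X \<U> \<and> spanier_group X \<U> x0 \<subseteq> H)) \<and>
         (openin (shape_topology X x0) H \<longleftrightarrow> covering_image TYPE((real \<Rightarrow> 'a) set) X x0 H) \<and>
         (covering_image TYPE('b) X x0 H \<longrightarrow> openin (shape_topology X x0) H)"
proof -
  let ?spanier = "\<exists>\<U>. open_cover X \<U> \<and> spanier_group X \<U> x0 \<subseteq> H"
  have "openin (shape_topology X x0) H \<and> covering_image TYPE((real \<Rightarrow> 'a) set) X x0 H" if sp: ?spanier
  proof -
    obtain \<U> where \<U>: "open_cover X \<U>" "spanier_group X \<U> x0 \<subseteq> H"
      using sp by blast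
    obtain \<W> where "spanier_cover X x0 H \<W>"
      using spanier_cover_exists[OF assms \<U>] .
    then interpret spanier_cover X x0 H \<W> .
    show ?thesis
      using openin_shape_topology_H[OF assms(3,4)] covering_image_H by blast
  qed
  moreover have ?spanier if "openin (shape_topology X x0) H"
    using openin_shape_topology_imp_spanier_subset[OF assms(5,6) that] .
  moreover have ?spanier if "covering_image TYPE((real \<Rightarrow> 'a) set) X x0 H"
    using covering_image_imp_spanier_subset[OF assms(5,6) that] .
  moreover have ?spanier if "covering_image TYPE('b) X x0 H"
    using covering_image_imp_spanier_subset[OF assms(5,6) that] .
  ultimately show ?thesis
    by blast
qed

end
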